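(* Let $N\in[1,\infty)$ and let $(X,d,m)$ be a geodesic metric measure space in which $\mathscr{E}_N$ is strongly displacement convex. Then for every continuous function $u\colon X\to\mathbb{R}$, every upper gradient $g$ of $u$, every point $x\in X$ and every radius $r>0$, \[ \frac{1}{m(B(x,r))}\int_{B(x,r)}|u-\langle u\rangle_{B(x,r)}|\,dm \le 2^{N+2}\,r\;\frac{1}{m(B(x,2r))}\int_{B(x,2r)}g\,dm . \]
   Context: Standing assumptions: $(X,d,m)$ is a metric measure space, $(X,d)$ is a complete geodesic metric space, $m$ is a Borel measure on $X$ with support $X$. $B(x,r)=\{y : d(x,y)<r\}$, and $\langle u\rangle_{B} = \frac{1}{m(B)}\int_B u\,dm$ is the average of $u$ over the ball $B$ (averages presuppose $0<m(B)<\infty$). Upper gradient: a Borel function $g\colon X \to [0,\infty]$ is an upper gradient of $u$ if for every constant speed curve $\gamma\colon[0,1]\to X$ with length $l(\gamma)<\infty$ one has $|u(\gamma(0))-u(\gamma(1))| \le l(\gamma)\int_0^1 g(\gamma(t))\,dt$. Wasserstein space: $\mathcal{P}(X)$ is the set of Borel probability measures on $X$, and $W_2(\mu,\nu) = \left(\inf_\sigma \int_{X\times X} d(x,y)^2\,d\sigma(x,y)\right)^{1/2}$ (possibly $+\infty$), the infimum being over $\sigma\in\mathcal{P}(X\times X)$ with first marginal $\mu$ and second marginal $\nu$. $\operatorname{Geo}(\mathcal{P}(X))$ is the set of constant speed geodesics of $(\mathcal{P}(X),W_2)$, i.e. continuous $\Gamma\colon[0,1]\to\mathcal{P}(X)$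 with $W_2(\Gamma(t),\Gamma(s))=|t-s|W_2(\Gamma(0),\Gamma(1))<\infty$ for all $s,t\in[0,1]$. Entropy: for $\mu\in\mathcal{P}(X)$ with Lebesgue decomposition $\mu=\rho m+\mu^\perp$ with respect to $m$, the Rényi entropy functional is $\mathscr{E}_N(\mu)=-\int_X\rho^{1-1/N}\,dm$ (the integrand being $0$ where $\rho=0$). Strong displacement convexity: a functional $\mathscr{F}\colon\mathcal{P}(X)\to\mathbb{R}\cup\{-\infty,\infty\}$ is strongly displacement convex if for every $\Gamma\in\operatorname{Geo}(\mathcal{P}(X))$ and all $s\in[0,1]$, $\mathscr{F}(\Gamma(s))\le(1-s)\mathscr{F}(\Gamma(0))+s\mathscr{F}(\Gamma(1))$. *)

theory Defs
  imports "HOL-Probability.Probability"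
begin

text \<open>
  The space \<open>X\<close> is a type of class \<open>metric_space\<close>; a Borel measure on it is a measure \<open>m\<close> with
  \<open>sets m = sets borel\<close>. Curves are functions on \<open>real\<close> of which only the values on \<open>{0..1}\<close>
  matter.
\<close>

definition measure_support :: "'a::topological_space measure \<Rightarrow> 'a set" where
  "measure_support m = {x. \<forall>U. open U \<longrightarrow> x \<in> U \<longrightarrow> 0 < emeasure m U}"

definition geodesic_space :: "'a::metric_space set \<Rightarrow> bool" where
  "geodesic_space X \<longleftrightarrow>
     (\<forall>x\<in>X. \<forall>y\<in>X. \<exists>\<gamma>::real \<Rightarrow> 'a. \<gamma> ` {0..1} \<subseteq> X \<and> \<gamma> 0 = x \<and> \<gamma> 1 = y \<and>
        (\<forall>s\<in>{0..1}. \<forall>t\<in>{0..1}. dist (\<gamma> s) (\<gamma> t) = \<bar>s - t\<bar> * dist x y))"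

text \<open>Length of the restriction of \<open>\<gamma>\<close> to \<open>{a..b}\<close>; the supremum is over all partitions
  \<open>a \<le> p 0 \<le> \<dots> \<le> p n \<le> b\<close>.\<close>

definition curve_length :: "(real \<Rightarrow> 'a::metric_space) \<Rightarrow> real \<Rightarrow> real \<Rightarrow> ennreal" where
  "curve_length \<gamma> a b =
     (SUP (n, p) \<in> {(n::nat, p::nat \<Rightarrow> real). mono_on {..n} p \<and> p ` {..n} \<subseteq> {a..b}}.
        \<Sum>i<n. ennreal (dist (\<gamma> (p i)) (\<gamma> (p (Suc i)))))"

definition constant_speed_curve :: "(real \<Rightarrow> 'a::metric_space) \<Rightarrow> bool" where
  "constant_speed_curve \<gamma> \<longleftrightarrow>
     continuous_on {0..1} \<gamma> \<and>
     (\<forall>s t. 0 \<le> s \<longrightarrow> s \<le> t \<longrightarrow> t \<le> 1 \<longrightarrow>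
        curve_length \<gamma> s t = ennreal (t - s) * curve_length \<gamma> 0 1)"

definition upper_gradient :: "('a::metric_space \<Rightarrow> real) \<Rightarrow> ('a \<Rightarrow> ennreal) \<Rightarrow> bool" where
  "upper_gradient u g \<longleftrightarrow>
     g \<in> borel_measurable borel \<and>
     (\<forall>\<gamma>. constant_speed_curve \<gamma> \<longrightarrow> curve_length \<gamma> 0 1 < \<infinity> \<longrightarrow>
        ennreal \<bar>u (\<gamma> 0) - u (\<gamma> 1)\<bar>
          \<le> curve_length \<gamma> 0 1 * (\<integral>\<^sup>+t\<in>{0..1}. g (\<gamma> t) \<partial>lborel))"

definition borel_probs :: "'a::topological_space measure set" where
  "borel_probs = {\<mu>. prob_space \<mu> \<and> sets \<mu> = sets borel}"

definition couplings ::
    "'a::topological_space measure \<Rightarrow> 'a measure \<Rightarrow> ('a \<times> 'a) measure set" where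
  "couplings \<mu> \<nu> = {\<sigma> \<in> borel_probs. distr \<sigma> borel fst = \<mu> \<and> distr \<sigma> borel snd = \<nu>}"

definition ennreal_sqrt :: "ennreal \<Rightarrow> ennreal" where
  "ennreal_sqrt a = (if a = \<infinity> then \<infinity> else ennreal (sqrt (enn2real a)))"

definition W2 :: "'a::metric_space measure \<Rightarrow> 'a measure \<Rightarrow> ennreal" where
  "W2 \<mu> \<nu> =
     ennreal_sqrt (INF \<sigma>\<in>couplings \<mu> \<nu>. \<integral>\<^sup>+z. ennreal ((dist (fst z) (snd z))\<^sup>2) \<partial>\<sigma>)"

definition W2_geodesics :: "(real \<Rightarrow> 'a::metric_space measure) set" where
  "W2_geodesics = {\<Gamma>.
     \<Gamma> ` {0..1} \<subseteq> borel_probs \<and>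
     (\<forall>t\<in>{0..1}. ((\<lambda>s. W2 (\<Gamma> s) (\<Gamma> t)) \<longlongrightarrow> 0) (at t within {0..1})) \<and>
     W2 (\<Gamma> 0) (\<Gamma> 1) < \<infinity> \<and>
     (\<forall>t\<in>{0..1}. \<forall>s\<in>{0..1}. W2 (\<Gamma> t) (\<Gamma> s) = ennreal \<bar>t - s\<bar> * W2 (\<Gamma> 0) (\<Gamma> 1))}"

definition mutually_singular ::
    "'a::topological_space measure \<Rightarrow> 'a measure \<Rightarrow> bool" where
  "mutually_singular m \<nu> \<longleftrightarrow>
     (\<exists>A\<in>sets borel. emeasure m A = 0 \<and> emeasure \<nu> (UNIV - A) = 0)"

text \<open>\<open>\<rho>\<close> is the density in a Lebesgue decomposition \<open>\<mu> = \<rho>m + \<nu>\<close> with \<open>\<nu>\<close> singular to \<open>m\<close>.\<close>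

definition lebesgue_density ::
    "'a::topological_space measure \<Rightarrow> 'a measure \<Rightarrow> ('a \<Rightarrow> real) \<Rightarrow> bool" where
  "lebesgue_density m \<mu> \<rho> \<longleftrightarrow>
     \<rho> \<in> borel_measurable borel \<and> (\<forall>x. 0 \<le> \<rho> x) \<and>
     (\<exists>\<nu>. sets \<nu> = sets borel \<and> mutually_singular m \<nu> \<and>
        (\<forall>B\<in>sets borel. emeasure \<mu> B = (\<integral>\<^sup>+x\<in>B. ennreal (\<rho> x) \<partial>m) + emeasure \<nu> B))"

text \<open>For \<open>\<sigma>\<close>-finite \<open>m\<close> the density exists and is unique \<open>m\<close>-almost everywhere, so the choice does
  not matter. As \<open>0 powr a = 0\<close> for every \<open>a\<close>, including \<open>a = 0\<close>, the integrand vanishes where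
  \<open>\<rho> = 0\<close> also for \<open>N = 1\<close>.\<close>

definition renyi_entropy :: "real \<Rightarrow> 'a::topological_space measure \<Rightarrow> 'a measure \<Rightarrow> ereal" where
  "renyi_entropy N m \<mu> =
     (let \<rho> = (SOME \<rho>. lebesgue_density m \<mu> \<rho>)
      in - enn2ereal (\<integral>\<^sup>+x. ennreal (\<rho> x powr (1 - 1 / N)) \<partial>m))"

text \<open>In \<open>ereal\<close>, \<open>0 * (-\<infinity>) = 0\<close>.\<close>

definition strongly_displacement_convex ::
    "('a::metric_space measure \<Rightarrow> ereal) \<Rightarrow> bool" where
  "strongly_displacement_convex F \<longleftrightarrow>
     (\<forall>\<Gamma>\<in>W2_geodesics. \<forall>s\<in>{0..1}.
        F (\<Gamma> s) \<le> ereal (1 - s) * F (\<Gamma> 0) + ereal s * F (\<Gamma> 1))"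

definition average :: "'a measure \<Rightarrow> 'a set \<Rightarrow> ('a \<Rightarrow> real) \<Rightarrow> real" where
  "average m B u = (1 / measure m B) * (LINT x:B|m. u x)"

definition nn_average :: "'a measure \<Rightarrow> 'a set \<Rightarrow> ('a \<Rightarrow> ennreal) \<Rightarrow> ennreal" where
  "nn_average m B f = (1 / emeasure m B) * (\<integral>\<^sup>+x\<in>B. f x \<partial>m)"

end

theory Submission
  imports Defs
begin

text \<open>
  Let \<open>P\<close> and \<open>Q\<close> be the parts of the ball \<open>B(x, r)\<close> where \<open>u\<close> is above, respectively below, its mean
  value. Transport the uniform measure of \<open>P\<close> optimally to that of \<open>Q\<close> along geodesics of \<open>X\<close>, which
  stay in \<open>B(x, 2 r)\<close>. Integrating the upper gradient along the geodesics bounds the difference of the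
  means of \<open>u\<close> over \<open>P\<close> and \<open>Q\<close>, and hence the oscillation of \<open>u\<close>, by \<open>4 r\<close> times the integral of \<open>g\<close>
  over \<open>B(x, 2 r)\<close>, provided that the densities of the interpolated measures never exceed those of the two
  endpoints. This is where convexity along every Wasserstein geodesic enters: the transport can be
  conditioned on passing at time \<open>t\<close> through an arbitrary Borel set \<open>A\<close>, the conditioned transport is
  again a geodesic, and its entropy at time \<open>t\<close> is bounded below in terms of \<open>m(A)\<close> only. The same
  argument for the contraction of \<open>B(x, 2 r)\<close> to \<open>x\<close> gives \<open>m(B(x, 2 r)) \<le> 2\<^sup>N m(B(x, r))\<close>.

  Local compactness is not available at the outset. Geodesics are therefore chosen measurably by an
  argument that works almost everywhere in any complete separable space, and optimal plans are found as
  limits of couplings, whose fixed marginals prevent a loss of mass. Separability itself follows since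
  disjoint balls have positive measure while large balls have finite measure.
\<close>

section \<open>Separability\<close>

text \<open>What convexity yields is one scalar inequality. Suppose the interpolation gives mass
  \<open>p\<close> to \<open>A\<close> at time \<open>t\<close>. Concentration on \<open>A\<close>
  bounds the conditioned entropy at time \<open>t\<close> below by
  \<open>- m(A) powr (1 / N)\<close>; conditioning multiplies the density bounds at the ends by
  \<open>1 / p\<close>, hence the entropy bounds there by \<open>p powr (1 / N)\<close>. Convexity
  then reads \<open>p powr (1 / N) * K \<le> m(A) powr (1 / N)\<close>, that is
  \<open>p \<le> K powr (- N) * m(A)\<close>, and as \<open>A\<close> is arbitrary this is a density
  bound. Equal bounds \<open>c\<close> at both ends give \<open>K powr (- N) = c\<close>; a point
  mass as target gives \<open>2 powr N * c\<close> at the midpoint. The final constant is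
  \<open>4 * 2 powr N\<close>: geodesics between points of the ball are shorter than
  \<open>2 * r\<close>, the two sides of the mean double this, and \<open>2 powr N\<close> comes
  from comparing the two balls. The type \<open>'a\<close> is only complete metric, and separability
  is a derived fact kept in a locale. Hence plans live on the Borel sets of
  \<open>'a \<times> 'a\<close>, and the measurability of pairs is obtained from an explicit dense
  sequence.\<close>

locale dense_sequence =
  fixes q :: "nat \<Rightarrow> 'a::metric_space"
  assumes dense: "0 < e \<Longrightarrow> \<exists>i. dist x (q i) < e"

text \<open>By Zorn's lemma a maximal \<open>e\<close>-separated subset exists, and it is
  automatically an \<open>e\<close>-net: a point at distance at least \<open>e\<close> from all of
  it could be added.\<close>

lemma maximal_separated_subset:
  fixes B :: "'a::metric_space set"
  assumes "0 < e"
  obtains S where "S \<subseteq> B" "\<And>x y. x \<in> S \<Longrightarrow> y \<in> S \<Longrightarrow> x \<noteq> y \<Longrightarrow> e \<le> dist x y"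
    "\<And>x. x \<in> B \<Longrightarrow> \<exists>s\<in>S. dist x s < e"
proof -
  define A where "A = {S. S \<subseteq> B \<and> (\<forall>x\<in>S. \<forall>y\<in>S. x \<noteq> y \<longrightarrow> e \<le> dist x y)}"
  have "\<exists>M\<in>A. \<forall>X\<in>A. M \<subseteq> X \<longrightarrow> X = M"
  proof (rule subset_Zorn')
    fix C assume "subset.chain A C"
    then have C: "C \<subseteq> A" "\<And>S T. S \<in> C \<Longrightarrow> T \<in> C \<Longrightarrow> S \<subseteq> T \<or> T \<subseteq> S"
      by (auto simp: subset_chain_def)
    have "e \<le> dist x y" if xy: "x \<in> \<Union>C" "y \<in> \<Union>C" "x \<noteq> y" for x y
    proof -
      obtain S T where "x \<in> S" "S \<in> C" "y \<in> T" "T \<in> C" using xy by blast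
      then obtain R where R: "x \<in> R" "y \<in> R" "R \<in> C" using C(2)[of S T] by blast
      then have "R \<in> A" using C(1) by blast
      then show ?thesis using R xy(3) unfolding A_def by blast
    qed
    moreover have "\<Union>C \<subseteq> B" using C(1) unfolding A_def by blast
    ultimately show "\<Union>C \<in> A" unfolding A_def by blast
  qed
  then obtain S where S: "S \<in> A" and max: "\<And>X. X \<in> A \<Longrightarrow> S \<subseteq> X \<Longrightarrow> X = S" by blast
  have "\<exists>s\<in>S. dist x s < e" if x: "x \<in> B" for x
  proof (rule ccontr)
    assume n: "\<not> ?thesis"
    then have "insert x S \<in> A" using S x unfolding A_def by (auto simp: not_less dist_commute)
    then have "x \<in> S" using max[of "insert x S"] by blast
    then show False using n assms by auto
  qed
  with S that[of S] show ?thesis unfolding A_def by blast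
qed

text \<open>The balls of radius \<open>e/2\<close> about the points of \<open>S\<close> are
  disjoint, have positive measure and lie in one ball of finite measure, so for each
  \<open>j\<close> only finitely many of them have measure above \<open>1 / Suc j\<close>.\<close>

lemma countable_separated_set:
  fixes m :: "'a::metric_space measure" and S :: "'a set"
  assumes "sets m = sets borel" "measure_support m = UNIV"
    and fin: "\<And>y \<delta>. emeasure m (ball y \<delta>) < \<infinity>"
    and "S \<subseteq> ball a R" and sep: "\<And>x y. x \<in> S \<Longrightarrow> y \<in> S \<Longrightarrow> x \<noteq> y \<Longrightarrow> e \<le> dist x y" and "0 < e"
  shows "countable S"
proof -
  have bs: "ball y \<delta> \<in> sets m" for y \<delta> using assms(1) by simp
  have pos: "0 < measure m (ball s (e/2))" for s
  proof -
    have "0 < emeasure m (ball s (e/2))"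
      using assms(2) \<open>0 < e\<close> unfolding measure_support_def
      by (metis (mono_tags, lifting) UNIV_I centre_in_ball half_gt_zero mem_Collect_eq open_ball)
    then show ?thesis using fin[of s "e/2"]
      by (simp add: measure_def enn2real_positive_iff)
  qed
  have "finite {s\<in>S. 1 / real (Suc j) < measure m (ball s (e/2))}" (is "finite ?T") for j
  proof (rule ccontr)
    assume inf: "infinite ?T"
    define V where "V = measure m (ball a (R + e))"
    obtain n where n: "real n > V * real (Suc j)" using reals_Archimedean2 by blast
    obtain F where F: "F \<subseteq> ?T" "finite F" "card F = n"
      using infinite_arbitrarily_large[OF inf] by blast
    have disj: "disjoint_family_on (\<lambda>s. ball s (e/2)) F"
      unfolding disjoint_family_on_def
    proof (intro ballI impI)
      fix x y assume xy: "x \<in> F" "y \<in> F" "x \<noteq> y"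
      then have "e \<le> dist x y" using sep F by blast
      moreover have False if "z \<in> ball x (e/2)" "z \<in> ball y (e/2)" for z
        using that \<open>e \<le> dist x y\<close> dist_triangle2[of x y z] by (simp add: dist_commute)
      ultimately show "ball x (e/2) \<inter> ball y (e/2) = {}" by blast
    qed
    have "real n * (1 / real (Suc j)) = (\<Sum>s\<in>F. 1 / real (Suc j))" using F by simp
    also have "\<dots> \<le> (\<Sum>s\<in>F. measure m (ball s (e/2)))" using F by (intro sum_mono) auto
    also have "\<dots> = measure m (\<Union>s\<in>F. ball s (e/2))"
      using F disj bs fin by (intro measure_finite_Union[symmetric]) (auto simp: less_top)
    also have "\<dots> \<le> V" unfolding V_def
    proof (rule measure_mono_fmeasurable)
      have "ball s (e/2) \<subseteq> ball a (R+e)" if "s \<in> F" for s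
      proof
        fix z assume "z \<in> ball s (e/2)"
        moreover have "dist a s < R" using that F assms(4) by auto
        ultimately show "z \<in> ball a (R+e)"
          using dist_triangle[of a z s] \<open>0 < e\<close> by simp
      qed
      then show "(\<Union>s\<in>F. ball s (e/2)) \<subseteq> ball a (R + e)" by blast
    qed (use F bs fin in \<open>auto simp: fmeasurable_def\<close>)
    finally show False using n by (simp add: field_simps)
  qed
  then have "countable (\<Union>j. {s\<in>S. 1 / real (Suc j) < measure m (ball s (e/2))})"
    by (intro countable_UN) (auto intro: countable_finite)
  moreover have "S \<subseteq> (\<Union>j. {s\<in>S. 1 / real (Suc j) < measure m (ball s (e/2))})"
  proof
    fix s assume "s \<in> S"
    moreover obtain j where "1 / real (Suc j) < measure m (ball s (e/2))"
      using nat_approx_posE[OF pos] by blast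
    ultimately show "s \<in> (\<Union>j. {s\<in>S. 1 / real (Suc j) < measure m (ball s (e/2))})" by blast
  qed
  ultimately show ?thesis using countable_subset by blast
qed

text \<open>Separated sets are known to be countable only inside a ball, so nets of all balls
  \<open>ball a n\<close> at all scales \<open>1 / Suc k\<close> are united.\<close>

lemma ex_dense_sequence:
  fixes m :: "'a::metric_space measure"
  assumes "sets m = sets borel" "measure_support m = UNIV"
    and "\<And>y \<delta>. emeasure m (ball y \<delta>) < \<infinity>"
  shows "\<exists>q :: nat \<Rightarrow> 'a. dense_sequence q"
proof -
  fix a :: 'a
  have "\<exists>S. countable S \<and> (\<forall>x\<in>ball a (real n). \<exists>s\<in>S. dist x s < 1 / Suc k)" for n k
  proof -
    have e: "0 < 1 / real (Suc k)" by simp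
    obtain S where S: "S \<subseteq> ball a (real n)"
        "\<And>x y. x \<in> S \<Longrightarrow> y \<in> S \<Longrightarrow> x \<noteq> y \<Longrightarrow> 1 / real (Suc k) \<le> dist x y"
        "\<And>x. x \<in> ball a (real n) \<Longrightarrow> \<exists>s\<in>S. dist x s < 1 / real (Suc k)"
      using maximal_separated_subset[OF e, of "ball a (real n)"] by blast
    have "countable S" by (rule countable_separated_set[OF assms S(1,2) e])
    then show ?thesis using S(3) by blast
  qed
  then obtain S where S: "\<And>n k. countable (S n k)"
    "\<And>n k x. x \<in> ball a (real n) \<Longrightarrow> \<exists>s\<in>S n k. dist x s < 1 / Suc k" by metis
  define Q where "Q = (\<Union>n k. S n k)"
  have cQ: "countable Q" unfolding Q_def using S(1) by auto
  have dQ: "\<exists>s\<in>Q. dist x s < e" if "0 < e" for x e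
  proof -
    obtain k where k: "1 / Suc k < e" using nat_approx_posE \<open>0 < e\<close> by blast
    obtain n where "dist a x < real n" using reals_Archimedean2 by blast
    then obtain s where "s \<in> S n k" "dist x s < 1 / Suc k" using S(2)[of x n k] by auto
    then show ?thesis unfolding Q_def using k by (intro bexI[of _ s]) auto
  qed
  have "Q \<noteq> {}" using dQ[of 1] by auto
  have "dense_sequence (from_nat_into Q)"
  proof
    fix e :: real and x :: 'a assume "0 < e"
    then obtain s where "s \<in> Q" "dist x s < e" using dQ by blast
    then show "\<exists>i. dist x (from_nat_into Q i) < e"
      using from_nat_into_surj[OF cQ] by metis
  qed
  then show ?thesis by blast
qed

section \<open>A countable base of balls and the Borel measurability of pairs\<close>

context dense_sequence
begin

text \<open>The balls about the dense points with radii \<open>1 / Suc n\<close> form a countable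
  base of the topology.\<close>

lemma open_cover_balls:
  assumes "open S" "x \<in> S"
  shows "\<exists>i n. x \<in> ball (q i) (1 / Suc n) \<and> ball (q i) (1 / Suc n) \<subseteq> S"
proof -
  obtain e where e: "0 < e" "ball x e \<subseteq> S" using openE[OF assms] by metis
  obtain n where n: "1 / Suc n < e / 2" using nat_approx_posE[of "e/2"] e by auto
  obtain i where i: "dist x (q i) < 1 / Suc n" using dense[of "1 / Suc n" x] by auto
  have "z \<in> S" if "z \<in> ball (q i) (1 / Suc n)" for z
  proof -
    have "dist (q i) z < 1 / Suc n" using that by simp
    with i n have "dist x z < e" using dist_triangle[of x z "q i"] by linarith
    then show ?thesis using e by auto
  qed
  moreover have "x \<in> ball (q i) (1 / Suc n)" using i by (simp only: mem_ball dist_commute)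
  ultimately show ?thesis by blast
qed

text \<open>In general the Borel sets of a product exceed the product of the Borel sigma algebras.
  With a countable base every open set of the product is a countable union of boxes, and boxes have
  measurable inverse images.\<close>

lemma borel_measurable_Pair':
  fixes f g :: "'b \<Rightarrow> 'a"
  assumes [measurable]: "f \<in> borel_measurable M" "g \<in> borel_measurable M"
  shows "(\<lambda>x. (f x, g x)) \<in> borel_measurable M"
proof (rule borel_measurableI)
  fix S :: "('a \<times> 'a) set" assume S: "open S"
  define I where "I = {(i,k,j,l). ball (q i) (1 / Suc k) \<times> ball (q j) (1 / Suc l) \<subseteq> S}"
  have "(\<lambda>x. (f x, g x)) -` S \<inter> space M =
      (\<Union>(i,k,j,l)\<in>I. {x\<in>space M. f x \<in> ball (q i) (1 / Suc k) \<and> g x \<in> ball (q j) (1 / Suc l)})"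
  proof safe
    fix x assume "x \<in> space M" "(f x, g x) \<in> S"
    then obtain A B where AB: "open A" "open B" "f x \<in> A" "g x \<in> B" "A \<times> B \<subseteq> S"
      using open_prod_elim[OF S] by (metis mem_Sigma_iff)
    obtain i k where "f x \<in> ball (q i) (1 / Suc k)" "ball (q i) (1 / Suc k) \<subseteq> A"
      using open_cover_balls AB by metis
    moreover obtain j l where "g x \<in> ball (q j) (1 / Suc l)" "ball (q j) (1 / Suc l) \<subseteq> B"
      using open_cover_balls AB by metis
    ultimately show "x \<in> (\<Union>(i,k,j,l)\<in>I. {x\<in>space M. f x \<in> ball (q i) (1 / Suc k) \<and> g x \<in> ball (q j) (1 / Suc l)})"
      using AB \<open>x \<in> space M\<close> unfolding I_def by blast
  qed (auto simp: I_def)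
  also have "\<dots> \<in> sets M"
  proof -
    have "{x\<in>space M. f x \<in> ball (q i) (1 / Suc k) \<and> g x \<in> ball (q j) (1 / Suc l)} \<in> sets M" for i k j l
    proof -
      have "(f -` ball (q i) (1 / Suc k) \<inter> space M) \<inter> (g -` ball (q j) (1 / Suc l) \<inter> space M) \<in> sets M"
        by (intro sets.Int measurable_sets[OF assms(1)] measurable_sets[OF assms(2)] borel_open open_ball)
      moreover have "(f -` ball (q i) (1 / Suc k) \<inter> space M) \<inter> (g -` ball (q j) (1 / Suc l) \<inter> space M)
         = {x\<in>space M. f x \<in> ball (q i) (1 / Suc k) \<and> g x \<in> ball (q j) (1 / Suc l)}"
        by blast
      ultimately show ?thesis by (simp only:)
    qed
    then show ?thesis by (intro sets.countable_UN') auto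
  qed
  finally show "(\<lambda>x. (f x, g x)) -` S \<inter> space M \<in> sets M" .
qed

end

lemma borel_measurable_fst':
  "fst \<in> borel_measurable (borel :: ('a::topological_space \<times> 'b::topological_space) measure)"
  by (intro borel_measurable_continuous_onI continuous_on_fst continuous_on_id)

lemma borel_measurable_snd':
  "snd \<in> borel_measurable (borel :: ('a::topological_space \<times> 'b::topological_space) measure)"
  by (intro borel_measurable_continuous_onI continuous_on_snd continuous_on_id)

section \<open>Measurable selection\<close>

text \<open>The point \<open>a\<close> may change with \<open>n\<close>, so no limit is given in
  advance; it only forces \<open>x i\<close> and \<open>x j\<close> to be within
  \<open>(1/2)^i + (1/2)^j\<close> of each other.\<close>

lemma convergent_common_points:
  fixes x :: "nat \<Rightarrow> 'a::complete_space"
  assumes "\<And>n. \<exists>a. \<forall>i\<le>n. dist a (x i) \<le> (1/2)^i"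
  shows "convergent x"
proof -
  have "Cauchy x"
  proof (rule metric_CauchyI)
    fix e :: real assume "0 < e"
    then obtain n where n: "(1/2::real)^n < e/2" using real_arch_pow_inv[of "e/2" "1/2"] by auto
    have "dist (x i) (x j) < e" if ij: "i \<ge> n" "j \<ge> n" for i j
    proof -
      obtain a where a: "\<forall>l\<le>max i j. dist a (x l) \<le> (1/2)^l" using assms by blast
      have "dist a (x i) \<le> (1/2)^i" "dist a (x j) \<le> (1/2)^j" using a by auto
      moreover have "(1/2::real)^i \<le> (1/2)^n" "(1/2::real)^j \<le> (1/2)^n"
        using ij by (auto intro!: power_decreasing)
      ultimately show ?thesis using n dist_triangle3[of "x i" "x j" a] by linarith
    qed
    then show "\<exists>M. \<forall>i\<ge>M. \<forall>j\<ge>M. dist (x i) (x j) < e" by blast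
  qed
  then show ?thesis by (simp add: Cauchy_convergent_iff)
qed

text \<open>With \<open>E\<close> read as the graph of a set-valued map, this is the inverse image
  of \<open>S\<close>. It is a projection, hence in general not Borel even if \<open>E\<close> and
  \<open>S\<close> are closed.\<close>

definition fibre_domain :: "('b \<times> 'c) set \<Rightarrow> 'c set \<Rightarrow> 'b set" where
  "fibre_domain E S = {y. \<exists>z\<in>S. (y, z) \<in> E}"

text \<open>A projection along a compact factor is closed. This is the source of all measurability
  of fibre domains below.\<close>

lemma closed_fibre_domain:
  fixes E :: "('b::metric_space \<times> 'c::metric_space) set"
  assumes "closed E" "compact S"
  shows "closed (fibre_domain E S)"
  unfolding closed_sequential_limits
proof (intro allI impI, elim conjE)
  fix y l assume y: "\<forall>n. y n \<in> fibre_domain E S" "y \<longlonglongrightarrow> l"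
  then have "\<forall>n. \<exists>z. z \<in> S \<and> (y n, z) \<in> E" unfolding fibre_domain_def by blast
  then obtain z where z: "\<And>n. z n \<in> S" "\<And>n. (y n, z n) \<in> E" by metis
  obtain w r where w: "w \<in> S" "strict_mono (r::nat\<Rightarrow>nat)" "(z \<circ> r) \<longlonglongrightarrow> w"
    using seq_compactE[OF compact_imp_seq_compact[OF assms(2)], of z] z(1) by metis
  have "(\<lambda>n. ((y \<circ> r) n, (z \<circ> r) n)) \<longlonglongrightarrow> (l, w)"
    by (intro tendsto_Pair LIMSEQ_subseq_LIMSEQ[OF y(2) w(2)] w(3))
  moreover have "((y \<circ> r) n, (z \<circ> r) n) \<in> E" for n using z(2) by simp
  ultimately have "(l, w) \<in> E"
    by (rule closed_sequentially[OF assms(1), of "\<lambda>n. ((y \<circ> r) n, (z \<circ> r) n)", rotated])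
  then show "l \<in> fibre_domain E S" using w(1) unfolding fibre_domain_def by blast
qed

lemma compact_closure_totally_bounded:
  fixes S :: "'c::complete_space set"
  assumes "\<And>e. 0 < e \<Longrightarrow> \<exists>F. finite F \<and> S \<subseteq> (\<Union>x\<in>F. cball x e)"
  shows "compact (closure S)"
  unfolding compact_eq_totally_bounded
proof (intro conjI allI impI)
  show "Topological_Spaces.complete (closure S)" by (simp add: complete_eq_closed)
  fix e :: real assume "0 < e"
  then obtain F where F: "finite F" "S \<subseteq> (\<Union>x\<in>F. cball x (e/2))" using assms[of "e/2"] by auto
  then have "closure S \<subseteq> (\<Union>x\<in>F. cball x (e/2))" by (intro closure_minimal) auto
  also have "\<dots> \<subseteq> (\<Union>x\<in>F. ball x e)" using \<open>0 < e\<close> by fastforce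
  finally show "\<exists>F. finite F \<and> closure S \<subseteq> (\<Union>x\<in>F. ball x e)" using F(1) by blast
qed

context dense_sequence
begin

lemma finite_cball_union_UNIV:
  assumes "0 < e"
  shows "(\<Union>n. \<Union>i<n. cball (q i) e) = (UNIV :: 'a set)"
proof -
  have "x \<in> (\<Union>n. \<Union>i<n. cball (q i) e)" for x
  proof -
    obtain i where "dist x (q i) < e" using dense[OF assms] by blast
    then have "x \<in> cball (q i) e" by (simp add: dist_commute)
    then show ?thesis by (intro UN_I[of "Suc i"] UN_I[of i]) auto
  qed
  then show ?thesis by blast
qed

end

text \<open>Outer measure is continuous along increasing unions of arbitrary sets, so the fibre domains of
  finite unions of small balls can be cut down one scale after the other although they need not be
  measurable; in the limit they are replaced by their closures.\<close>

lemma selection_tight: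
  fixes \<mu> :: "'b::metric_space measure" and E :: "('b \<times> 'c::complete_space) set" and q :: "nat \<Rightarrow> 'c"
  assumes \<mu>: "sets \<mu> = sets borel" "finite_measure \<mu>"
    and E: "closed E" "\<And>y. \<exists>z. (y, z) \<in> E"
    and q: "dense_sequence q"
    and c: "c < emeasure \<mu> UNIV"
  shows "\<exists>H. compact H \<and> c \<le> emeasure \<mu> (fibre_domain E H)"
proof -
  interpret dense_sequence q by fact
  interpret finite_measure \<mu> by fact
  have sp: "space \<mu> = UNIV" using sets_eq_imp_space_eq[OF \<mu>(1)] by simp
  define o' where "o' S = outer_measure_of \<mu> (fibre_domain E S)" for S
  define T where "T k n = (\<Union>i<n. cball (q i) ((1/2)^k))" for k n :: nat
  define Q where "Q k S n = S \<inter> T k n" for k S n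
  \<comment> \<open>The bound by \<open>c\<close> is kept strict: a strict inequality passes from
    the supremum to one of its members and so survives every cut.\<close>
  have step0: "\<exists>n. c < o' (S \<inter> T k n)" if "c < o' S" for S k
  proof -
    have "(SUP n. outer_measure_of \<mu> (fibre_domain E (S \<inter> T k n)))
        = outer_measure_of \<mu> (\<Union>n. fibre_domain E (S \<inter> T k n))"
    proof (rule SUP_outer_measure_of_incseq)
      show "incseq (\<lambda>n. fibre_domain E (S \<inter> T k n))"
        unfolding incseq_def fibre_domain_def T_def by fastforce
    qed (simp add: sp)
    also have "(\<Union>n. fibre_domain E (S \<inter> T k n)) = fibre_domain E (S \<inter> (\<Union>n. T k n))"
      unfolding fibre_domain_def by blast
    also have "(\<Union>n. T k n) = UNIV" unfolding T_def by (rule finite_cball_union_UNIV) simp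
    finally have "c < (SUP n. o' (S \<inter> T k n))" using that unfolding o'_def by simp
    then show ?thesis unfolding less_SUP_iff by blast
  qed
  have step: "\<exists>S'. (closed S' \<and> c < o' S') \<and> (\<exists>n. S' = S \<inter> T k n)"
    if S: "closed S \<and> c < o' S" for S k
  proof -
    have "closed (T k n)" for n unfolding T_def by (intro closed_UN) auto
    moreover obtain n where "c < o' (S \<inter> T k n)" using step0[of S k] S by blast
    ultimately show ?thesis using S by blast
  qed
  have "closed (UNIV :: 'c set) \<and> c < o' UNIV"
  proof -
    have "fibre_domain E UNIV = UNIV" using E(2) unfolding fibre_domain_def by blast
    then show ?thesis using c \<mu> unfolding o'_def by simp
  qed
  then have ex0: "\<exists>S::'c set. closed S \<and> c < o' S" by blast
  obtain S where S: "\<And>k. closed (S k) \<and> c < o' (S k)" "\<And>k. \<exists>n. S (Suc k) = S k \<inter> T k n"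
    using dependent_nat_choice[of "\<lambda>_ S. closed S \<and> c < o' S" "\<lambda>k S S'. \<exists>n. S' = S \<inter> T k n", OF ex0 step]
    by blast
  have Sdec: "decseq S" using S(2) by (intro decseq_SucI) blast
  have cov: "\<exists>F. finite F \<and> S (Suc k) \<subseteq> (\<Union>x\<in>F. cball x ((1/2)^k))" for k
  proof -
    obtain n where "S (Suc k) = S k \<inter> T k n" using S(2) by blast
    then show ?thesis unfolding T_def by (intro exI[of _ "q ` {..<n}"]) auto
  qed
  have cov': "\<exists>k F. finite F \<and> S k \<subseteq> (\<Union>x\<in>F. cball x e)" if e: "0 < e" for e
  proof -
    obtain k where k: "(1/2)^k < e" using real_arch_pow_inv[OF e, of "1/2"] by auto
    obtain F where F: "finite F" "S (Suc k) \<subseteq> (\<Union>x\<in>F. cball x ((1/2)^k))" using cov by blast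
    moreover have "(\<Union>x\<in>F. cball x ((1/2)^k)) \<subseteq> (\<Union>x\<in>F. cball x e)" using k by fastforce
    ultimately show ?thesis by blast
  qed
  define H where "H = (\<Inter>k. S k)"
  have "closed H" unfolding H_def using S(1) by blast
  have "compact (closure H)"
  proof (rule compact_closure_totally_bounded)
    fix e :: real assume "0 < e"
    then obtain k F where "finite F" "S k \<subseteq> (\<Union>x\<in>F. cball x e)" using cov' by blast
    then show "\<exists>F. finite F \<and> H \<subseteq> (\<Union>x\<in>F. cball x e)" unfolding H_def by blast
  qed
  then have "compact H" using \<open>closed H\<close> by (simp add: closure_closed)
  \<comment> \<open>Replacing fibre domains by their closures costs nothing in the limit. A point
    \<open>y\<close> of all closures is a limit of points \<open>y' k\<close> with values
    \<open>z k \<in> S k\<close>; as the sets \<open>S k\<close> are covered at ever finer scales,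
    the \<open>z k\<close> subconverge, and closedness of \<open>E\<close> puts the limit over
    \<open>y\<close>.\<close>
  have sub: "(\<Inter>k. closure (fibre_domain E (S k))) \<subseteq> fibre_domain E H"
  proof
    fix y assume y: "y \<in> (\<Inter>k. closure (fibre_domain E (S k)))"
    have "\<exists>y' z. dist y' y < (1/2)^k \<and> z \<in> S k \<and> (y', z) \<in> E" for k
    proof -
      have "y \<in> closure (fibre_domain E (S k))" using y by blast
      then obtain y' where "y' \<in> fibre_domain E (S k)" "dist y' y < (1/2)^k"
        unfolding closure_approachable by (metis half_gt_zero_iff zero_less_one zero_less_power)
      then show ?thesis unfolding fibre_domain_def by blast
    qed
    then obtain y' z where yz: "\<And>k. dist (y' k) y < (1/2)^k" "\<And>k. z k \<in> S k" "\<And>k. (y' k, z k) \<in> E"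
      by metis
    have y'lim: "y' \<longlonglongrightarrow> y"
    proof (rule metric_tendsto_imp_tendsto[where f="\<lambda>k. (1/2::real)^k" and a=0])
      show "(\<lambda>k. (1/2::real)^k) \<longlonglongrightarrow> 0" by (intro LIMSEQ_power_zero) simp
      show "\<forall>\<^sub>F k in sequentially. dist (y' k) y \<le> dist ((1/2::real)^k) 0"
        using yz(1) by (intro always_eventually) (auto intro: less_imp_le)
    qed
    have "compact (closure (range z))"
    proof (rule compact_closure_totally_bounded)
      fix e :: real assume "0 < e"
      then obtain k F where F: "finite F" "S k \<subseteq> (\<Union>x\<in>F. cball x e)" using cov' by blast
      \<comment> \<open>Only finitely many terms can lie outside \<open>S k\<close>; these are made
        centres themselves.\<close>
      have "z j \<in> (\<Union>x\<in>F \<union> z ` {..<k}. cball x e)" for j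
      proof (cases "j < k")
        case True
        then show ?thesis using \<open>0 < e\<close> by (intro UN_I[of "z j"]) auto
      next
        case False
        then have "z j \<in> S k" using yz(2)[of j] decseqD[OF Sdec, of k j] by auto
        then show ?thesis using F(2) by blast
      qed
      then show "\<exists>F. finite F \<and> range z \<subseteq> (\<Union>x\<in>F. cball x e)"
        using F(1) by (intro exI[of _ "F \<union> z ` {..<k}"]) blast
    qed
    moreover have "\<forall>n. z n \<in> closure (range z)"
      by (intro allI subsetD[OF closure_subset] rangeI)
    ultimately obtain w r where w: "strict_mono (r::nat\<Rightarrow>nat)" "(z \<circ> r) \<longlonglongrightarrow> w"
      using seq_compactE[OF compact_imp_seq_compact, of "closure (range z)" z] by metis
    have "w \<in> S k" for k
    proof (rule closed_sequentially[where f="\<lambda>n. (z \<circ> r) (n + k)"])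
      show "closed (S k)" using S(1) by blast
      show "(\<lambda>n. (z \<circ> r) (n + k)) \<longlonglongrightarrow> w" using w(2) by (rule LIMSEQ_ignore_initial_segment)
      fix n
      have "k \<le> r (n + k)" using seq_suble[OF w(1), of "n+k"] by linarith
      then show "(z \<circ> r) (n + k) \<in> S k" using yz(2)[of "r (n+k)"] decseqD[OF Sdec] by auto
    qed
    then have "w \<in> H" unfolding H_def by blast
    moreover have "(y, w) \<in> E"
    proof (rule closed_sequentially[OF E(1)])
      show "((y' \<circ> r) n, (z \<circ> r) n) \<in> E" for n using yz(3) by simp
      show "(\<lambda>n. ((y' \<circ> r) n, (z \<circ> r) n)) \<longlonglongrightarrow> (y, w)"
        by (intro tendsto_Pair LIMSEQ_subseq_LIMSEQ[OF y'lim w(1)] w(2))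
    qed
    ultimately show "y \<in> fibre_domain E H" unfolding fibre_domain_def by blast
  qed
  \<comment> \<open>Here outer measure is traded for measure: the closures are Borel, so continuity
    from above applies, which fails for outer measures of arbitrary sets.\<close>
  have "c \<le> (INF k. emeasure \<mu> (closure (fibre_domain E (S k))))"
  proof (rule INF_greatest)
    fix k
    have "c \<le> o' (S k)" using S(1) less_imp_le by blast
    also have "\<dots> \<le> outer_measure_of \<mu> (closure (fibre_domain E (S k)))"
      unfolding o'_def by (intro outer_measure_of_mono closure_subset)
    also have "\<dots> = emeasure \<mu> (closure (fibre_domain E (S k)))" using \<mu>(1) by simp
    finally show "c \<le> emeasure \<mu> (closure (fibre_domain E (S k)))" .
  qed
  also have "\<dots> = emeasure \<mu> (\<Inter>k. closure (fibre_domain E (S k)))"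
  proof (rule INF_emeasure_decseq)
    show "range (\<lambda>k. closure (fibre_domain E (S k))) \<subseteq> sets \<mu>" using \<mu>(1) by (simp add: image_subset_iff)
    show "decseq (\<lambda>k. closure (fibre_domain E (S k)))"
      unfolding decseq_def
    proof (intro allI impI closure_mono)
      fix i j :: nat assume "i \<le> j"
      then show "fibre_domain E (S j) \<subseteq> fibre_domain E (S i)"
        using decseqD[OF Sdec] unfolding fibre_domain_def by blast
    qed
  qed simp
  also have "\<dots> \<le> emeasure \<mu> (fibre_domain E H)"
    using sub closed_fibre_domain[OF E(1) \<open>compact H\<close>] \<mu>(1) by (intro emeasure_mono) auto
  finally show ?thesis using \<open>compact H\<close> by blast
qed

text \<open>The scheme of Kuratowski and Ryll-Nardzewski: at stage \<open>k\<close> the least index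
  is taken whose ball of radius \<open>(1/2)^k\<close> still meets the fibre inside the earlier
  balls. Compactness of \<open>H\<close> makes each test membership in a closed set, so every choice
  is Borel.\<close>

lemma compact_selection:
  fixes E :: "('b::metric_space \<times> 'c::complete_space) set" and q :: "nat \<Rightarrow> 'c"
  assumes E: "closed E" and H: "compact H" and q: "dense_sequence q"
  shows "\<exists>s\<in>borel_measurable borel. \<forall>y\<in>fibre_domain E H. (y, s y) \<in> E"
proof -
  interpret dense_sequence q by fact
  define F where "F l = H \<inter> (\<Inter>j<length l. cball (q (l ! j)) ((1/2)^j))" for l :: "nat list"
  have cF: "closed (fibre_domain E (F l))" for l
    unfolding F_def by (intro closed_fibre_domain E compact_Int_closed H closed_INT) auto
  have Fsnoc: "F (l @ [i]) = F l \<inter> cball (q i) ((1/2)^(length l))" for l i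
  proof -
    have "(\<Inter>j<Suc (length l). cball (q ((l @ [i]) ! j)) ((1/2)^j))
        = (\<Inter>j<length l. cball (q ((l @ [i]) ! j)) ((1/2)^j)) \<inter> cball (q i) ((1/2)^(length l))"
      by (auto simp: lessThan_Suc)
    also have "(\<Inter>j<length l. cball (q ((l @ [i]) ! j)) ((1/2)^j)) = (\<Inter>j<length l. cball (q (l ! j)) ((1/2)^j))"
      by (intro INF_cong) (auto simp: nth_append)
    finally show ?thesis unfolding F_def by auto
  qed
  \<comment> \<open>\<open>W y k\<close> records the first \<open>k\<close> indices chosen for
    \<open>y\<close>. Words form a countable type, so measurability reduces to that of one choice
    after a fixed word.\<close>
  define W where "W y = rec_nat [] (\<lambda>k w. w @ [LEAST i. y \<in> fibre_domain E (F (w @ [i]))])" for y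
  have W0: "W y 0 = []" and WS: "W y (Suc k) = W y k @ [LEAST i. y \<in> fibre_domain E (F (W y k @ [i]))]" for y k
    unfolding W_def by simp_all
  have lW: "length (W y k) = k" for y k by (induction k) (simp_all add: W0 WS)
  have mW: "(\<lambda>y. W y k) \<in> borel \<rightarrow>\<^sub>M count_space UNIV" for k
  proof (induction k)
    case (Suc k)
    have "(\<lambda>y. l @ [LEAST i. y \<in> fibre_domain E (F (l @ [i]))]) \<in> borel \<rightarrow>\<^sub>M count_space UNIV" for l
    proof -
      have "(\<lambda>y. LEAST i. y \<in> fibre_domain E (F (l @ [i]))) \<in> borel \<rightarrow>\<^sub>M count_space UNIV"
      proof (rule measurable_Least)
        fix i
        have "fibre_domain E (F (l @ [i])) \<in> sets borel" using cF by simp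
        then show "Measurable.pred borel (\<lambda>y. y \<in> fibre_domain E (F (l @ [i])))" by simp
      qed
      from measurable_compose[OF this, of "\<lambda>i. l @ [i]"] show ?thesis by simp
    qed
    from measurable_compose_countable[OF this Suc] show ?case unfolding WS .
  qed (simp add: W0)
  have inW: "y \<in> fibre_domain E (F (W y k))" if "y \<in> fibre_domain E H" for y k
  proof (induction k)
    case 0
    then show ?case using that by (simp add: W0 F_def)
  next
    case (Suc k)
    then obtain z where z: "z \<in> F (W y k)" "(y, z) \<in> E" unfolding fibre_domain_def by blast
    obtain i where "dist z (q i) < (1/2)^k" using dense[of "(1/2)^k" z] by auto
    then have "z \<in> F (W y k @ [i])" using z(1) unfolding Fsnoc by (simp add: lW dist_commute)
    then have "y \<in> fibre_domain E (F (W y k @ [i]))" using z(2) unfolding fibre_domain_def by blast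
    then show ?case unfolding WS by (rule LeastI)
  qed
  \<comment> \<open>Outside the fibre domain the approximants are constant, so that the limit exists
    everywhere.\<close>
  define v where "v k y = (if y \<in> fibre_domain E H then q (last (W y (Suc k))) else q 0)" for k y
  have mv: "v k \<in> borel_measurable borel" for k
  proof -
    have "(\<lambda>y. q (last (W y (Suc k)))) \<in> borel_measurable borel"
      using measurable_compose[OF mW[of "Suc k"], of "\<lambda>w. q (last w)"] by simp
    then show ?thesis unfolding v_def
      using closed_fibre_domain[OF E H] by (intro measurable_If_set) auto
  qed
  \<comment> \<open>The chosen balls need not be nested, but one point of the fibre lies in all of
    the first ones at once; this yields both the convergence and, by closedness of \<open>E\<close>,
    the graph property of the limit.\<close>
  have key: "\<exists>z\<in>H. (y, z) \<in> E \<and> (\<forall>j\<le>k. dist z (v j y) \<le> (1/2)^j)" if y: "y \<in> fibre_domain E H" for y k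
  proof -
    obtain z where z: "z \<in> F (W y (Suc k))" "(y, z) \<in> E"
      using inW[OF y] unfolding fibre_domain_def by blast
    have "dist z (v j y) \<le> (1/2)^j" if "j \<le> k" for j
    proof -
      have "j < Suc k \<Longrightarrow> W y (Suc k) ! j = last (W y (Suc j))" for k j
      proof (induction k)
        case 0
        then show ?case by (simp add: WS W0)
      next
        case (Suc k)
        obtain i where i: "W y (Suc (Suc k)) = W y (Suc k) @ [i]" using WS by blast
        show ?case
        proof (cases "j = Suc k")
          case True
          then show ?thesis using lW[of y "Suc k"] by (simp add: i nth_append)
        next
          case False
          then have "W y (Suc (Suc k)) ! j = W y (Suc k) ! j"
            using Suc.prems lW[of y "Suc k"] by (simp add: i nth_append)
          then show ?thesis using Suc False by simp
        qed
      qed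
      then have "W y (Suc k) ! j = last (W y (Suc j))" using \<open>j \<le> k\<close> by simp
      moreover have "z \<in> cball (q (W y (Suc k) ! j)) ((1/2)^j)"
        using z(1) \<open>j \<le> k\<close> lW[of y "Suc k"] unfolding F_def by auto
      ultimately show ?thesis using y by (simp add: v_def dist_commute)
    qed
    moreover have "z \<in> H" using z(1) unfolding F_def by blast
    ultimately show ?thesis using z(2) by blast
  qed
  have conv: "convergent (\<lambda>k. v k y)" for y
  proof (cases "y \<in> fibre_domain E H")
    case True
    show ?thesis
    proof (rule convergent_common_points)
      show "\<exists>a. \<forall>i\<le>n. dist a (v i y) \<le> (1/2)^i" for n using key[OF True, of n] by blast
    qed
  qed (simp add: v_def convergent_const)
  define s where "s y = lim (\<lambda>k. v k y)" for y
  have lim: "(\<lambda>k. v k y) \<longlonglongrightarrow> s y" for y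
    using conv unfolding s_def by (simp add: convergent_LIMSEQ_iff)
  have "s \<in> borel_measurable borel" by (rule borel_measurable_LIMSEQ_metric[OF mv lim])
  moreover have "(y, s y) \<in> E" if y: "y \<in> fibre_domain E H" for y
  proof -
    have "\<exists>z. (y, z) \<in> E \<and> dist z (v k y) \<le> (1/2)^k" for k using key[OF y, of k] by blast
    then obtain z where z: "\<And>k. (y, z k) \<in> E" "\<And>k. dist (z k) (v k y) \<le> (1/2)^k" by metis
    have "(\<lambda>k. dist (z k) (s y)) \<longlonglongrightarrow> 0"
    proof (rule tendsto_sandwich[where f="\<lambda>_. 0" and h="\<lambda>k. (1/2)^k + dist (v k y) (s y)"])
      have "(\<lambda>k. (1/2::real)^k) \<longlonglongrightarrow> 0" by (intro LIMSEQ_power_zero) simp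
      from tendsto_add[OF this tendsto_dist_iff[THEN iffD1, OF lim[of y]]]
      show "(\<lambda>k. (1/2)^k + dist (v k y) (s y)) \<longlonglongrightarrow> 0" by simp
      have "dist (z k) (s y) \<le> (1/2)^k + dist (v k y) (s y)" for k
        using z(2)[of k] dist_triangle[of "z k" "s y" "v k y"] by linarith
      then show "\<forall>\<^sub>F k in sequentially. dist (z k) (s y) \<le> (1/2)^k + dist (v k y) (s y)" by simp
    qed simp_all
    then have "z \<longlonglongrightarrow> s y" by (subst tendsto_dist_iff)
    then have "(\<lambda>k. (y, z k)) \<longlonglongrightarrow> (y, s y)" by (intro tendsto_Pair tendsto_const)
    with z(1) show ?thesis by (rule closed_sequentially[OF E])
  qed
  ultimately show ?thesis by blast
qed

text \<open>Exhaustion by compact sets \<open>H k\<close> whose fibre domains miss at most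
  \<open>1 / Suc k\<close> of the mass; on their union the selection of the first suitable
  \<open>k\<close> is used.\<close>

theorem measurable_selection_ae:
  fixes \<mu> :: "'b::metric_space measure" and E :: "('b \<times> 'c::complete_space) set" and q :: "nat \<Rightarrow> 'c"
  assumes \<mu>: "sets \<mu> = sets borel" "finite_measure \<mu>"
    and E: "closed E" "\<And>y. \<exists>z. (y, z) \<in> E" and q: "dense_sequence q"
  obtains A s where "A \<in> sets borel" "emeasure \<mu> (- A) = 0" "s \<in> borel_measurable borel"
    "\<And>y. y \<in> A \<Longrightarrow> (y, s y) \<in> E"
proof -
  interpret finite_measure \<mu> by fact
  have sp: "space \<mu> = UNIV" using sets_eq_imp_space_eq[OF \<mu>(1)] by simp
  have "\<exists>H. compact H \<and> measure \<mu> UNIV - 1 / Suc k \<le> measure \<mu> (fibre_domain E H)" for k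
  proof (cases "0 < measure \<mu> UNIV - 1 / Suc k")
    case True
    have "ennreal (measure \<mu> UNIV - 1 / Suc k) < emeasure \<mu> UNIV"
    proof -
      have "measure \<mu> UNIV - 1 / Suc k < measure \<mu> UNIV" by simp
      with True show ?thesis unfolding emeasure_eq_measure by (intro ennreal_lessI) linarith+
    qed
    from selection_tight[OF \<mu> E q this] obtain H where
      "compact H" "ennreal (measure \<mu> UNIV - 1 / Suc k) \<le> emeasure \<mu> (fibre_domain E H)" by blast
    then show ?thesis using True by (auto simp: emeasure_eq_measure)
  next
    case False
    then show ?thesis by (intro exI[of _ "{}"]) (auto simp: fibre_domain_def)
  qed
  then obtain H where H: "\<And>k. compact (H k)"
    "\<And>k. measure \<mu> UNIV - 1 / Suc k \<le> measure \<mu> (fibre_domain E (H k))" by metis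
  obtain s where s: "\<And>k. s k \<in> borel_measurable borel" "\<And>k y. y \<in> fibre_domain E (H k) \<Longrightarrow> (y, s k y) \<in> E"
    using compact_selection[OF E(1) H(1) q] by metis
  have mD: "fibre_domain E (H k) \<in> sets borel" for k
    using closed_fibre_domain[OF E(1) H(1)] by simp
  define A where "A = (\<Union>k. fibre_domain E (H k))"
  have mA: "A \<in> sets borel" unfolding A_def using mD by blast
  define t where "t y = s (LEAST k. y \<in> fibre_domain E (H k)) y" for y
  have "(\<lambda>y. LEAST k. y \<in> fibre_domain E (H k)) \<in> borel \<rightarrow>\<^sub>M count_space UNIV"
    by (rule measurable_Least) (use mD in simp)
  then have "t \<in> borel_measurable borel" unfolding t_def
    by (rule measurable_compose_countable[OF s(1)])
  moreover have "(y, t y) \<in> E" if "y \<in> A" for y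
  proof -
    obtain k where "y \<in> fibre_domain E (H k)" using \<open>y \<in> A\<close> unfolding A_def by blast
    then have "y \<in> fibre_domain E (H (LEAST k. y \<in> fibre_domain E (H k)))" by (rule LeastI)
    then show ?thesis unfolding t_def by (rule s(2))
  qed
  moreover have "emeasure \<mu> (- A) = 0"
  proof -
    have "measure \<mu> UNIV \<le> measure \<mu> A"
    proof (rule field_le_epsilon)
      fix e :: real assume "0 < e"
      then obtain k where "1 / Suc k < e" using nat_approx_posE by blast
      moreover have "measure \<mu> (fibre_domain E (H k)) \<le> measure \<mu> A"
        using mA \<mu>(1) unfolding A_def by (intro finite_measure_mono) auto
      ultimately show "measure \<mu> UNIV \<le> measure \<mu> A + e" using H(2)[of k] by linarith
    qed
    moreover have "measure \<mu> (UNIV - A) = measure \<mu> UNIV - measure \<mu> A"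
      using finite_measure_compl[of A] mA \<mu>(1) sp by simp
    ultimately have "measure \<mu> (- A) = 0"
      using measure_nonneg[of \<mu> "- A"] by (simp add: Compl_eq_Diff_UNIV)
    then show ?thesis by (simp add: emeasure_eq_measure)
  qed
  ultimately show ?thesis using that mA by blast
qed

section \<open>Selecting geodesics\<close>

text \<open>Functions with values in the dense sequence that are constant from some coordinate on.
  The distance of functions is at most twice the maximal distance on the first \<open>N\<close>
  coordinates plus \<open>(1/2)^N\<close>, here \<open>2 * (e/8)\<close> plus less than
  \<open>e/4\<close>.\<close>

lemma dense_sequence_fun:
  fixes q :: "nat \<Rightarrow> 'a::metric_space"
  assumes "dense_sequence q"
  shows "\<exists>Q :: nat \<Rightarrow> ('i::countable \<Rightarrow> 'a). dense_sequence Q"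
proof -
  interpret dense_sequence q by fact
  define Q :: "nat \<Rightarrow> 'i \<Rightarrow> 'a" where
    "Q n a = (let l = from_nat n :: nat list in if to_nat a < length l then q (l ! to_nat a) else q 0)" for n a
  have "dense_sequence Q"
  proof
    fix e :: real and p :: "'i \<Rightarrow> 'a" assume e: "0 < e"
    obtain N where N: "(1/2::real)^N < e/4" using real_arch_pow_inv[of "e/4" "1/2"] e by auto
    have "\<forall>a. \<exists>i. dist (p a) (q i) < e/8" using dense[of "e/8"] e by auto
    then obtain i where i: "\<And>a. dist (p a) (q (i a)) < e/8" by metis
    \<comment> \<open>\<open>Q\<close> reads coordinate \<open>a\<close> at position
      \<open>to_nat a\<close>, so the list must be longer than the codes of the first
      \<open>N\<close> coordinates; their sum is a crude bound.\<close>
    define M where "M = Suc (\<Sum>n\<le>N. to_nat (from_nat n :: 'i))"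
    define l where "l = map (\<lambda>k. i (from_nat k)) [0..<M]"
    have Ql: "Q (to_nat l) (from_nat n) = q (i (from_nat n))" if "n \<le> N" for n
    proof -
      have "to_nat (from_nat n :: 'i) < M"
        using member_le_sum[of n "{..N}" "\<lambda>n. to_nat (from_nat n :: 'i)"] that unfolding M_def by simp
      then show ?thesis unfolding Q_def l_def by simp
    qed
    have "{dist (p (from_nat n)) (Q (to_nat l) (from_nat n)) |n. n \<le> N}
        = (\<lambda>n. dist (p (from_nat n)) (Q (to_nat l) (from_nat n))) ` {..N}" by auto
    moreover have "Max ((\<lambda>n. dist (p (from_nat n)) (Q (to_nat l) (from_nat n))) ` {..N}) \<le> e/8"
    proof (rule Max.boundedI)
      fix a assume "a \<in> (\<lambda>n. dist (p (from_nat n)) (Q (to_nat l) (from_nat n))) ` {..N}"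
      then obtain n where "n \<le> N" "a = dist (p (from_nat n)) (Q (to_nat l) (from_nat n))" by auto
      then show "a \<le> e/8" using Ql i[of "from_nat n"] by simp
    qed auto
    ultimately have "Max {dist (p (from_nat n)) (Q (to_nat l) (from_nat n)) |n. n \<le> N} \<le> e/8" by simp
    then have "dist p (Q (to_nat l)) < e"
      using dist_fun_le_dist_first_terms[of p "Q (to_nat l)" N] N e by linarith
    then show "\<exists>n. dist p (Q n) < e" by blast
  qed
  then show ?thesis by blast
qed

text \<open>Clamping lets the whole countable type \<open>rat\<close> serve as the set of times; a
  recorded path is constant outside \<open>[0, 1]\<close>.\<close>

definition clamp01 :: "real \<Rightarrow> real" where
  "clamp01 t = max 0 (min 1 t)"

lemma clamp01_id: "t \<in> {0..1} \<Longrightarrow> clamp01 t = t"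
  and clamp01_mem: "clamp01 t \<in> {0..1}"
  by (auto simp: clamp01_def)

text \<open>Geodesics are recorded by their values at rational times, so that the space of all of them is a
  closed subset of a countable product.\<close>

definition geodesic_paths :: "(('a::metric_space \<times> 'a) \<times> (rat \<Rightarrow> 'a)) set" where
  "geodesic_paths = {z. snd z 0 = fst (fst z) \<and> snd z 1 = snd (fst z) \<and>
     (\<forall>a b. dist (snd z a) (snd z b) =
        \<bar>clamp01 (of_rat a) - clamp01 (of_rat b)\<bar> * dist (fst (fst z)) (snd (fst z)))}"

lemma closed_geodesic_paths: "closed (geodesic_paths :: (('a::metric_space \<times> 'a) \<times> (rat \<Rightarrow> 'a)) set)"
proof -
  have c: "continuous_on UNIV (\<lambda>z::('a \<times> 'a) \<times> (rat \<Rightarrow> 'a). snd z a)" for a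
    by (rule continuous_on_compose2[OF continuous_on_product_coordinates continuous_on_snd[OF continuous_on_id]]) auto
  have f: "continuous_on UNIV (\<lambda>z::('a \<times> 'a) \<times> (rat \<Rightarrow> 'a). fst (fst z))"
    and s: "continuous_on UNIV (\<lambda>z::('a \<times> 'a) \<times> (rat \<Rightarrow> 'a). snd (fst z))"
    by (intro continuous_on_fst continuous_on_snd continuous_on_id)+
  show ?thesis
    unfolding geodesic_paths_def
    by (intro closed_Collect_conj closed_Collect_all closed_Collect_eq c f s
        continuous_on_dist continuous_on_mult continuous_on_const)
qed

lemma geodesic_paths_section:
  assumes "geodesic_space (UNIV :: 'a::metric_space set)"
  shows "\<exists>p. (y :: 'a \<times> 'a, p) \<in> geodesic_paths"
proof -
  obtain \<gamma> :: "real \<Rightarrow> 'a" where \<gamma>: "\<gamma> 0 = fst y" "\<gamma> 1 = snd y"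
    "\<And>s t. s \<in> {0..1} \<Longrightarrow> t \<in> {0..1} \<Longrightarrow> dist (\<gamma> s) (\<gamma> t) = \<bar>s - t\<bar> * dist (fst y) (snd y)"
    using assms unfolding geodesic_space_def by (metis UNIV_I)
  then have "(y, \<lambda>a. \<gamma> (clamp01 (of_rat a))) \<in> geodesic_paths"
    unfolding geodesic_paths_def using clamp01_mem by (auto simp: clamp01_id)
  then show ?thesis by blast
qed

text \<open>Rounding down to the grid of step \<open>1 / Suc k\<close>: a Borel function of
  \<open>t\<close> with values in a countable type, exact at the times \<open>0\<close> and
  \<open>1\<close>, so that limits along it keep the endpoints.\<close>

definition rat_below :: "nat \<Rightarrow> real \<Rightarrow> rat" where
  "rat_below k t = of_int \<lfloor>t * real (Suc k)\<rfloor> / of_nat (Suc k)"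

lemma of_rat_below: "of_rat (rat_below k t) = of_int \<lfloor>t * real (Suc k)\<rfloor> / real (Suc k)"
  unfolding rat_below_def by (simp only: of_rat_divide of_rat_of_int_eq of_rat_of_nat_eq)

lemma rat_below_tendsto: "(\<lambda>k. of_rat (rat_below k t)) \<longlonglongrightarrow> t"
proof (rule LIMSEQ_I)
  fix e :: real assume "0 < e"
  then obtain n where n: "1 / Suc n < e" using nat_approx_posE by blast
  have "norm (of_rat (rat_below k t) - t) < e" if "n \<le> k" for k
  proof -
    have "\<bar>of_int \<lfloor>t * real (Suc k)\<rfloor> - t * real (Suc k)\<bar> \<le> 1" by linarith
    then have "\<bar>of_int \<lfloor>t * real (Suc k)\<rfloor> - t * real (Suc k)\<bar> / real (Suc k) \<le> 1 / real (Suc k)"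
      by (rule divide_right_mono) simp
    moreover have "\<bar>of_int \<lfloor>t * real (Suc k)\<rfloor> / real (Suc k) - t\<bar>
        = \<bar>of_int \<lfloor>t * real (Suc k)\<rfloor> - t * real (Suc k)\<bar> / real (Suc k)"
    proof -
      have "of_int \<lfloor>t * real (Suc k)\<rfloor> / real (Suc k) - t
          = (of_int \<lfloor>t * real (Suc k)\<rfloor> - t * real (Suc k)) / real (Suc k)"
        by (simp add: diff_divide_distrib del: of_nat_Suc)
      then show ?thesis by (simp add: abs_divide del: of_nat_Suc)
    qed
    ultimately have "\<bar>of_int \<lfloor>t * real (Suc k)\<rfloor> / real (Suc k) - t\<bar> \<le> 1 / real (Suc k)" by linarith
    also have "\<dots> \<le> 1 / real (Suc n)" using that by (intro divide_left_mono) auto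
    finally show ?thesis using n unfolding of_rat_below by simp
  qed
  then show "\<exists>no. \<forall>k\<ge>no. norm (of_rat (rat_below k t) - t) < e" by blast
qed

lemma measurable_rat_below: "rat_below k \<in> borel \<rightarrow>\<^sub>M count_space UNIV"
proof -
  have "(\<lambda>t. t * real (Suc k)) \<in> borel_measurable borel" by measurable
  from measurable_compose[OF measurable_compose[OF this measurable_real_floor],
      of "\<lambda>i. of_int i / of_nat (Suc k) :: rat"]
  show ?thesis unfolding rat_below_def by simp
qed

text \<open>The geodesic identities are asked only almost everywhere, which is what a measurable
  selection provides. Joint measurability in point and time is included because Fubini's theorem
  will exchange the plan with time.\<close>

definition geodesic_interpolation ::
    "('a::metric_space \<times> 'a) measure \<Rightarrow> ('a \<times> 'a \<Rightarrow> real \<Rightarrow> 'a) \<Rightarrow> bool" where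
  "geodesic_interpolation \<sigma> G \<longleftrightarrow>
     (\<forall>t. (\<lambda>z. G z t) \<in> borel_measurable borel) \<and>
     (\<lambda>(z, t). G z t) \<in> borel_measurable (borel \<Otimes>\<^sub>M borel) \<and>
     (AE z in \<sigma>. G z 0 = fst z \<and> G z 1 = snd z \<and>
       (\<forall>s\<in>{0..1}. \<forall>t\<in>{0..1}. dist (G z s) (G z t) = \<bar>s - t\<bar> * dist (fst z) (snd z)))"

text \<open>A path is selected at rational times and extended by continuity: the speed identity
  makes the values along \<open>rat_below k t\<close> a Cauchy sequence. The approximants depend on
  \<open>t\<close> only through a countable type, so they and their limit are jointly
  measurable.\<close>

theorem geodesic_selection:
  fixes \<sigma> :: "('a::complete_space \<times> 'a) measure" and q :: "nat \<Rightarrow> 'a"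
  assumes geo: "geodesic_space (UNIV :: 'a set)" and q: "dense_sequence q"
    and \<sigma>: "sets \<sigma> = sets borel" "finite_measure \<sigma>"
  obtains G where "geodesic_interpolation \<sigma> G"
proof -
  obtain Q :: "nat \<Rightarrow> (rat \<Rightarrow> 'a)" where Q: "dense_sequence Q" using dense_sequence_fun[OF q] by blast
  obtain A p where A: "A \<in> sets borel" "emeasure \<sigma> (- A) = 0" "p \<in> borel_measurable borel"
    and p: "\<And>z. z \<in> A \<Longrightarrow> (z, p z :: rat \<Rightarrow> 'a) \<in> geodesic_paths"
    using measurable_selection_ae[OF \<sigma> closed_geodesic_paths geodesic_paths_section[OF geo] Q] by metis
  \<comment> \<open>Off the set \<open>A\<close> of good pairs the path stays at its initial point,
    which keeps every limit below convergent.\<close>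
  define P where "P a z = (if z \<in> A then p z a else fst z)" for a z
  have mP: "P a \<in> borel_measurable borel" for a
  proof -
    have "(\<lambda>z. p z a) \<in> borel_measurable borel"
      using measurable_compose[OF A(3) borel_measurable_continuous_onI[OF continuous_on_product_coordinates]] .
    then show ?thesis unfolding P_def using A(1) borel_measurable_fst' by (intro measurable_If_set) auto
  qed
  define D where "D z = dist (fst z) (snd z)" for z :: "'a \<times> 'a"
  have pd: "dist (p z a) (p z b) = \<bar>clamp01 (of_rat a) - clamp01 (of_rat b)\<bar> * D z"
    and p0: "p z 0 = fst z" and p1: "p z 1 = snd z" if "z \<in> A" for z a b
    using p[OF that] unfolding geodesic_paths_def D_def by auto
  have cl: "(\<lambda>k. clamp01 (of_rat (rat_below k t))) \<longlonglongrightarrow> clamp01 t" for t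
    unfolding clamp01_def by (intro tendsto_max tendsto_min tendsto_const rat_below_tendsto)
  have conv: "convergent (\<lambda>k. P (rat_below k t) z)" for t z
  proof (cases "z \<in> A")
    case True
    have "Cauchy (\<lambda>k. P (rat_below k t) z)"
    proof (rule metric_CauchyI)
      fix e :: real assume "0 < e"
      define e' where "e' = e / (D z + 1)"
      have D0: "0 \<le> D z" unfolding D_def by simp
      then have e': "0 < e'" using \<open>0 < e\<close> unfolding e'_def by (intro divide_pos_pos) auto
      have "Cauchy (\<lambda>k. clamp01 (of_rat (rat_below k t)))" by (rule LIMSEQ_imp_Cauchy[OF cl])
      from metric_CauchyD[OF this e'] obtain M where
        M: "\<And>m n. M \<le> m \<Longrightarrow> M \<le> n \<Longrightarrow>
          dist (clamp01 (of_rat (rat_below m t))) (clamp01 (of_rat (rat_below n t))) < e'" by blast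
      have "dist (P (rat_below m t) z) (P (rat_below n t) z) < e" if "M \<le> m" "M \<le> n" for m n
      proof -
        have "dist (P (rat_below m t) z) (P (rat_below n t) z)
            = \<bar>clamp01 (of_rat (rat_below m t)) - clamp01 (of_rat (rat_below n t))\<bar> * D z"
          using True pd by (simp add: P_def)
        also have "\<dots> \<le> e' * D z"
          using M[OF that] D0 by (intro mult_right_mono) (auto simp: dist_real_def)
        also have "\<dots> < e' * (D z + 1)" using e' by simp
        also have "\<dots> = e" using D0 unfolding e'_def by simp
        finally show ?thesis .
      qed
      then show "\<exists>M. \<forall>m\<ge>M. \<forall>n\<ge>M. dist (P (rat_below m t) z) (P (rat_below n t) z) < e" by blast
    qed
    then show ?thesis by (simp add: Cauchy_convergent_iff)
  qed (simp add: P_def convergent_const)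
  define G where "G z t = lim (\<lambda>k. P (rat_below k t) z)" for z t
  have lim: "(\<lambda>k. P (rat_below k t) z) \<longlonglongrightarrow> G z t" for z t
    using conv unfolding G_def by (simp add: convergent_LIMSEQ_iff)
  have "\<forall>t. (\<lambda>z. G z t) \<in> borel_measurable borel"
    by (intro allI borel_measurable_LIMSEQ_metric[OF mP lim])
  moreover have "(\<lambda>(z, t). G z t) \<in> borel_measurable (borel \<Otimes>\<^sub>M borel)"
  proof (rule borel_measurable_LIMSEQ_metric)
    fix k
    have "(\<lambda>x::('a \<times> 'a) \<times> real. P a (fst x)) \<in> borel_measurable (borel \<Otimes>\<^sub>M borel)" for a
      by (rule measurable_compose[OF measurable_fst mP])
    from measurable_compose_countable[OF this measurable_compose[OF measurable_snd measurable_rat_below]]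
    show "(\<lambda>x::('a \<times> 'a) \<times> real. P (rat_below k (snd x)) (fst x)) \<in> borel_measurable (borel \<Otimes>\<^sub>M borel)" .
  next
    fix x :: "('a \<times> 'a) \<times> real"
    show "(\<lambda>k. P (rat_below k (snd x)) (fst x)) \<longlonglongrightarrow> (case x of (z, t) \<Rightarrow> G z t)"
      using lim by (simp add: case_prod_beta)
  qed
  moreover have "G z 0 = fst z" if "z \<in> A" for z
  proof -
    have "(\<lambda>k. P (rat_below k 0) z) = (\<lambda>k. fst z)" using that p0 by (simp add: P_def rat_below_def)
    then show ?thesis using lim[of 0 z] by (simp add: LIMSEQ_const_iff)
  qed
  moreover have "G z 1 = snd z" if "z \<in> A" for z
  proof -
    have "rat_below k 1 = 1" for k
    proof -
      have "\<lfloor>1 * real (Suc k)\<rfloor> = int (Suc k)" by (simp only: mult_1 floor_of_nat)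
      then show ?thesis unfolding rat_below_def by (simp only: of_int_of_nat_eq) simp
    qed
    then have "(\<lambda>k. P (rat_below k 1) z) = (\<lambda>k. snd z)" using that p1 by (simp add: P_def)
    then show ?thesis using lim[of 1 z] by (simp add: LIMSEQ_const_iff)
  qed
  moreover have "dist (G z s) (G z t) = \<bar>s - t\<bar> * dist (fst z) (snd z)"
    if "z \<in> A" "s \<in> {0..1}" "t \<in> {0..1}" for z s t
  proof -
    have "(\<lambda>k. dist (P (rat_below k s) z) (P (rat_below k t) z)) \<longlonglongrightarrow> dist (G z s) (G z t)"
      by (intro tendsto_dist lim)
    moreover have "(\<lambda>k. dist (P (rat_below k s) z) (P (rat_below k t) z))
        = (\<lambda>k. \<bar>clamp01 (of_rat (rat_below k s)) - clamp01 (of_rat (rat_below k t))\<bar> * D z)"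
      using that pd by (simp add: P_def)
    moreover have "(\<lambda>k. \<bar>clamp01 (of_rat (rat_below k s)) - clamp01 (of_rat (rat_below k t))\<bar> * D z)
        \<longlonglongrightarrow> \<bar>clamp01 s - clamp01 t\<bar> * D z"
      by (intro tendsto_mult tendsto_const tendsto_rabs tendsto_diff cl)
    ultimately have "dist (G z s) (G z t) = \<bar>clamp01 s - clamp01 t\<bar> * D z"
      using LIMSEQ_unique by metis
    then show ?thesis using that by (simp add: clamp01_id D_def)
  qed
  moreover have "AE z in \<sigma>. z \<in> A"
    using A(1,2) \<sigma>(1) sets_eq_imp_space_eq[OF \<sigma>(1)] by (intro AE_I[of _ _ "- A"]) auto
  ultimately show ?thesis
    by (intro that[of G]) (auto simp: geodesic_interpolation_def elim!: eventually_mono)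
qed

section \<open>The Wasserstein distance\<close>

definition transport_cost :: "('a::metric_space \<times> 'a) measure \<Rightarrow> ennreal" where
  "transport_cost \<sigma> = (\<integral>\<^sup>+z. ennreal ((dist (fst z) (snd z))\<^sup>2) \<partial>\<sigma>)"

lemma measurable_dist_sq [measurable]:
  "(\<lambda>z::'a::metric_space \<times> 'a. ennreal ((dist (fst z) (snd z))\<^sup>2)) \<in> borel_measurable borel"
  by (intro borel_measurable_continuous_onI continuous_on_ennreal continuous_intros)

lemma ennreal_sqrt_mono:
  assumes "a \<le> b"
  shows "ennreal_sqrt a \<le> ennreal_sqrt b"
proof (cases "b = \<infinity>")
  case False
  then have "b < top" "a \<noteq> \<infinity>" using assms by (auto simp: less_top top_unique)
  then show ?thesis unfolding ennreal_sqrt_def using assms False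
    by (auto intro!: ennreal_leI real_sqrt_le_mono enn2real_mono)
qed (simp add: ennreal_sqrt_def)

lemma ennreal_sqrt_power2: "0 \<le> c \<Longrightarrow> ennreal_sqrt (ennreal (c\<^sup>2)) = ennreal c"
  by (simp add: ennreal_sqrt_def)

lemma W2_le:
  assumes "\<sigma> \<in> couplings \<mu> \<nu>" "transport_cost \<sigma> \<le> ennreal (c\<^sup>2)" "0 \<le> c"
  shows "W2 \<mu> \<nu> \<le> ennreal c"
proof -
  have "W2 \<mu> \<nu> \<le> ennreal_sqrt (ennreal (c\<^sup>2))"
    unfolding W2_def using assms unfolding transport_cost_def
    by (intro ennreal_sqrt_mono) (rule INF_lower2)
  then show ?thesis using assms(3) by (simp add: ennreal_sqrt_power2)
qed

lemma W2_lessD: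
  assumes "W2 \<mu> \<nu> < ennreal c" "0 \<le> c"
  shows "\<exists>\<sigma>\<in>couplings \<mu> \<nu>. transport_cost \<sigma> \<le> ennreal (c\<^sup>2)"
proof (rule ccontr)
  assume "\<not> ?thesis"
  then have "ennreal (c\<^sup>2) \<le> (INF \<sigma>\<in>couplings \<mu> \<nu>. transport_cost \<sigma>)"
    by (intro INF_greatest) auto
  from ennreal_sqrt_mono[OF this] have "ennreal c \<le> W2 \<mu> \<nu>"
    using assms(2) unfolding W2_def transport_cost_def by (simp add: ennreal_sqrt_power2)
  then show False using assms(1) by simp
qed

lemma borel_measurable_swap:
  "prod.swap \<in> borel_measurable (borel :: ('a::topological_space \<times> 'b::topological_space) measure)"
  by (intro borel_measurable_continuous_onI continuous_on_swap)

lemma borel_probsD: "\<sigma> \<in> borel_probs \<Longrightarrow> prob_space \<sigma>" "\<sigma> \<in> borel_probs \<Longrightarrow> sets \<sigma> = sets borel"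
  by (simp_all add: borel_probs_def)

lemma borel_measurable_borel_probs:
  "\<sigma> \<in> borel_probs \<Longrightarrow> f \<in> borel_measurable \<sigma> \<longleftrightarrow> f \<in> borel_measurable borel"
  by (auto simp: borel_probs_def cong: measurable_cong_sets)

lemma distr_in_borel_probs:
  assumes "prob_space M" "f \<in> borel_measurable M"
  shows "distr M borel f \<in> borel_probs"
  using assms by (simp add: borel_probs_def prob_space.prob_space_distr)

lemma W2_commute_le: "W2 \<mu> \<nu> \<le> W2 \<nu> \<mu>"
  unfolding W2_def
proof (intro ennreal_sqrt_mono INF_mono)
  fix \<sigma> assume \<sigma>: "\<sigma> \<in> couplings \<nu> \<mu>"
  then have b: "\<sigma> \<in> borel_probs" by (simp add: couplings_def)
  have ms: "prod.swap \<in> borel_measurable \<sigma>"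
    using borel_measurable_swap borel_measurable_borel_probs[OF b] by blast
  have "distr \<sigma> borel prod.swap \<in> couplings \<mu> \<nu>"
    unfolding couplings_def
  proof (intro CollectI conjI)
    show "distr \<sigma> borel prod.swap \<in> borel_probs"
      by (rule distr_in_borel_probs[OF borel_probsD(1)[OF b] ms])
    have "fst \<circ> prod.swap = (snd :: 'a \<times> 'a \<Rightarrow> 'a)" "snd \<circ> prod.swap = (fst :: 'a \<times> 'a \<Rightarrow> 'a)" by auto
    then show "distr (distr \<sigma> borel prod.swap) borel fst = \<mu>" "distr (distr \<sigma> borel prod.swap) borel snd = \<nu>"
      using \<sigma> distr_distr[OF borel_measurable_fst' ms] distr_distr[OF borel_measurable_snd' ms]
      by (simp_all add: couplings_def)
  qed
  moreover have "transport_cost (distr \<sigma> borel prod.swap) \<le> transport_cost \<sigma>"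
    unfolding transport_cost_def using ms
    by (subst nn_integral_distr) (use measurable_dist_sq in \<open>auto simp: dist_commute\<close>)
  ultimately show "\<exists>\<sigma>'\<in>couplings \<mu> \<nu>. (\<integral>\<^sup>+z. ennreal ((dist (fst z) (snd z))\<^sup>2) \<partial>\<sigma>')
      \<le> (\<integral>\<^sup>+z. ennreal ((dist (fst z) (snd z))\<^sup>2) \<partial>\<sigma>)"
    unfolding transport_cost_def by blast
qed

lemma W2_commute: "W2 \<mu> \<nu> = W2 \<nu> \<mu>"
  by (intro antisym W2_commute_le)

text \<open>Cauchy-Schwarz with weights \<open>a\<close>, \<open>b\<close>,
  \<open>\<epsilon>\<close>, where \<open>e\<^sup>2 / \<epsilon> \<le> \<epsilon>\<close>. With the
  two transport distances as weights, integrating this pointwise bound gives Minkowski's inequality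
  without roots of integrals.\<close>

lemma weighted_sum_square_le:
  fixes a b \<epsilon> x y e :: real
  assumes "0 < a" "0 < b" "0 < \<epsilon>" "\<bar>e\<bar> \<le> \<epsilon>"
  shows "(x + y + e)\<^sup>2 \<le> (a + b + \<epsilon>) * (x\<^sup>2 / a + y\<^sup>2 / b + \<epsilon>)"
proof -
  define S where "S = a + b + \<epsilon>"
  \<comment> \<open>\<open>T\<close> maximises \<open>2 * (x + y + e) * T - S * T\<^sup>2\<close>;
    at this value the three inequalities
    \<open>2 * v * T - c * T\<^sup>2 \<le> v\<^sup>2 / c\<close> add up to the claim.\<close>
  define T where "T = (x + y + e) / S"
  have S: "0 < S" using assms by (simp add: S_def)
  have *: "2 * v * T - c * T\<^sup>2 \<le> v\<^sup>2 / c" if "0 < c" for v c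
  proof -
    have "0 \<le> (v - c * T)\<^sup>2 / c" using that by simp
    also have "\<dots> = v\<^sup>2 / c - 2 * v * T + c * T\<^sup>2"
      using that by (simp add: power2_eq_square field_simps)
    finally show ?thesis by simp
  qed
  have "e\<^sup>2 / \<epsilon> \<le> \<epsilon>"
    using assms(3,4) by (simp add: field_simps power2_eq_square[symmetric] abs_le_square_iff[symmetric])
  then have "2 * (x + y + e) * T - S * T\<^sup>2 \<le> x\<^sup>2 / a + y\<^sup>2 / b + \<epsilon>"
    using *[OF assms(1), of x] *[OF assms(2), of y] *[OF assms(3), of e] by (simp add: S_def algebra_simps)
  moreover have "2 * (x + y + e) * T - S * T\<^sup>2 = S * T\<^sup>2"
  proof -
    have "x + y + e = S * T" using S by (simp add: T_def)
    then show ?thesis by (simp add: power2_eq_square)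
  qed
  ultimately have "S * (S * T\<^sup>2) \<le> S * (x\<^sup>2 / a + y\<^sup>2 / b + \<epsilon>)" using S by simp
  moreover have "S * (S * T\<^sup>2) = (x + y + e)\<^sup>2" using S by (simp add: T_def power2_eq_square)
  ultimately show ?thesis by (simp add: S_def)
qed

lemma nn_integral_affine:
  assumes [measurable]: "f \<in> borel_measurable M" "g \<in> borel_measurable M"
  shows "(\<integral>\<^sup>+p. a * f p + b * g p + c \<partial>M) =
     a * (\<integral>\<^sup>+p. f p \<partial>M) + b * (\<integral>\<^sup>+p. g p \<partial>M) + c * emeasure M (space M)"
  by (simp add: nn_integral_add nn_integral_cmult)

section \<open>Approximate gluing of couplings and the triangle inequality\<close>

context dense_sequence
begin

definition cell :: "real \<Rightarrow> 'a \<Rightarrow> nat" where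
  "cell \<epsilon> x = (LEAST i. dist x (q i) < \<epsilon>)"

lemma dist_cell: "0 < \<epsilon> \<Longrightarrow> dist x (q (cell \<epsilon> x)) < \<epsilon>"
  unfolding cell_def by (rule LeastI_ex) (rule dense)

lemma measurable_cell: "cell \<epsilon> \<in> borel \<rightarrow>\<^sub>M count_space UNIV"
  unfolding cell_def
proof (rule measurable_Least)
  fix i
  have "open {x. dist x (q i) < \<epsilon>}" by (intro open_Collect_less continuous_intros)
  then have "{x. dist x (q i) < \<epsilon>} \<in> sets borel" by (rule borel_open)
  then show "Measurable.pred borel (\<lambda>x. dist x (q i) < \<epsilon>)" by (simp add: pred_def)
qed

text \<open>Instead of disintegrating both couplings over the middle marginal, they are glued along a
  countable partition into cells of diameter below \<open>2 \<epsilon>\<close>; this needs only a density with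
  respect to their product and costs an error \<open>2 \<epsilon>\<close>.\<close>

lemma glue_cost:
  assumes \<alpha>: "\<alpha> \<in> couplings \<mu> \<nu>" "transport_cost \<alpha> \<le> ennreal (a\<^sup>2)" "0 < a"
    and \<beta>: "\<beta> \<in> couplings \<nu> \<rho>" "transport_cost \<beta> \<le> ennreal (b\<^sup>2)" "0 < b"
    and \<epsilon>: "0 < \<epsilon>"
  shows "W2 \<mu> (\<rho> :: 'a measure) \<le> ennreal (a + b + 2 * \<epsilon>)"
proof -
  have \<alpha>b: "\<alpha> \<in> borel_probs" and \<beta>b: "\<beta> \<in> borel_probs" using \<alpha> \<beta> by (auto simp: couplings_def)
  interpret A: prob_space \<alpha> using borel_probsD[OF \<alpha>b] by simp
  interpret B: prob_space \<beta> using borel_probsD[OF \<beta>b] by simp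
  interpret AB: pair_sigma_finite \<alpha> \<beta> ..
  note s\<alpha>[measurable_cong] = borel_probsD(2)[OF \<alpha>b]
  note s\<beta>[measurable_cong] = borel_probsD(2)[OF \<beta>b]
  note [measurable] = borel_measurable_fst' borel_measurable_snd' measurable_cell
  have sp: "space \<alpha> = UNIV" "space \<beta> = UNIV"
    using sets_eq_imp_space_eq[OF s\<alpha>] sets_eq_imp_space_eq[OF s\<beta>] by simp_all
  have \<nu>\<alpha>: "\<nu> = distr \<alpha> borel snd" and \<nu>\<beta>: "\<nu> = distr \<beta> borel fst"
    and \<mu>: "\<mu> = distr \<alpha> borel fst" and \<rho>: "\<rho> = distr \<beta> borel snd"
    using \<alpha> \<beta> by (auto simp: couplings_def)
  define c where "c i = emeasure \<nu> {x. cell \<epsilon> x = i}" for i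
  have mc: "{x. cell \<epsilon> x = i} \<in> sets borel" for i
  proof -
    have "cell \<epsilon> -` {i} \<inter> space borel \<in> sets borel" by (rule measurable_sets[OF measurable_cell]) simp
    then show ?thesis by (simp add: vimage_def)
  qed
  have c\<alpha>: "emeasure \<alpha> {z. cell \<epsilon> (snd z) = i} = c i" for i
    unfolding c_def \<nu>\<alpha> using mc sp by (subst emeasure_distr) (auto simp: vimage_def)
  have c\<beta>: "emeasure \<beta> {z. cell \<epsilon> (fst z) = i} = c i" for i
    unfolding c_def \<nu>\<beta> using mc sp by (subst emeasure_distr) (auto simp: vimage_def)
  have m\<alpha>: "{z. cell \<epsilon> (snd z) = i} \<in> sets \<alpha>" and m\<beta>: "{z. cell \<epsilon> (fst z) = i} \<in> sets \<beta>" for i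
    using measurable_sets[OF borel_measurable_snd' mc[of i]] measurable_sets[OF borel_measurable_fst' mc[of i]]
    by (simp_all add: s\<alpha> s\<beta> vimage_def)
  have ctop: "c i \<noteq> \<infinity>" for i unfolding c\<alpha>[symmetric] by simp
  \<comment> \<open>Conditional independence given the cell of the middle point: pairs whose middle
    points share the cell \<open>i\<close> get weight \<open>1 / c i\<close>, so integrating out
    either factor gives \<open>1\<close> and leaves the other coupling unchanged.\<close>
  define h :: "('a \<times> 'a) \<times> ('a \<times> 'a) \<Rightarrow> ennreal" where
    "h p = (if cell \<epsilon> (snd (fst p)) = cell \<epsilon> (fst (snd p)) then inverse (c (cell \<epsilon> (snd (fst p)))) else 0)" for p
  have m1: "(\<lambda>p. cell \<epsilon> (snd (fst p))) \<in> \<alpha> \<Otimes>\<^sub>M \<beta> \<rightarrow>\<^sub>M count_space UNIV"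
    and m2: "(\<lambda>p. cell \<epsilon> (fst (snd p))) \<in> \<alpha> \<Otimes>\<^sub>M \<beta> \<rightarrow>\<^sub>M count_space UNIV"
    by measurable
  have mh[measurable]: "h \<in> borel_measurable (\<alpha> \<Otimes>\<^sub>M \<beta>)"
  proof -
    have "(\<lambda>p. if i = cell \<epsilon> (fst (snd p)) then inverse (c i) else 0) \<in> borel_measurable (\<alpha> \<Otimes>\<^sub>M \<beta>)" for i
      using measurable_compose[OF m2, of "\<lambda>j. if i = j then inverse (c i) else 0" borel] by simp
    from measurable_compose_countable[OF this m1] show ?thesis unfolding h_def .
  qed
  define \<gamma> where "\<gamma> = density (\<alpha> \<Otimes>\<^sub>M \<beta>) h"
  have inv: "c i * inverse (c i) = 1" if "c i \<noteq> 0" for i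
    using ennreal_divide_self[of "c i"] that ctop[of i]
    by (simp add: divide_ennreal_def less_top)
  \<comment> \<open>Cells of mass zero, where the weight is infinite, are avoided almost
    everywhere.\<close>
  have ae: "AE z in \<kappa>. c (cell \<epsilon> (h' z)) \<noteq> 0"
    if "\<And>i. {z. cell \<epsilon> (h' z) = i} \<in> sets \<kappa>" "\<And>i. emeasure \<kappa> {z. cell \<epsilon> (h' z) = i} = c i"
    for \<kappa> :: "('a \<times> 'a) measure" and h'
  proof -
    have "AE z in \<kappa>. cell \<epsilon> (h' z) = i \<longrightarrow> c i \<noteq> 0" for i
    proof (cases "c i = 0")
      case True
      then have "{z. cell \<epsilon> (h' z) = i} \<in> null_sets \<kappa>" using that by (intro null_setsI) auto
      from AE_not_in[OF this] show ?thesis by eventually_elim auto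
    qed simp
    then have "AE z in \<kappa>. \<forall>i. cell \<epsilon> (h' z) = i \<longrightarrow> c i \<noteq> 0" unfolding AE_all_countable by blast
    then show ?thesis by eventually_elim auto
  qed
  have ae\<alpha>: "AE z in \<alpha>. c (cell \<epsilon> (snd z)) \<noteq> 0" by (rule ae[OF m\<alpha> c\<alpha>])
  have ae\<beta>: "AE z in \<beta>. c (cell \<epsilon> (fst z)) \<noteq> 0" by (rule ae[OF m\<beta> c\<beta>])
  have int1: "(\<integral>\<^sup>+p. F (fst p) \<partial>\<gamma>) = (\<integral>\<^sup>+z. F z \<partial>\<alpha>)" if [measurable]: "F \<in> borel_measurable borel" for F
  proof -
    have "(\<integral>\<^sup>+p. F (fst p) \<partial>\<gamma>) = (\<integral>\<^sup>+p. h p * F (fst p) \<partial>(\<alpha> \<Otimes>\<^sub>M \<beta>))"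
      unfolding \<gamma>_def by (intro nn_integral_density) measurable
    also have "\<dots> = (\<integral>\<^sup>+z. \<integral>\<^sup>+w. h (z, w) * F z \<partial>\<beta> \<partial>\<alpha>)"
      by (subst B.nn_integral_fst[symmetric]) (auto intro: nn_integral_cong)
    also have "\<dots> = (\<integral>\<^sup>+z. F z \<partial>\<alpha>)"
    proof (rule nn_integral_cong_AE, use ae\<alpha> in eventually_elim)
      fix z :: "'a \<times> 'a" assume n0: "c (cell \<epsilon> (snd z)) \<noteq> 0"
      let ?i = "cell \<epsilon> (snd z)"
      have "(\<integral>\<^sup>+w. h (z, w) * F z \<partial>\<beta>)
          = (\<integral>\<^sup>+w. (inverse (c ?i) * F z) * indicator {w. cell \<epsilon> (fst w) = ?i} w \<partial>\<beta>)"
        by (intro nn_integral_cong) (auto simp: h_def split: split_indicator)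
      also have "\<dots> = inverse (c ?i) * F z * c ?i"
        using m\<beta> c\<beta> by (subst nn_integral_cmult_indicator) auto
      also have "\<dots> = F z" using inv[OF n0] by (simp add: mult.commute mult.left_commute)
      finally show "(\<integral>\<^sup>+w. h (z, w) * F z \<partial>\<beta>) = F z" .
    qed
    finally show ?thesis .
  qed
  have int2: "(\<integral>\<^sup>+p. F (snd p) \<partial>\<gamma>) = (\<integral>\<^sup>+z. F z \<partial>\<beta>)" if [measurable]: "F \<in> borel_measurable borel" for F
  proof -
    have "(\<integral>\<^sup>+p. F (snd p) \<partial>\<gamma>) = (\<integral>\<^sup>+p. h p * F (snd p) \<partial>(\<alpha> \<Otimes>\<^sub>M \<beta>))"
      unfolding \<gamma>_def by (intro nn_integral_density) measurable
    also have "\<dots> = (\<integral>\<^sup>+w. \<integral>\<^sup>+z. h (z, w) * F w \<partial>\<alpha> \<partial>\<beta>)"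
      by (subst AB.nn_integral_snd[symmetric]) (auto intro: nn_integral_cong)
    also have "\<dots> = (\<integral>\<^sup>+w. F w \<partial>\<beta>)"
    proof (rule nn_integral_cong_AE, use ae\<beta> in eventually_elim)
      fix w :: "'a \<times> 'a" assume n0: "c (cell \<epsilon> (fst w)) \<noteq> 0"
      let ?i = "cell \<epsilon> (fst w)"
      have "(\<integral>\<^sup>+z. h (z, w) * F w \<partial>\<alpha>)
          = (\<integral>\<^sup>+z. (inverse (c ?i) * F w) * indicator {z. cell \<epsilon> (snd z) = ?i} z \<partial>\<alpha>)"
        by (intro nn_integral_cong) (auto simp: h_def split: split_indicator)
      also have "\<dots> = inverse (c ?i) * F w * c ?i"
        using m\<alpha> c\<alpha> by (subst nn_integral_cmult_indicator) auto
      also have "\<dots> = F w" using inv[OF n0] by (simp add: mult.commute mult.left_commute)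
      finally show "(\<integral>\<^sup>+z. h (z, w) * F w \<partial>\<alpha>) = F w" .
    qed
    finally show ?thesis .
  qed
  have s\<gamma>[measurable_cong]: "sets \<gamma> = sets (\<alpha> \<Otimes>\<^sub>M \<beta>)" by (simp add: \<gamma>_def)
  have sp\<gamma>: "space \<gamma> = UNIV" using sets_eq_imp_space_eq[OF s\<gamma>] sp by (simp add: space_pair_measure)
  have f1: "(\<lambda>p. fst (fst p)) \<in> borel_measurable \<gamma>" and f2: "(\<lambda>p. snd (snd p)) \<in> borel_measurable \<gamma>"
    by measurable
  define T where "T p = (fst (fst p), snd (snd p))" for p :: "('a \<times> 'a) \<times> ('a \<times> 'a)"
  have mT: "T \<in> borel_measurable \<gamma>" unfolding T_def by (rule borel_measurable_Pair'[OF f1 f2])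
  have "emeasure \<gamma> UNIV = 1"
    using int1[of "\<lambda>_. 1"] A.emeasure_space_1 sp sp\<gamma> by simp
  then have pg: "prob_space \<gamma>" using sp\<gamma> by (intro prob_spaceI) simp
  have "distr \<gamma> borel T \<in> couplings \<mu> \<rho>"
    unfolding couplings_def
  proof (intro CollectI conjI)
    show "distr \<gamma> borel T \<in> borel_probs" by (rule distr_in_borel_probs[OF pg mT])
    have "fst \<circ> T = (\<lambda>p. fst (fst p))" "snd \<circ> T = (\<lambda>p. snd (snd p))" by (auto simp: T_def)
    then have "distr (distr \<gamma> borel T) borel fst = distr \<gamma> borel (\<lambda>p. fst (fst p))"
      "distr (distr \<gamma> borel T) borel snd = distr \<gamma> borel (\<lambda>p. snd (snd p))"
      using distr_distr[OF borel_measurable_fst' mT] distr_distr[OF borel_measurable_snd' mT] by simp_all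
    moreover have marg: "distr \<gamma> borel (\<lambda>p. h' (f p)) = distr \<kappa> borel h'"
      if f: "(\<lambda>p. h' (f p)) \<in> borel_measurable \<gamma>" and h': "h' \<in> borel_measurable borel"
        and \<kappa>: "sets \<kappa> = sets borel"
        and int: "\<And>F. F \<in> borel_measurable borel \<Longrightarrow> (\<integral>\<^sup>+p. F (f p) \<partial>\<gamma>) = (\<integral>\<^sup>+z. F z \<partial>\<kappa>)"
      for f and \<kappa> :: "('a \<times> 'a) measure" and h' :: "'a \<times> 'a \<Rightarrow> 'a"
    proof (rule measure_eqI)
      fix X assume "X \<in> sets (distr \<gamma> borel (\<lambda>p. h' (f p)))"
      then have X[measurable]: "X \<in> sets borel" by simp
      have h\<kappa>: "h' \<in> borel_measurable \<kappa>" using h' \<kappa> by (simp cong: measurable_cong_sets)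
      have "emeasure (distr \<gamma> borel (\<lambda>p. h' (f p))) X = (\<integral>\<^sup>+x. indicator X x \<partial>distr \<gamma> borel (\<lambda>p. h' (f p)))"
        using X by simp
      also have "\<dots> = (\<integral>\<^sup>+p. indicator X (h' (f p)) \<partial>\<gamma>)" by (intro nn_integral_distr f) simp
      also have "\<dots> = (\<integral>\<^sup>+z. indicator X (h' z) \<partial>\<kappa>)"
        by (rule int) (rule measurable_compose[OF h'], simp)
      also have "\<dots> = (\<integral>\<^sup>+x. indicator X x \<partial>distr \<kappa> borel h')"
        by (intro nn_integral_distr[symmetric] h\<kappa>) simp
      finally show "emeasure (distr \<gamma> borel (\<lambda>p. h' (f p))) X = emeasure (distr \<kappa> borel h') X" using X by simp
    qed simp
    note marg[OF f1 borel_measurable_fst' s\<alpha> int1] marg[OF f2 borel_measurable_snd' s\<beta> int2]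
    ultimately show "distr (distr \<gamma> borel T) borel fst = \<mu>" "distr (distr \<gamma> borel T) borel snd = \<rho>"
      by (simp_all add: \<mu> \<rho>)
  qed
  moreover have "transport_cost (distr \<gamma> borel T) \<le> ennreal ((a + b + 2 * \<epsilon>)\<^sup>2)"
  proof -
    \<comment> \<open>With weights \<open>a\<close>, \<open>b\<close>, \<open>2 * \<epsilon>\<close>
      the integrated bound collapses to a square: \<open>S / a * a\<^sup>2 + S / b * b\<^sup>2 + S *
      (2 * \<epsilon>) = S\<^sup>2\<close>.\<close>
    define S where "S = a + b + 2 * \<epsilon>"
    have S: "0 < S" using \<alpha> \<beta> \<epsilon> by (simp add: S_def)
    define Sa where "Sa = S / a"
    define Sb where "Sb = S / b"
    have Sab: "0 < Sa" "0 < Sb" using S \<alpha>(3) \<beta>(3) by (simp_all add: Sa_def Sb_def)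
    let ?d = "\<lambda>z::'a \<times> 'a. (dist (fst z) (snd z))\<^sup>2"
    have md: "(\<lambda>z. ennreal (?d z)) \<in> borel_measurable borel" by (rule measurable_dist_sq)
    have "transport_cost (distr \<gamma> borel T) = (\<integral>\<^sup>+p. ennreal (?d (T p)) \<partial>\<gamma>)"
      unfolding transport_cost_def by (rule nn_integral_distr[OF mT]) (use md in simp)
    also have "\<dots> \<le> (\<integral>\<^sup>+p. ennreal Sa * ennreal (?d (fst p)) + ennreal Sb * ennreal (?d (snd p)) + ennreal (S * (2 * \<epsilon>)) \<partial>\<gamma>)"
    proof (rule nn_integral_mono_AE)
      have "AE p in \<alpha> \<Otimes>\<^sub>M \<beta>. 0 < h p \<longrightarrow> ennreal (?d (T p)) \<le> ennreal Sa * ennreal (?d (fst p)) + ennreal Sb * ennreal (?d (snd p)) + ennreal (S * (2 * \<epsilon>))"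
      proof (rule AE_I2, rule impI)
        fix p assume "0 < h p"
        then have ceq: "cell \<epsilon> (snd (fst p)) = cell \<epsilon> (fst (snd p))" by (auto simp: h_def split: if_splits)
        define x y e where "x = dist (fst (fst p)) (snd (fst p))" and "y = dist (fst (snd p)) (snd (snd p))"
          and "e = dist (fst (fst p)) (snd (snd p)) - x - y"
        define e' where "e' = dist (snd (fst p)) (fst (snd p))"
        have e': "0 \<le> e'" "e' \<le> 2 * \<epsilon>"
          using dist_cell[OF \<epsilon>, of "snd (fst p)"] dist_cell[OF \<epsilon>, of "fst (snd p)"] ceq
            dist_triangle2[of "snd (fst p)" "fst (snd p)" "q (cell \<epsilon> (snd (fst p)))"]
          by (simp_all add: e'_def)
        have le: "dist (fst (fst p)) (snd (snd p)) \<le> x + y + e'"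
          using dist_triangle[of "fst (fst p)" "snd (snd p)" "snd (fst p)"]
            dist_triangle[of "snd (fst p)" "snd (snd p)" "fst (snd p)"] by (simp add: x_def y_def e'_def)
        have "?d (T p) \<le> (x + y + e')\<^sup>2" using le by (simp add: T_def power_mono)
        also have "\<dots> \<le> S * (x\<^sup>2 / a + y\<^sup>2 / b + 2 * \<epsilon>)"
          unfolding S_def using \<alpha>(3) \<beta>(3) \<epsilon> e' by (intro weighted_sum_square_le) auto
        also have "\<dots> = Sa * x\<^sup>2 + Sb * y\<^sup>2 + S * (2 * \<epsilon>)" by (simp add: Sa_def Sb_def algebra_simps)
        finally have "ennreal (?d (T p)) \<le> ennreal (Sa * x\<^sup>2 + Sb * y\<^sup>2 + S * (2 * \<epsilon>))" by (rule ennreal_leI)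
        then show "ennreal (?d (T p)) \<le> ennreal Sa * ennreal (?d (fst p)) + ennreal Sb * ennreal (?d (snd p)) + ennreal (S * (2 * \<epsilon>))"
          using S Sab \<epsilon> by (simp add: x_def y_def ennreal_plus ennreal_mult)
      qed
      then show "AE p in \<gamma>. ennreal (?d (T p)) \<le> ennreal Sa * ennreal (?d (fst p)) + ennreal Sb * ennreal (?d (snd p)) + ennreal (S * (2 * \<epsilon>))"
        unfolding \<gamma>_def by (simp add: AE_density[OF mh])
    qed
    also have "\<dots> = ennreal Sa * transport_cost \<alpha> + ennreal Sb * transport_cost \<beta> + ennreal (S * (2 * \<epsilon>))"
    proof -
      have m: "(\<lambda>p. ennreal (?d (fst p))) \<in> borel_measurable \<gamma>" "(\<lambda>p. ennreal (?d (snd p))) \<in> borel_measurable \<gamma>"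
        using measurable_dist_sq by measurable
      have "(\<integral>\<^sup>+p. ennreal Sa * ennreal (?d (fst p)) + ennreal Sb * ennreal (?d (snd p)) + ennreal (S * (2 * \<epsilon>)) \<partial>\<gamma>)
          = ennreal Sa * (\<integral>\<^sup>+p. ennreal (?d (fst p)) \<partial>\<gamma>) + ennreal Sb * (\<integral>\<^sup>+p. ennreal (?d (snd p)) \<partial>\<gamma>)
            + ennreal (S * (2 * \<epsilon>)) * emeasure \<gamma> (space \<gamma>)"
        by (rule nn_integral_affine[OF m])
      then show ?thesis
        using int1[OF md] int2[OF md] \<open>emeasure \<gamma> UNIV = 1\<close> sp\<gamma> unfolding transport_cost_def by simp
    qed
    also have "\<dots> \<le> ennreal Sa * ennreal (a\<^sup>2) + ennreal Sb * ennreal (b\<^sup>2) + ennreal (S * (2 * \<epsilon>))"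
      using \<alpha>(2) \<beta>(2) by (intro add_mono mult_left_mono) auto
    also have "\<dots> = ennreal (Sa * a\<^sup>2 + Sb * b\<^sup>2 + S * (2 * \<epsilon>))"
      using S Sab \<epsilon> by (simp add: ennreal_plus ennreal_mult)
    also have "Sa * a\<^sup>2 + Sb * b\<^sup>2 + S * (2 * \<epsilon>) = S\<^sup>2"
    proof -
      have "Sa * a\<^sup>2 = S * a" "Sb * b\<^sup>2 = S * b"
        using \<alpha>(3) \<beta>(3) by (simp_all add: Sa_def Sb_def power2_eq_square)
      then show ?thesis by (simp add: S_def power2_eq_square algebra_simps)
    qed
    finally show ?thesis by (simp add: S_def)
  qed
  ultimately show ?thesis using \<alpha>(3) \<beta>(3) \<epsilon> by (intro W2_le) auto
qed

lemma W2_triangle: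
  assumes "W2 \<mu> \<nu> \<le> ennreal a" "W2 \<nu> \<rho> \<le> ennreal b" "0 \<le> a" "0 \<le> b"
  shows "W2 \<mu> (\<rho> :: 'a measure) \<le> ennreal (a + b)"
proof (rule ennreal_le_epsilon)
  fix e :: real assume e: "0 < e"
  \<comment> \<open>The excess \<open>e/4\<close> yields actual couplings without attained infima
    and makes both bounds positive, as \<open>glue_cost\<close> divides by them.\<close>
  have "W2 \<mu> \<nu> < ennreal (a + e/4)" "W2 \<nu> \<rho> < ennreal (b + e/4)"
    using assms e by (auto intro: le_less_trans ennreal_lessI)
  then obtain \<alpha> \<beta> where "\<alpha> \<in> couplings \<mu> \<nu>" "transport_cost \<alpha> \<le> ennreal ((a + e/4)\<^sup>2)"
    "\<beta> \<in> couplings \<nu> \<rho>" "transport_cost \<beta> \<le> ennreal ((b + e/4)\<^sup>2)"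
    using W2_lessD assms e by (metis add_nonneg_nonneg divide_nonneg_nonneg less_imp_le zero_le_numeral)
  then have "W2 \<mu> \<rho> \<le> ennreal ((a + e/4) + (b + e/4) + 2 * (e/4))"
    using assms e by (intro glue_cost) auto
  also have "(a + e/4) + (b + e/4) + 2 * (e/4) = (a + b) + e" by simp
  finally show "W2 \<mu> \<rho> \<le> ennreal (a + b) + ennreal e" using assms e by (simp add: ennreal_plus)
qed

end

section \<open>Existence of optimal plans\<close>

lemma sets_fibre:
  assumes "f \<in> M \<rightarrow>\<^sub>M count_space UNIV"
  shows "{x\<in>space M. f x = l} \<in> sets M"
proof -
  have "f -` {l} \<inter> space M \<in> sets M" by (rule measurable_sets[OF assms]) simp
  moreover have "f -` {l} \<inter> space M = {x\<in>space M. f x = l}" by blast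
  ultimately show ?thesis by (simp only:)
qed

text \<open>The law of \<open>f\<close> is a weighted counting measure. This turns integrals of word
  functions into sums over one fixed \<open>count_space\<close>, where Fatou's lemma applies
  although the underlying measures vary.\<close>

lemma nn_integral_countable_valued:
  fixes f :: "'z \<Rightarrow> 'c::countable"
  assumes "f \<in> M \<rightarrow>\<^sub>M count_space UNIV"
  shows "(\<integral>\<^sup>+x. \<phi> (f x) \<partial>M) = (\<integral>\<^sup>+l. emeasure M {x\<in>space M. f x = l} * \<phi> l \<partial>count_space UNIV)"
proof -
  define \<nu> where "\<nu> = distr M (count_space UNIV) f"
  have e: "emeasure \<nu> {l} = emeasure M {x\<in>space M. f x = l}" for l
    unfolding \<nu>_def using assms by (subst emeasure_distr) (auto intro!: arg_cong[where f="emeasure M"])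
  have eq: "\<nu> = density (count_space UNIV) (\<lambda>l. emeasure \<nu> {l})"
  proof (rule measure_eqI_countable[where A=UNIV])
    fix l :: 'c
    have "emeasure (density (count_space UNIV) (\<lambda>l. emeasure \<nu> {l})) {l}
        = (\<integral>\<^sup>+k. emeasure \<nu> {l} * indicator {l} k \<partial>count_space UNIV)"
      by (subst emeasure_density) (auto intro!: nn_integral_cong split: split_indicator)
    also have "\<dots> = emeasure \<nu> {l}" by (subst nn_integral_cmult_indicator) auto
    finally show "emeasure \<nu> {l} = emeasure (density (count_space UNIV) (\<lambda>l. emeasure \<nu> {l})) {l}" by simp
  qed (auto simp: \<nu>_def)
  have "(\<integral>\<^sup>+l. \<phi> l \<partial>\<nu>) = (\<integral>\<^sup>+l. \<phi> l \<partial>density (count_space UNIV) (\<lambda>l. emeasure \<nu> {l}))"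
    by (rule arg_cong[OF eq, where f="\<lambda>M. \<integral>\<^sup>+l. \<phi> l \<partial>M"])
  also have "\<dots> = (\<integral>\<^sup>+l. emeasure \<nu> {l} * \<phi> l \<partial>count_space UNIV)"
    by (rule nn_integral_density) auto
  finally have "(\<integral>\<^sup>+l. \<phi> l \<partial>\<nu>) = (\<integral>\<^sup>+l. emeasure \<nu> {l} * \<phi> l \<partial>count_space UNIV)" .
  moreover
  have "(\<integral>\<^sup>+l. \<phi> l \<partial>\<nu>) = (\<integral>\<^sup>+x. \<phi> (f x) \<partial>M)"
    unfolding \<nu>_def using assms by (intro nn_integral_distr) auto
  ultimately show ?thesis by (simp add: e)
qed

text \<open>Weights on finite words which are additive over one-letter extensions are the lengths of nested
  subintervals of \<open>[0, 1)\<close>, so Lebesgue measure carries a random word of every length.\<close>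

lemma word_tree_realization:
  fixes w :: "nat list \<Rightarrow> real"
  assumes w0: "\<And>l. 0 \<le> w l" and w1: "w [] = 1" and ws: "\<And>l. (\<lambda>i. w (l @ [i])) sums w l"
  obtains M :: "real measure" and W :: "nat \<Rightarrow> real \<Rightarrow> nat list" where
    "prob_space M" "\<And>k. W k \<in> M \<rightarrow>\<^sub>M count_space UNIV" "\<And>k s. length (W k s) = k"
    "\<And>k s. \<exists>i. W (Suc k) s = W k s @ [i]" "\<And>k s. s \<in> space M \<Longrightarrow> 0 < w (W k s)"
    "\<And>k l. length l = k \<Longrightarrow> emeasure M {s\<in>space M. W k s = l} = ennreal (w l)"
proof -
  \<comment> \<open>The left end of the interval of \<open>l\<close>: at every position the weights
    of the siblings with a smaller last letter are added up.\<close>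
  define a where "a l = (\<Sum>j<length l. \<Sum>i<l!j. w (take j l @ [i]))" for l
  have a_snoc: "a (l @ [i]) = a l + (\<Sum>j<i. w (l @ [j]))" for l i
  proof -
    have "(\<Sum>j<length l. \<Sum>k<(l @ [i])!j. w (take j (l @ [i]) @ [k])) = a l"
      unfolding a_def by (intro sum.cong) (auto simp: nth_append)
    then show ?thesis unfolding a_def by simp
  qed
  \<comment> \<open>Half-open intervals tile their parent exactly and are empty exactly for weight
    zero. A point therefore never follows a word of weight zero, not even on a null set.\<close>
  define J where "J l = {a l ..< a l + w l}" for l
  have J0: "J [] = {0..<1}" unfolding J_def a_def by (simp add: w1)
  have J_snoc: "J (l @ [i]) = {a l + (\<Sum>j<i. w (l @ [j])) ..< a l + (\<Sum>j<Suc i. w (l @ [j]))}" for l i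
    unfolding J_def a_snoc by (simp add: add.assoc)
  have J_sub: "J (l @ [i]) \<subseteq> J l" for l i
  proof -
    have "(\<Sum>j<Suc i. w (l @ [j])) \<le> w l"
      using sum_le_suminf[OF sums_summable[OF ws[of l]], of "{..<Suc i}"] w0 sums_unique[OF ws[of l]] by simp
    moreover have "0 \<le> (\<Sum>j<i. w (l @ [j]))" by (intro sum_nonneg w0)
    ultimately show ?thesis unfolding J_snoc J_def[of l] by auto
  qed
  have J_disj: "i = i'" if "s \<in> J (l @ [i])" "s \<in> J (l @ [i'])" for s l i i'
  proof -
    have "False" if "i < i'" "s \<in> J (l @ [i])" "s \<in> J (l @ [i'])" for i i'
    proof -
      have "(\<Sum>j<Suc i. w (l @ [j])) \<le> (\<Sum>j<i'. w (l @ [j]))"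
        using that(1) w0 by (intro sum_mono2) auto
      then show False using that(2,3) unfolding J_snoc by auto
    qed
    then show ?thesis using that by (meson linorder_neqE_nat)
  qed
  \<comment> \<open>The child interval of \<open>s\<close> is found by the first partial sum that
    passes \<open>s\<close>; one exists since the partial sums tend to \<open>w l\<close> and
    \<open>s\<close> lies strictly left of the right end.\<close>
  define nxt where "nxt s l = (LEAST i. s < a l + (\<Sum>j<Suc i. w (l @ [j])))" for s l
  have nxt: "s \<in> J (l @ [nxt s l])" if s: "s \<in> J l" for s l
  proof -
    have "(\<lambda>n. \<Sum>j<n. w (l @ [j])) \<longlonglongrightarrow> w l" using ws[of l] unfolding sums_def .
    then have "eventually (\<lambda>n. s - a l < (\<Sum>j<n. w (l @ [j]))) sequentially"
      by (rule order_tendstoD) (use s in \<open>auto simp: J_def\<close>)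
    then obtain n where n: "s - a l < (\<Sum>j<n. w (l @ [j]))" unfolding eventually_sequentially by blast
    have "s - a l < (\<Sum>j<Suc n. w (l @ [j]))" using n w0[of "l @ [n]"] by simp
    then have "s < a l + (\<Sum>j<Suc n. w (l @ [j]))" by linarith
    then have "s < a l + (\<Sum>j<Suc (nxt s l). w (l @ [j]))" unfolding nxt_def by (rule LeastI)
    moreover have "a l + (\<Sum>j<nxt s l. w (l @ [j])) \<le> s"
    proof (cases "nxt s l")
      case 0
      then show ?thesis using s by (simp add: J_def)
    next
      case (Suc i)
      then have "\<not> s < a l + (\<Sum>j<Suc i. w (l @ [j]))"
        using not_less_Least[of i "\<lambda>i. s < a l + (\<Sum>j<Suc i. w (l @ [j]))"] unfolding nxt_def by simp
      then show ?thesis using Suc by simp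
    qed
    ultimately show ?thesis unfolding J_snoc by simp
  qed
  define W where "W k s = rec_nat [] (\<lambda>_ l. l @ [nxt s l]) k" for k s
  have W0: "W 0 s = []" and WS: "W (Suc k) s = W k s @ [nxt s (W k s)]" for k s
    by (simp_all add: W_def)
  have lW: "length (W k s) = k" for k s by (induction k) (simp_all add: W0 WS)
  have JW: "s \<in> J (W k s)" if "s \<in> {0..<1}" for k s
  proof (induction k)
    case 0
    then show ?case using that by (simp only: W0 J0)
  next
    case (Suc k)
    then show ?case unfolding WS by (rule nxt)
  qed
  have WJ: "s \<in> {0..<1} \<and> W (length l) s = l" if "s \<in> J l" for s l
    using that
  proof (induction l rule: rev_induct)
    case Nil
    then show ?case unfolding list.size W0 J0 by blast
  next
    case (snoc i l)
    then have IH: "s \<in> {0..<1}" "W (length l) s = l" using J_sub by blast+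
    have "s \<in> J (l @ [nxt s l])" using JW[OF IH(1), of "Suc (length l)"] unfolding WS IH(2) .
    then have "nxt s l = i" using J_disj snoc.prems by blast
    then show ?case using IH by (simp add: WS)
  qed
  define M where "M = restrict_space lborel {0..<1::real}"
  have spM: "space M = {0..<1}" by (simp add: M_def space_restrict_space)
  have WeqJ: "{s\<in>space M. W k s = l} = J l" if "length l = k" for k l
    unfolding spM using WJ[of _ l] JW[of _ k] that by blast
  have eJ: "emeasure M (J l) = ennreal (w l)" "J l \<in> sets M" for l
  proof -
    have sub: "J l \<subseteq> {0..<1}" using WJ by blast
    have "emeasure M (J l) = emeasure lborel (J l)"
      unfolding M_def using sub by (intro emeasure_restrict_space) auto
    also have "\<dots> = ennreal (w l)" unfolding J_def using w0[of l] by simp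
    finally show "emeasure M (J l) = ennreal (w l)" .
    show "J l \<in> sets M" unfolding M_def using sub by (auto simp: sets_restrict_space_iff J_def)
  qed
  show ?thesis
  proof
    show "prob_space M" using eJ(1)[of "[]"] by (intro prob_spaceI) (simp only: J0 w1 spM ennreal_1)
    show "W k \<in> M \<rightarrow>\<^sub>M count_space UNIV" for k
      unfolding measurable_count_space_eq2_countable
    proof (intro conjI ballI)
      fix l :: "nat list"
      have "W k -` {l} \<inter> space M = {s\<in>space M. W k s = l}" by blast
      also have "\<dots> = (if length l = k then J l else {})" using WeqJ lW by auto
      also have "\<dots> \<in> sets M" using eJ(2) by simp
      finally show "W k -` {l} \<inter> space M \<in> sets M" .
    qed simp
    show "length (W k s) = k" for k s by (rule lW)
    show "\<exists>i. W (Suc k) s = W k s @ [i]" for k s using WS by blast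
    show "0 < w (W k s)" if "s \<in> space M" for k s
      using JW[of s k] that unfolding spM J_def by simp
    show "emeasure M {s\<in>space M. W k s = l} = ennreal (w l)" if "length l = k" for k l
      unfolding WeqJ[OF that] by (rule eJ)
  qed
qed

text \<open>In place of a diagonal argument: the cube is compact by Tychonoff's theorem, and the
  countable power is a metric space, where compactness gives convergent subsequences.\<close>

lemma pointwise_convergent_subsequence:
  fixes f :: "nat \<Rightarrow> 'i::countable \<Rightarrow> real"
  assumes "\<And>n i. f n i \<in> {0..1}"
  obtains r g where "strict_mono (r :: nat \<Rightarrow> nat)" "\<And>i. (\<lambda>n. f (r n) i) \<longlonglongrightarrow> g i"
proof -
  have "compactin (product_topology (\<lambda>i. euclidean) (UNIV :: 'i set)) (PiE UNIV (\<lambda>_. {0..1::real}))"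
    unfolding compactin_PiE by simp
  then have "compact (PiE (UNIV :: 'i set) (\<lambda>_. {0..1::real}))"
    unfolding euclidean_product_topology compactin_euclidean_iff .
  moreover have "\<forall>n. f n \<in> PiE UNIV (\<lambda>_. {0..1::real})" using assms by auto
  ultimately obtain g r where r: "strict_mono (r :: nat \<Rightarrow> nat)" "(f \<circ> r) \<longlonglongrightarrow> g"
    using seq_compactE[OF compact_imp_seq_compact] by metis
  have "(\<lambda>n. f (r n) i) \<longlonglongrightarrow> g i" for i
    using continuous_on_tendsto_compose[OF continuous_on_product_coordinates[of i] r(2)] by simp
  with r(1) that show ?thesis by blast
qed

definition digit_word :: "(nat \<Rightarrow> 'z \<Rightarrow> nat) \<Rightarrow> nat \<Rightarrow> 'z \<Rightarrow> nat list" where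
  "digit_word D k z = map (\<lambda>j. D j z) [0..<k]"

lemma digit_word_simps:
  "digit_word D 0 z = []" "digit_word D (Suc k) z = digit_word D k z @ [D k z]"
  "length (digit_word D k z) = k" "j < k \<Longrightarrow> digit_word D k z ! j = D j z"
  by (simp_all add: digit_word_def)

lemma measurable_digit_word:
  assumes "\<And>j. D j \<in> M \<rightarrow>\<^sub>M count_space UNIV"
  shows "digit_word D k \<in> M \<rightarrow>\<^sub>M count_space UNIV"
proof (induction k)
  case 0
  have "digit_word D 0 = (\<lambda>z. [])" by (auto simp: digit_word_simps)
  then show ?case by simp
next
  case (Suc k)
  have "(\<lambda>z. l @ [D k z]) \<in> M \<rightarrow>\<^sub>M count_space UNIV" for l
    using measurable_compose[OF assms[of k], of "\<lambda>i. l @ [i]"] by simp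
  from measurable_compose_countable[OF this Suc]
  have "(\<lambda>z. digit_word D k z @ [D k z]) \<in> M \<rightarrow>\<^sub>M count_space UNIV" .
  moreover have "digit_word D (Suc k) = (\<lambda>z. digit_word D k z @ [D k z])" by (auto simp: digit_word_simps)
  ultimately show ?case by simp
qed

text \<open>Pointwise limits of weights could lose mass to large letters. The summable bound
  \<open>p j\<close>, uniform in \<open>n\<close>, prevents this: Tannery's theorem lets additivity
  over the last letter pass to the limit.\<close>

lemma limit_word_weights:
  fixes \<sigma> :: "nat \<Rightarrow> 'z measure"
  assumes prob: "\<And>n. prob_space (\<sigma> n)" and D: "\<And>n j. D j \<in> \<sigma> n \<rightarrow>\<^sub>M count_space UNIV"
    and dom: "\<And>n j i. measure (\<sigma> n) {z\<in>space (\<sigma> n). D j z = i} \<le> p j i" "\<And>j. summable (p j)"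
  obtains r w where "strict_mono (r :: nat \<Rightarrow> nat)" "\<And>l. 0 \<le> w l" "w [] = 1"
    "\<And>l. (\<lambda>i. w (l @ [i])) sums w l"
    "\<And>l. (\<lambda>n. measure (\<sigma> (r n)) {z\<in>space (\<sigma> (r n)). digit_word D (length l) z = l}) \<longlonglongrightarrow> w l"
proof -
  define P where "P n l = measure (\<sigma> n) {z\<in>space (\<sigma> n). digit_word D (length l) z = l}" for n l
  have ms: "{z\<in>space (\<sigma> n). digit_word D k z = l} \<in> sets (\<sigma> n)" for n k l
    by (rule sets_fibre[OF measurable_digit_word[OF D]])
  have mD: "{z\<in>space (\<sigma> n). D j z = i} \<in> sets (\<sigma> n)" for n j i
    by (rule sets_fibre[OF D])
  have P01: "P n l \<in> {0..1}" for n l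
    unfolding P_def using prob_space.prob_le_1[OF prob] by simp
  obtain r w where r: "strict_mono r" and w: "\<And>l. (\<lambda>n. P (r n) l) \<longlonglongrightarrow> w l"
    using pointwise_convergent_subsequence[of P, OF P01] by blast
  have Psums: "(\<lambda>i. P n (l @ [i])) sums P n l" for n l
  proof -
    interpret prob_space "\<sigma> n" by (rule prob)
    let ?A = "\<lambda>i. {z\<in>space (\<sigma> n). digit_word D (length (l @ [i])) z = l @ [i]}"
    have "(\<lambda>i. measure (\<sigma> n) (?A i)) sums measure (\<sigma> n) (\<Union>i. ?A i)"
    proof (rule finite_measure_UNION)
      show "range ?A \<subseteq> sets (\<sigma> n)" using ms by blast
      show "disjoint_family ?A" unfolding disjoint_family_on_def by (auto simp: digit_word_simps)
    qed
    moreover have "(\<Union>i. ?A i) = {z\<in>space (\<sigma> n). digit_word D (length l) z = l}"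
      by (auto simp: digit_word_simps)
    ultimately show ?thesis by (simp add: P_def)
  qed
  have Pdom: "norm (P n (l @ [i])) \<le> p (length l) i" for n l i
  proof -
    interpret prob_space "\<sigma> n" by (rule prob)
    have "P n (l @ [i]) \<le> measure (\<sigma> n) {z\<in>space (\<sigma> n). D (length l) z = i}"
      unfolding P_def by (intro finite_measure_mono mD) (auto simp: digit_word_simps)
    with dom(1)[of n "length l" i] show ?thesis using P01[of n "l @ [i]"] by simp
  qed
  have ws: "(\<lambda>i. w (l @ [i])) sums w l" for l
  proof -
    have "eventually (\<lambda>(k,n). norm (P (r n) (l @ [k])) \<le> p (length l) k) (at_top \<times>\<^sub>F sequentially)"
      using Pdom by (intro always_eventually) auto
    from tannerys_theorem[OF w this dom(2)[of "length l"]]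
    have T: "summable (\<lambda>i. norm (w (l @ [i])))"
      "(\<lambda>n. \<Sum>i. P (r n) (l @ [i])) \<longlonglongrightarrow> (\<Sum>i. w (l @ [i]))" by simp_all
    have "(\<lambda>n. \<Sum>i. P (r n) (l @ [i])) = (\<lambda>n. P (r n) l)"
      by (rule ext) (rule sums_unique[OF Psums, symmetric])
    with T(2) have "(\<lambda>n. P (r n) l) \<longlonglongrightarrow> (\<Sum>i. w (l @ [i]))" by (simp only:)
    then have "(\<Sum>i. w (l @ [i])) = w l" by (rule LIMSEQ_unique) (rule w)
    then show ?thesis using summable_sums[OF summable_norm_cancel[OF T(1)]] by simp
  qed
  have "P n [] = 1" for n
    using prob_space.prob_space[OF prob[of n]] by (simp add: P_def digit_word_simps)
  then have "w [] = 1" using w[of "[]"] by (simp add: LIMSEQ_const_iff)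
  moreover have "0 \<le> w l" for l
    by (rule LIMSEQ_le_const[OF w]) (use P01 in auto)
  ultimately show ?thesis using that[OF r _ _ ws w[unfolded P_def]] by blast
qed

text \<open>A weak limit provides only an inequality on open sets. Shrinking neighbourhoods transfer
  it to closed sets, complements give the reverse one because both masses are \<open>1\<close>, and
  closed sets generate the Borel sets.\<close>

lemma measure_eq_from_open_le:
  fixes \<mu> \<nu> :: "'a::metric_space measure"
  assumes \<mu>: "prob_space \<mu>" "sets \<mu> = sets borel" and \<nu>: "prob_space \<nu>" "sets \<nu> = sets borel"
    and le: "\<And>U. open U \<Longrightarrow> emeasure \<nu> U \<le> emeasure \<mu> U"
  shows "\<nu> = \<mu>"
proof -
  interpret M: prob_space \<mu> by fact
  interpret N: prob_space \<nu> by fact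
  have sp: "space \<mu> = UNIV" "space \<nu> = UNIV"
    using sets_eq_imp_space_eq[OF \<mu>(2)] sets_eq_imp_space_eq[OF \<nu>(2)] by simp_all
  have eq: "emeasure \<nu> C = emeasure \<mu> C" if "closed C" for C
  proof (cases "C = {}")
    case False
    define U where "U k = {x. infdist x C < 1 / Suc k}" for k
    have U: "open (U k)" for k unfolding U_def by (intro open_Collect_less continuous_intros)
    have CU: "(\<Inter>k. U k) = C"
    proof safe
      fix x assume x: "x \<in> (\<Inter>k. U k)"
      have "infdist x C \<le> 0"
      proof (rule field_le_epsilon)
        fix e :: real assume "0 < e"
        then obtain k where "1 / Suc k < e" using nat_approx_posE by blast
        moreover have "x \<in> U k" using x by blast
        ultimately show "infdist x C \<le> 0 + e" unfolding U_def by simp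
      qed
      then have "infdist x C = 0" using infdist_nonneg[of x C] by linarith
      then show "x \<in> C" using in_closed_iff_infdist_zero[OF \<open>closed C\<close> False] by blast
    qed (auto simp: U_def)
    have dec: "decseq U"
    proof (rule decseq_SucI)
      fix k
      have "1 / real (Suc (Suc k)) \<le> 1 / real (Suc k)" by (intro divide_left_mono) auto
      then show "U (Suc k) \<subseteq> U k" unfolding U_def by auto
    qed
    have "(\<lambda>k. emeasure \<nu> (U k)) \<longlonglongrightarrow> emeasure \<nu> (\<Inter>k. U k)"
      using U \<nu>(2) by (intro Lim_emeasure_decseq dec) auto
    moreover have "(\<lambda>k. emeasure \<mu> (U k)) \<longlonglongrightarrow> emeasure \<mu> (\<Inter>k. U k)"
      using U \<mu>(2) by (intro Lim_emeasure_decseq dec) auto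
    ultimately have "emeasure \<nu> C \<le> emeasure \<mu> C"
      unfolding CU by (rule LIMSEQ_le) (use le U in blast)
    moreover have "emeasure \<mu> C \<le> emeasure \<nu> C"
    proof -
      have "measure \<nu> (UNIV - C) \<le> measure \<mu> (UNIV - C)"
        using le[of "UNIV - C"] that by (simp add: M.emeasure_eq_measure N.emeasure_eq_measure Compl_eq_Diff_UNIV[symmetric] open_Compl)
      moreover have "measure \<nu> (UNIV - C) = 1 - measure \<nu> C" "measure \<mu> (UNIV - C) = 1 - measure \<mu> C"
        using that M.prob_compl[of C] N.prob_compl[of C] \<mu>(2) \<nu>(2) sp by auto
      ultimately show ?thesis by (simp add: M.emeasure_eq_measure N.emeasure_eq_measure)
    qed
    ultimately show ?thesis by (rule antisym)
  qed simp
  show ?thesis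
  proof (rule measure_eqI_generator_eq[where E="Collect closed" and \<Omega>=UNIV and A="\<lambda>_. UNIV"])
    show "Int_stable (Collect closed :: 'a set set)" by (auto simp: Int_stable_def)
    show "sets \<nu> = sigma_sets UNIV (Collect closed)" "sets \<mu> = sigma_sets UNIV (Collect closed)"
      using \<mu>(2) \<nu>(2) by (simp_all add: borel_eq_closed)
  qed (use eq in auto)
qed

lemma distr_fst_snd_borel_probs:
  assumes "\<sigma> \<in> couplings \<mu> \<nu>"
  shows "\<mu> \<in> borel_probs" "\<nu> \<in> borel_probs"
proof -
  have \<sigma>: "\<sigma> \<in> borel_probs" using assms by (simp add: couplings_def)
  have "fst \<in> borel_measurable \<sigma>" "snd \<in> borel_measurable \<sigma>"
    unfolding borel_measurable_borel_probs[OF \<sigma>] by (rule borel_measurable_fst' borel_measurable_snd')+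
  then have "distr \<sigma> borel fst \<in> borel_probs" "distr \<sigma> borel snd \<in> borel_probs"
    using distr_in_borel_probs[OF borel_probsD(1)[OF \<sigma>]] by blast+
  then show "\<mu> \<in> borel_probs" "\<nu> \<in> borel_probs" using assms by (simp_all add: couplings_def)
qed

text \<open>The limit of the couplings is built as the law of a pair of limit points: the digits of the two
  coordinates are interleaved, so that the law of each new digit is controlled by one fixed marginal
  and no mass is lost in the limit of the word weights.\<close>

theorem coupling_weak_limit:
  fixes q :: "nat \<Rightarrow> 'a::complete_space" and \<sigma> :: "nat \<Rightarrow> ('a \<times> 'a) measure"
  assumes q: "dense_sequence q" and \<sigma>: "\<And>n. \<sigma> n \<in> couplings \<mu> \<nu>"
  obtains \<rho> where "\<rho> \<in> couplings \<mu> \<nu>"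
    "\<And>b n0. (\<And>n. n0 \<le> n \<Longrightarrow> transport_cost (\<sigma> n) \<le> b) \<Longrightarrow> transport_cost \<rho> \<le> b"
proof -
  interpret dense_sequence q by fact
  have \<sigma>b: "\<sigma> n \<in> borel_probs" for n using \<sigma> by (simp add: couplings_def)
  have prob: "prob_space (\<sigma> n)" for n by (rule borel_probsD[OF \<sigma>b])
  have \<mu>b: "\<mu> \<in> borel_probs" and \<nu>b: "\<nu> \<in> borel_probs" using distr_fst_snd_borel_probs[OF \<sigma>] by blast+
  have mfst: "fst \<in> borel_measurable (\<sigma> n)" and msnd: "snd \<in> borel_measurable (\<sigma> n)" for n
    unfolding borel_measurable_borel_probs[OF \<sigma>b] by (rule borel_measurable_fst' borel_measurable_snd')+
  have dfst: "distr (\<sigma> n) borel fst = \<mu>" and dsnd: "distr (\<sigma> n) borel snd = \<nu>" for n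
    using \<sigma> by (simp_all add: couplings_def)
  define \<delta> where "\<delta> k = (1/2::real)^k" for k :: nat
  have \<delta>0: "0 < \<delta> k" for k by (simp add: \<delta>_def)
  define D where "D j z = cell (\<delta> (j div 2)) (if even j then fst z else snd z)" for j and z :: "'a \<times> 'a"
  have D_even: "D (2*i) z = cell (\<delta> i) (fst z)" and D_odd: "D (2*i+1) z = cell (\<delta> i) (snd z)" for i z
    by (simp_all add: D_def)
  have mD: "D j \<in> \<sigma> n \<rightarrow>\<^sub>M count_space UNIV" for n j
  proof (cases "even j")
    case True
    then have "D j = (\<lambda>z. cell (\<delta> (j div 2)) (fst z))" by (auto simp: D_def)
    then show ?thesis using measurable_compose[OF mfst measurable_cell] by simp
  next
    case False
    then have "D j = (\<lambda>z. cell (\<delta> (j div 2)) (snd z))" by (auto simp: D_def)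
    then show ?thesis using measurable_compose[OF msnd measurable_cell] by simp
  qed
  \<comment> \<open>The law of digit \<open>j\<close> under a single marginal: it is the same for
    every \<open>\<sigma> n\<close> and serves as the dominating series.\<close>
  define p where "p j i = measure (if even j then \<mu> else \<nu>) {x. cell (\<delta> (j div 2)) x = i}" for j i
  have cellset: "{x. cell (\<delta> k) x = i} \<in> sets borel" for k i
    using sets_fibre[OF measurable_cell, of "\<delta> k" i] by simp
  have dom: "measure (\<sigma> n) {z\<in>space (\<sigma> n). D j z = i} \<le> p j i" for n j i
  proof -
    define h where "h z = (if even j then fst z else snd z)" for z :: "'a \<times> 'a"
    have h: "h \<in> borel_measurable (\<sigma> n)" "(if even j then \<mu> else \<nu>) = distr (\<sigma> n) borel h"
      unfolding h_def[abs_def] using mfst[of n] msnd[of n] dfst[of n] dsnd[of n] by simp_all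
    have "p j i = measure (\<sigma> n) (h -` {x. cell (\<delta> (j div 2)) x = i} \<inter> space (\<sigma> n))"
      unfolding p_def h(2) by (rule measure_distr[OF h(1) cellset])
    also have "h -` {x. cell (\<delta> (j div 2)) x = i} \<inter> space (\<sigma> n) = {z\<in>space (\<sigma> n). D j z = i}"
      by (auto simp: D_def h_def)
    finally show ?thesis by simp
  qed
  have sump: "summable (p j)" for j
  proof -
    define \<tau> where "\<tau> = (if even j then \<mu> else \<nu>)"
    have \<tau>: "\<tau> \<in> borel_probs" using \<mu>b \<nu>b by (simp add: \<tau>_def)
    interpret prob_space \<tau> by (rule borel_probsD[OF \<tau>])
    have "(\<lambda>i. measure \<tau> {x. cell (\<delta> (j div 2)) x = i}) sums measure \<tau> (\<Union>i. {x. cell (\<delta> (j div 2)) x = i})"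
    proof (rule finite_measure_UNION)
      show "range (\<lambda>i. {x. cell (\<delta> (j div 2)) x = i}) \<subseteq> sets \<tau>"
        unfolding borel_probsD(2)[OF \<tau>] using cellset by blast
      show "disjoint_family (\<lambda>i. {x. cell (\<delta> (j div 2)) x = i})" by (auto simp: disjoint_family_on_def)
    qed
    moreover have "p j = (\<lambda>i. measure \<tau> {x. cell (\<delta> (j div 2)) x = i})" by (auto simp: p_def \<tau>_def)
    ultimately show ?thesis using sums_summable by metis
  qed
  obtain r w where r: "strict_mono (r :: nat \<Rightarrow> nat)" and w0: "\<And>l. 0 \<le> w l" and w1: "w [] = 1"
    and ws: "\<And>l. (\<lambda>i. w (l @ [i])) sums w l"
    and wlim: "\<And>l. (\<lambda>n. measure (\<sigma> (r n)) {z\<in>space (\<sigma> (r n)). digit_word D (length l) z = l}) \<longlonglongrightarrow> w l"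
    by (rule limit_word_weights[where D=D and \<sigma>=\<sigma> and p=p, OF prob mD dom sump]) (rule that)
  obtain M :: "real measure" and W where M: "prob_space M"
    and mW: "\<And>k. W k \<in> M \<rightarrow>\<^sub>M count_space UNIV" and lW: "\<And>k s. length (W k s) = k"
    and WS: "\<And>k s. \<exists>i. W (Suc k) s = W k s @ [i]" and Wpos: "\<And>k s. s \<in> space M \<Longrightarrow> 0 < w (W k s)"
    and eW: "\<And>k l. length l = k \<Longrightarrow> emeasure M {s\<in>space M. W k s = l} = ennreal (w l)"
    by (rule word_tree_realization[of w, OF w0 w1 ws]) (rule that)
  interpret M: prob_space M by (rule M)
  have Wnth: "W (k + d) s ! j = W k s ! j" if "j < k" for j k d s
  proof (induction d)
    case (Suc d)
    obtain i where "W (Suc (k + d)) s = W (k + d) s @ [i]" using WS by blast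
    then show ?case using Suc that lW[of "k + d" s] by (simp add: nth_append)
  qed simp
  define x where "x i s = q (W (2*i+2) s ! (2*i))" for i s
  define y where "y i s = q (W (2*i+2) s ! (2*i+1))" for i s
  \<comment> \<open>A word of positive limit weight has positive weight under some
    \<open>\<sigma> (r m)\<close>, so it is the word of an actual pair. This is why the balls named
    by its letters meet and the centres converge.\<close>
  have common: "\<exists>z. \<forall>i\<le>n. dist (fst z) (x i s) < \<delta> i \<and> dist (snd z) (y i s) < \<delta> i" if s: "s \<in> space M" for s n
  proof -
    let ?l = "W (2*n+2) s"
    have "\<exists>z. digit_word D (2*n+2) z = ?l"
    proof (rule ccontr)
      assume "\<not> ?thesis"
      then have "{z\<in>space (\<sigma> (r m)). digit_word D (length ?l) z = ?l} = {}" for m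
        unfolding lW by blast
      then have "(\<lambda>m. 0) \<longlonglongrightarrow> w ?l" using wlim[of ?l] by (simp only: measure_empty)
      then have "w ?l = 0" by (simp only: LIMSEQ_const_iff)
      then show False using Wpos[OF s, of "2*n+2"] by simp
    qed
    then obtain z where z: "digit_word D (2*n+2) z = ?l" by blast
    have "dist (fst z) (x i s) < \<delta> i \<and> dist (snd z) (y i s) < \<delta> i" if "i \<le> n" for i
    proof -
      have "W (2*n+2) s ! j = W (2*i+2) s ! j" if "j < 2*i+2" for j
        using Wnth[OF that, of "2*n - 2*i" s] \<open>i \<le> n\<close> by simp
      moreover have "W (2*n+2) s ! j = D j z" if "j < 2*n+2" for j
        using digit_word_simps(4)[OF that, of D z] z by simp
      ultimately have "x i s = q (D (2*i) z)" "y i s = q (D (2*i+1) z)"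
        using \<open>i \<le> n\<close> unfolding x_def y_def by auto
      then show ?thesis unfolding D_even D_odd using dist_cell[OF \<delta>0] by simp
    qed
    then show ?thesis by blast
  qed
  have convx: "convergent (\<lambda>i. x i s)" and convy: "convergent (\<lambda>i. y i s)" if s: "s \<in> space M" for s
  proof -
    have "(\<exists>a. \<forall>i\<le>n. dist a (x i s) \<le> (1/2)^i) \<and> (\<exists>a. \<forall>i\<le>n. dist a (y i s) \<le> (1/2)^i)" for n
    proof -
      obtain z where z: "\<forall>i\<le>n. dist (fst z) (x i s) < \<delta> i \<and> dist (snd z) (y i s) < \<delta> i"
        using common[OF s, of n] by (rule exE)
      then have "\<forall>i\<le>n. dist (fst z) (x i s) \<le> (1/2)^i" "\<forall>i\<le>n. dist (snd z) (y i s) \<le> (1/2)^i"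
        unfolding \<delta>_def by (simp_all add: less_imp_le)
      then show ?thesis by (intro conjI exI)
    qed
    then show "convergent (\<lambda>i. x i s)" "convergent (\<lambda>i. y i s)"
      by (intro convergent_common_points; simp)+
  qed
  define X where "X s = lim (\<lambda>i. x i s)" for s
  define Y where "Y s = lim (\<lambda>i. y i s)" for s
  have limX: "(\<lambda>i. x i s) \<longlonglongrightarrow> X s" and limY: "(\<lambda>i. y i s) \<longlonglongrightarrow> Y s" if "s \<in> space M" for s
    using convx[OF that] convy[OF that] unfolding X_def Y_def by (simp_all add: convergent_LIMSEQ_iff)
  have mx: "x i \<in> borel_measurable M" and my: "y i \<in> borel_measurable M" for i
    unfolding x_def y_def
    using measurable_compose[OF mW, of "\<lambda>l. q (l ! (2*i))" borel "2*i+2"]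
      measurable_compose[OF mW, of "\<lambda>l. q (l ! (2*i+1))" borel "2*i+2"] by simp_all
  have mX: "X \<in> borel_measurable M" by (rule borel_measurable_LIMSEQ_metric[OF mx limX])
  have mY: "Y \<in> borel_measurable M" by (rule borel_measurable_LIMSEQ_metric[OF my limY])
  define Z where "Z s = (X s, Y s)" for s
  have mZ: "Z \<in> borel_measurable M" unfolding Z_def by (rule borel_measurable_Pair'[OF mX mY])
  define \<rho> where "\<rho> = distr M borel Z"
  have \<rho>b: "\<rho> \<in> borel_probs" unfolding \<rho>_def by (rule distr_in_borel_probs[OF M mZ])
  \<comment> \<open>Lower semicontinuity of integrals under the limit. Replacing \<open>F\<close> by
    its infimum \<open>\<Phi>\<close> over a cell leaves a function of words, to which Fatou's lemma
    on words applies as the weights converge; a second use of Fatou's lemma lets the cells shrink.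
    It serves for the cost and for indicators of open sets.\<close>
  have key: "(\<integral>\<^sup>+z. F z \<partial>\<rho>) \<le> b"
    if F: "F \<in> borel_measurable borel" and lsc: "\<And>c. open {z. c < F z}"
      and bd: "\<And>n. n0 \<le> n \<Longrightarrow> (\<integral>\<^sup>+z. F z \<partial>\<sigma> n) \<le> b" for F b n0
  proof -
    define C where "C k l = {z. dist (fst z) (q (l ! (2*k))) < \<delta> k \<and> dist (snd z) (q (l ! (2*k+1))) < \<delta> k}" for k l
    define \<Phi> where "\<Phi> k l = (INF z\<in>C k l. F z)" for k l
    have \<Phi>F: "\<Phi> k (digit_word D (2*k+2) z) \<le> F z" for k z
    proof -
      have "digit_word D (2*k+2) z ! (2*k) = D (2*k) z" "digit_word D (2*k+2) z ! (2*k+1) = D (2*k+1) z"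
        by (simp_all only: digit_word_simps(4))
      then have "z \<in> C k (digit_word D (2*k+2) z)"
        unfolding C_def D_even D_odd using dist_cell[OF \<delta>0] by simp
      then show ?thesis unfolding \<Phi>_def by (rule INF_lower)
    qed
    have step: "(\<integral>\<^sup>+s. \<Phi> k (W (2*k+2) s) \<partial>M) \<le> b" for k
    proof -
      define K where "K = 2*k+2"
      let ?e = "\<lambda>n l. emeasure (\<sigma> (r n)) {z\<in>space (\<sigma> (r n)). digit_word D K z = l}"
      \<comment> \<open>\<open>\<Phi>\<close> is infinite on words without points, and
        multiplication is not continuous at zero times infinity. Words of limit weight zero are
        therefore split off; their contribution is zero by convention.\<close>
      have pw: "emeasure M {s\<in>space M. W K s = l} * \<Phi> k l \<le> liminf (\<lambda>n. ?e n l * \<Phi> k l)" for l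
      proof (cases "length l = K \<and> w l \<noteq> 0")
        case False
        then have "emeasure M {s\<in>space M. W K s = l} = 0"
        proof (cases "length l = K")
          case False
          then have "{s\<in>space M. W K s = l} = {}" using lW by auto
          then show ?thesis by (simp only: emeasure_empty)
        qed (use eW[of l K] False in simp)
        then show ?thesis by simp
      next
        case True
        then have pos: "0 < w l" using w0[of l] by simp
        have "(\<lambda>n. ennreal (measure (\<sigma> (r n)) {z\<in>space (\<sigma> (r n)). digit_word D K z = l})) \<longlonglongrightarrow> ennreal (w l)"
          using wlim[of l] True by (intro tendsto_ennrealI) simp
        then have "(\<lambda>n. ?e n l) \<longlonglongrightarrow> ennreal (w l)"
          using finite_measure.emeasure_eq_measure[OF prob_space.finite_measure[OF prob]] by simp
        then have "(\<lambda>n. ?e n l * \<Phi> k l) \<longlonglongrightarrow> ennreal (w l) * \<Phi> k l"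
          by (rule tendsto_mult_ennreal[OF _ tendsto_const]) (use pos in auto)
        then have "liminf (\<lambda>n. ?e n l * \<Phi> k l) = ennreal (w l) * \<Phi> k l"
          by (rule lim_imp_Liminf[OF trivial_limit_sequentially])
        then show ?thesis using eW[of l K] True by simp
      qed
      have "(\<integral>\<^sup>+s. \<Phi> k (W K s) \<partial>M)
          = (\<integral>\<^sup>+l. emeasure M {s\<in>space M. W K s = l} * \<Phi> k l \<partial>count_space UNIV)"
        by (rule nn_integral_countable_valued[OF mW])
      also have "\<dots> \<le> (\<integral>\<^sup>+l. liminf (\<lambda>n. ?e n l * \<Phi> k l) \<partial>count_space UNIV)"
        by (intro nn_integral_mono pw)
      also have "\<dots> \<le> liminf (\<lambda>n. \<integral>\<^sup>+l. ?e n l * \<Phi> k l \<partial>count_space UNIV)"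
        by (rule nn_integral_liminf) simp
      also have "(\<lambda>n. \<integral>\<^sup>+l. ?e n l * \<Phi> k l \<partial>count_space UNIV)
          = (\<lambda>n. \<integral>\<^sup>+z. \<Phi> k (digit_word D K z) \<partial>\<sigma> (r n))"
        by (intro ext nn_integral_countable_valued[symmetric] measurable_digit_word mD)
      also have "liminf \<dots> \<le> liminf (\<lambda>n. b)"
      proof (rule Liminf_mono)
        have "(\<integral>\<^sup>+z. \<Phi> k (digit_word D K z) \<partial>\<sigma> (r n)) \<le> b" if "n0 \<le> n" for n
        proof -
          have "(\<integral>\<^sup>+z. \<Phi> k (digit_word D K z) \<partial>\<sigma> (r n)) \<le> (\<integral>\<^sup>+z. F z \<partial>\<sigma> (r n))"
            unfolding K_def by (intro nn_integral_mono \<Phi>F)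
          also have "\<dots> \<le> b" using seq_suble[OF r, of n] that by (intro bd) linarith
          finally show ?thesis .
        qed
        then show "eventually (\<lambda>n. (\<integral>\<^sup>+z. \<Phi> k (digit_word D K z) \<partial>\<sigma> (r n)) \<le> b) sequentially"
          unfolding eventually_sequentially by blast
      qed
      also have "\<dots> = b" by (simp add: Liminf_const)
      finally show ?thesis unfolding K_def .
    qed
    \<comment> \<open>Once the scale is below \<open>e\<close>, all points of the cell lie within
      \<open>2 * e\<close> of \<open>Z s\<close> in both coordinates, inside a box on which
      \<open>F > c'\<close>.\<close>
    have lim: "F (Z s) \<le> liminf (\<lambda>k. \<Phi> k (W (2*k+2) s))" if s: "s \<in> space M" for s
      unfolding le_Liminf_iff
    proof (intro allI impI)
      fix c assume cF: "c < F (Z s)"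
      obtain c' where c': "c < c'" "c' < F (Z s)" using Orderings.dense[OF cF] by blast
      obtain A B where AB: "open A" "open B" "Z s \<in> A \<times> B" "A \<times> B \<subseteq> {z. c' < F z}"
        using open_prod_elim[OF lsc[of c'], of "Z s"] c'(2) by auto
      have XA: "X s \<in> A" "Y s \<in> B" using AB(3) by (simp_all add: Z_def)
      obtain e1 where e1: "0 < e1" "ball (X s) e1 \<subseteq> A" using openE[OF AB(1) XA(1)] by metis
      obtain e2 where e2: "0 < e2" "ball (Y s) e2 \<subseteq> B" using openE[OF AB(2) XA(2)] by metis
      define e where "e = min e1 e2 / 2"
      have e: "0 < e" using e1 e2 by (simp add: e_def)
      have "\<delta> \<longlonglongrightarrow> 0" unfolding \<delta>_def by (intro LIMSEQ_power_zero) simp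
      then have "eventually (\<lambda>k. \<delta> k < e) sequentially" using e by (rule order_tendstoD)
      moreover have "eventually (\<lambda>k. dist (x k s) (X s) < e) sequentially" using limX[OF s] e by (rule tendstoD)
      moreover have "eventually (\<lambda>k. dist (y k s) (Y s) < e) sequentially" using limY[OF s] e by (rule tendstoD)
      ultimately show "eventually (\<lambda>k. c < \<Phi> k (W (2*k+2) s)) sequentially"
      proof eventually_elim
        fix k assume k: "\<delta> k < e" "dist (x k s) (X s) < e" "dist (y k s) (Y s) < e"
        have "c' \<le> F z" if "z \<in> C k (W (2*k+2) s)" for z
        proof -
          have zz: "dist (fst z) (x k s) < \<delta> k" "dist (snd z) (y k s) < \<delta> k"
            using that by (simp_all add: C_def x_def y_def)
          have "dist (X s) (fst z) < 2 * e" "dist (Y s) (snd z) < 2 * e"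
            using zz k dist_triangle2[of "X s" "fst z" "x k s"] dist_triangle2[of "Y s" "snd z" "y k s"]
            by (simp_all add: dist_commute)
          then have "fst z \<in> A" "snd z \<in> B" using e1(2) e2(2) by (auto simp: e_def)
          then have "z \<in> A \<times> B" by (simp add: mem_Times_iff)
          then show ?thesis using AB(4) by (auto intro: less_imp_le)
        qed
        then have "c' \<le> \<Phi> k (W (2*k+2) s)" unfolding \<Phi>_def by (rule INF_greatest)
        with c'(1) show "c < \<Phi> k (W (2*k+2) s)" by (rule less_le_trans)
      qed
    qed
    have "(\<integral>\<^sup>+z. F z \<partial>\<rho>) = (\<integral>\<^sup>+s. F (Z s) \<partial>M)"
      unfolding \<rho>_def by (rule nn_integral_distr[OF mZ]) (use F in simp)
    also have "\<dots> \<le> (\<integral>\<^sup>+s. liminf (\<lambda>k. \<Phi> k (W (2*k+2) s)) \<partial>M)" by (intro nn_integral_mono lim)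
    also have "\<dots> \<le> liminf (\<lambda>k. \<integral>\<^sup>+s. \<Phi> k (W (2*k+2) s) \<partial>M)"
      by (rule nn_integral_liminf) (rule measurable_compose[OF mW], simp)
    also have "\<dots> \<le> liminf (\<lambda>k. b)" by (intro Liminf_mono always_eventually allI step)
    also have "\<dots> = b" by (simp add: Liminf_const)
    finally show ?thesis .
  qed
  have pr\<rho>: "prob_space \<rho>" by (rule borel_probsD[OF \<rho>b])
  have ind: "{z :: 'a \<times> 'a. c < (indicator V (h z) :: ennreal)} = (if c < 1 then h -` V else {})" for c V h
    by (auto split: split_indicator simp: not_less)
  \<comment> \<open>All \<open>\<sigma> n\<close> have the same image under \<open>h\<close>, so
    \<open>key\<close> for indicators bounds the open sets, and
    \<open>measure_eq_from_open_le\<close> upgrades this to equality.\<close>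
  have marg: "distr \<rho> borel h = \<tau>"
    if h: "continuous_on UNIV h" and \<tau>: "\<tau> \<in> borel_probs" and d: "\<And>n. distr (\<sigma> n) borel h = \<tau>"
    for h :: "'a \<times> 'a \<Rightarrow> 'a" and \<tau>
  proof (rule measure_eq_from_open_le)
    have hb: "h \<in> borel_measurable borel" by (rule borel_measurable_continuous_onI[OF h])
    then have h\<rho>: "h \<in> borel_measurable \<rho>" and h\<sigma>: "h \<in> borel_measurable (\<sigma> n)" for n
      using borel_measurable_borel_probs[OF \<rho>b] borel_measurable_borel_probs[OF \<sigma>b] by blast+
    show "prob_space (distr \<rho> borel h)" by (rule prob_space.prob_space_distr[OF pr\<rho> h\<rho>])
    fix V :: "'a set" assume V: "open V"
    have "emeasure (distr \<rho> borel h) V = (\<integral>\<^sup>+v. indicator V v \<partial>distr \<rho> borel h)" using V by simp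
    also have "\<dots> = (\<integral>\<^sup>+z. indicator V (h z) \<partial>\<rho>)" by (rule nn_integral_distr[OF h\<rho>]) (use V in simp)
    also have "\<dots> \<le> emeasure \<tau> V"
    proof (rule key)
      show "(\<lambda>z. indicator V (h z) :: ennreal) \<in> borel_measurable borel"
        using measurable_compose[OF hb, of "indicator V" borel] V by simp
      show "open {z :: 'a \<times> 'a. c < (indicator V (h z) :: ennreal)}" for c
        unfolding ind using open_vimage[OF V h] by simp
      fix n :: nat assume "0 \<le> n"
      have "(\<integral>\<^sup>+z. indicator V (h z) \<partial>\<sigma> n) = (\<integral>\<^sup>+v. indicator V v \<partial>distr (\<sigma> n) borel h)"
        by (rule nn_integral_distr[OF h\<sigma>, symmetric]) (use V in simp)
      also have "\<dots> = emeasure \<tau> V" unfolding d using V borel_probsD(2)[OF \<tau>] by simp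
      finally show "(\<integral>\<^sup>+z. indicator V (h z) \<partial>\<sigma> n) \<le> emeasure \<tau> V" by simp
    qed
    finally show "emeasure (distr \<rho> borel h) V \<le> emeasure \<tau> V" .
  qed (use borel_probsD[OF \<tau>] in simp_all)
  have "\<rho> \<in> couplings \<mu> \<nu>"
    using \<rho>b marg[OF continuous_on_fst[OF continuous_on_id] \<mu>b dfst]
      marg[OF continuous_on_snd[OF continuous_on_id] \<nu>b dsnd] by (simp add: couplings_def)
  moreover have "transport_cost \<rho> \<le> b" if "\<And>n. n0 \<le> n \<Longrightarrow> transport_cost (\<sigma> n) \<le> b" for b n0
    unfolding transport_cost_def
  proof (rule key[OF measurable_dist_sq])
    fix c
    have "continuous_on UNIV (\<lambda>z :: 'a \<times> 'a. ennreal ((dist (fst z) (snd z))\<^sup>2))"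
      by (intro continuous_on_ennreal continuous_intros)
    then show "open {z :: 'a \<times> 'a. c < ennreal ((dist (fst z) (snd z))\<^sup>2)}"
      by (intro open_Collect_less continuous_on_const)
  qed (use that in \<open>simp add: transport_cost_def\<close>)
  ultimately show ?thesis using that by blast
qed

text \<open>Finite cost is part of the notion because \<open>optimal_plan_restrict\<close> cancels
  the cost of the unchanged part and the Wasserstein distance of the marginals has to be
  finite.\<close>

definition optimal_plan :: "('a::metric_space \<times> 'a) measure \<Rightarrow> bool" where
  "optimal_plan \<sigma> \<longleftrightarrow> \<sigma> \<in> borel_probs \<and> transport_cost \<sigma> < \<infinity> \<and>
     (\<forall>\<sigma>'\<in>couplings (distr \<sigma> borel fst) (distr \<sigma> borel snd). transport_cost \<sigma> \<le> transport_cost \<sigma>')"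

text \<open>The direct method: the limit of a minimising sequence of couplings obeys every eventual
  bound of their costs, hence attains the infimum.\<close>

theorem ex_optimal_plan:
  fixes q :: "nat \<Rightarrow> 'a::complete_space"
  assumes q: "dense_sequence q" and \<sigma>: "\<sigma> \<in> couplings \<mu> \<nu>" "transport_cost \<sigma> < \<infinity>"
  shows "\<exists>\<rho>\<in>couplings \<mu> (\<nu> :: 'a measure). optimal_plan \<rho>"
proof -
  define c where "c = (INF \<sigma>\<in>couplings \<mu> \<nu>. transport_cost \<sigma>)"
  have "c \<le> transport_cost \<sigma>" unfolding c_def using \<sigma>(1) by (rule INF_lower)
  then have ctop: "c < \<infinity>" using \<sigma>(2) by simp
  have "\<exists>\<sigma>\<in>couplings \<mu> \<nu>. transport_cost \<sigma> < c + ennreal (1 / Suc n)" for n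
  proof -
    have "c < c + ennreal (1 / Suc n)" using ctop by (simp add: ennreal_zero_less_divide less_top)
    then show ?thesis by (simp only: c_def INF_less_iff)
  qed
  then obtain \<tau> where \<tau>: "\<And>n. \<tau> n \<in> couplings \<mu> \<nu>" "\<And>n. transport_cost (\<tau> n) < c + ennreal (1 / Suc n)"
    by metis
  obtain \<rho> where \<rho>: "\<rho> \<in> couplings \<mu> \<nu>"
    "\<And>b n0. (\<And>n. n0 \<le> n \<Longrightarrow> transport_cost (\<tau> n) \<le> b) \<Longrightarrow> transport_cost \<rho> \<le> b"
    using coupling_weak_limit[where \<sigma>=\<tau>, OF q \<tau>(1)] by blast
  have "transport_cost \<rho> \<le> c"
  proof (rule ennreal_le_epsilon)
    fix e :: real assume "0 < e"
    then obtain n0 where n0: "1 / Suc n0 < e" using nat_approx_posE by blast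
    show "transport_cost \<rho> \<le> c + ennreal e"
    proof (rule \<rho>(2))
      fix n assume "n0 \<le> n"
      then have "1 / real (Suc n) \<le> 1 / real (Suc n0)" by (intro divide_left_mono) auto
      then have "c + ennreal (1 / Suc n) \<le> c + ennreal e" using n0 by (intro add_left_mono ennreal_leI) linarith
      then show "transport_cost (\<tau> n) \<le> c + ennreal e"
        by (rule order_trans[OF less_imp_le[OF \<tau>(2)[of n]]])
    qed
  qed
  then have "transport_cost \<rho> \<le> transport_cost \<sigma>'" if "\<sigma>' \<in> couplings \<mu> \<nu>" for \<sigma>'
    using that unfolding c_def by (meson INF_lower order_trans)
  moreover have "transport_cost \<rho> < \<infinity>" using \<open>transport_cost \<rho> \<le> c\<close> ctop by simp
  ultimately have "optimal_plan \<rho>" unfolding optimal_plan_def using \<rho>(1) by (simp add: couplings_def)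
  then show ?thesis using \<rho>(1) by blast
qed

section \<open>Wasserstein geodesics from optimal plans\<close>

text \<open>This assembles a competitor for an optimal plan from a rescaled coupling and the
  untouched remainder.\<close>

lemma ex_measure_sum:
  fixes M N :: "'b::topological_space measure" and p :: ennreal
  assumes M: "sets M = sets borel" and N: "sets N = sets borel"
  obtains R where "sets R = sets borel"
    "\<And>B. B \<in> sets borel \<Longrightarrow> emeasure R B = p * emeasure M B + emeasure N B"
    "\<And>f. f \<in> borel_measurable borel \<Longrightarrow> (\<integral>\<^sup>+x. f x \<partial>R) = p * (\<integral>\<^sup>+x. f x \<partial>M) + (\<integral>\<^sup>+x. f x \<partial>N)"
proof -
  define R where "R = measure_of UNIV (sets (borel :: 'b measure)) (\<lambda>B. p * emeasure M B + emeasure N B)"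
  have sR: "sets R = sets borel"
    unfolding R_def using sets.sigma_sets_eq[of "borel :: 'b measure"] by (simp add: sets_measure_of_conv)
  have eR: "emeasure R B = p * emeasure M B + emeasure N B" if "B \<in> sets borel" for B
    unfolding R_def
  proof (rule emeasure_measure_of_sigma)
    show "sigma_algebra UNIV (sets (borel :: 'b measure))"
      using sets.sigma_algebra_axioms[of "borel :: 'b measure"] by simp
    show "positive (sets borel) (\<lambda>B. p * emeasure M B + emeasure N B)" by (simp add: positive_def)
    show "countably_additive (sets borel) (\<lambda>B. p * emeasure M B + emeasure N B)"
    proof (rule countably_additiveI)
      fix A :: "nat \<Rightarrow> 'b set" assume A: "range A \<subseteq> sets borel" "disjoint_family A"
      have "(\<Sum>i. emeasure M (A i)) = emeasure M (\<Union>i. A i)" "(\<Sum>i. emeasure N (A i)) = emeasure N (\<Union>i. A i)"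
        using A M N by (intro suminf_emeasure; simp)+
      then show "(\<Sum>i. p * emeasure M (A i) + emeasure N (A i)) = p * emeasure M (\<Union>i. A i) + emeasure N (\<Union>i. A i)"
        by (simp add: suminf_add[symmetric, OF summableI summableI])
    qed
  qed (use that in simp)
  have "(\<integral>\<^sup>+x. f x \<partial>R) = p * (\<integral>\<^sup>+x. f x \<partial>M) + (\<integral>\<^sup>+x. f x \<partial>N)" if "f \<in> borel_measurable borel" for f
    using that
  proof (induction f rule: borel_measurable_induct)
    case (cong f g)
    then have "f = g" by (intro ext) simp
    then show ?case using cong by simp
  next
    case (set A)
    then show ?case using eR[OF set] sR M N by simp
  next
    case (mult u c)
    have m: "u \<in> borel_measurable R" "u \<in> borel_measurable M" "u \<in> borel_measurable N"
      using mult(2) sR M N by (simp_all cong: measurable_cong_sets)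
    show ?case using mult m by (simp add: nn_integral_cmult distrib_left mult.left_commute)
  next
    case (add u v)
    have m: "u \<in> borel_measurable R" "u \<in> borel_measurable M" "u \<in> borel_measurable N"
      "v \<in> borel_measurable R" "v \<in> borel_measurable M" "v \<in> borel_measurable N"
      using add.hyps(1,3) sR M N by (simp_all cong: measurable_cong_sets)
    show ?case using add m by (simp add: nn_integral_add distrib_left ac_simps)
  next
    case (seq U)
    have m: "U i \<in> borel_measurable R" "U i \<in> borel_measurable M" "U i \<in> borel_measurable N" for i
      using seq.hyps(1)[of i] sR M N by (simp_all cong: measurable_cong_sets)
    have inc: "incseq (\<lambda>i. \<integral>\<^sup>+x. U i x \<partial>K)" for K :: "'b measure"
      using seq.hyps(3) by (auto simp: incseq_def le_fun_def intro!: nn_integral_mono)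
    have "(\<integral>\<^sup>+x. (SUP i. U i) x \<partial>R) = (SUP i. \<integral>\<^sup>+x. U i x \<partial>R)"
      using nn_integral_monotone_convergence_SUP[OF seq.hyps(3) m(1)] by (simp add: image_comp)
    also have "\<dots> = (SUP i. p * (\<integral>\<^sup>+x. U i x \<partial>M) + (\<integral>\<^sup>+x. U i x \<partial>N))" by (simp add: seq.IH)
    also have "\<dots> = (SUP i. p * (\<integral>\<^sup>+x. U i x \<partial>M)) + (SUP i. \<integral>\<^sup>+x. U i x \<partial>N)"
      using inc[of M] inc[of N] by (intro ennreal_SUP_add) (auto simp: incseq_def intro!: mult_left_mono)
    also have "(SUP i. p * (\<integral>\<^sup>+x. U i x \<partial>M)) = p * (SUP i. \<integral>\<^sup>+x. U i x \<partial>M)"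
      by (rule SUP_mult_left_ennreal[symmetric])
    also have "(SUP i. \<integral>\<^sup>+x. U i x \<partial>M) = (\<integral>\<^sup>+x. (SUP i. U i) x \<partial>M)"
      using nn_integral_monotone_convergence_SUP[OF seq.hyps(3) m(2)] by (simp add: image_comp)
    also have "(SUP i. \<integral>\<^sup>+x. U i x \<partial>N) = (\<integral>\<^sup>+x. (SUP i. U i) x \<partial>N)"
      using nn_integral_monotone_convergence_SUP[OF seq.hyps(3) m(3)] by (simp add: image_comp)
    finally show ?case .
  qed
  with sR eR that show ?thesis by blast
qed

lemma nn_integral_uniform_measure':
  assumes "f \<in> borel_measurable M" "S \<in> sets M"
  shows "(\<integral>\<^sup>+x. f x \<partial>uniform_measure M S) = (\<integral>\<^sup>+x\<in>S. f x \<partial>M) / emeasure M S"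
proof -
  have "(\<integral>\<^sup>+x. f x \<partial>uniform_measure M S) = (\<integral>\<^sup>+x. (indicator S x / emeasure M S) * f x \<partial>M)"
    unfolding uniform_measure_def using assms by (intro nn_integral_density) auto
  also have "\<dots> = (\<integral>\<^sup>+x. (f x * indicator S x) / emeasure M S \<partial>M)"
    by (intro nn_integral_cong) (simp add: divide_ennreal_def ac_simps)
  also have "\<dots> = (\<integral>\<^sup>+x\<in>S. f x \<partial>M) / emeasure M S"
    using assms by (intro nn_integral_divide) auto
  finally show ?thesis .
qed

lemma uniform_measure_borel_probs:
  assumes \<sigma>: "\<sigma> \<in> borel_probs" and S: "S \<in> sets borel" "emeasure \<sigma> S \<noteq> 0"
  shows "uniform_measure \<sigma> S \<in> borel_probs"
proof -
  interpret prob_space \<sigma> by (rule borel_probsD[OF \<sigma>])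
  have "prob_space (uniform_measure \<sigma> S)" using S(2) by (intro prob_space_uniform_measure) auto
  then show ?thesis using borel_probsD(2)[OF \<sigma>] by (simp add: borel_probs_def)
qed

text \<open>A cheaper coupling of the restricted marginals could be combined with the rest of the plan.\<close>

lemma optimal_plan_restrict:
  fixes \<sigma> :: "('a::metric_space \<times> 'a) measure"
  assumes opt: "optimal_plan \<sigma>" and S: "S \<in> sets borel" "emeasure \<sigma> S \<noteq> 0"
  shows "optimal_plan (uniform_measure \<sigma> S)"
proof -
  have \<sigma>: "\<sigma> \<in> borel_probs" and fin: "transport_cost \<sigma> < \<infinity>"
    and min: "\<And>\<sigma>'. \<sigma>' \<in> couplings (distr \<sigma> borel fst) (distr \<sigma> borel snd) \<Longrightarrow> transport_cost \<sigma> \<le> transport_cost \<sigma>'"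
    using opt by (auto simp: optimal_plan_def)
  interpret prob_space \<sigma> by (rule borel_probsD[OF \<sigma>])
  note s\<sigma> = borel_probsD(2)[OF \<sigma>]
  have sp: "space \<sigma> = UNIV" using sets_eq_imp_space_eq[OF s\<sigma>] by simp
  define d where "d z = ennreal ((dist (fst z) (snd z))\<^sup>2)" for z :: "'a \<times> 'a"
  have md: "d \<in> borel_measurable borel" unfolding d_def by (rule measurable_dist_sq)
  have md\<sigma>: "d \<in> borel_measurable \<sigma>" using md borel_measurable_borel_probs[OF \<sigma>] by blast
  have cost: "transport_cost \<tau> = (\<integral>\<^sup>+z. d z \<partial>\<tau>)" for \<tau> by (simp add: transport_cost_def d_def)
  define p where "p = emeasure \<sigma> S"
  have p: "p \<noteq> 0" "p < \<infinity>" using S(2) by (simp_all add: p_def less_top[symmetric])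
  define \<tau> where "\<tau> = uniform_measure \<sigma> S"
  have \<tau>: "\<tau> \<in> borel_probs" unfolding \<tau>_def by (rule uniform_measure_borel_probs[OF \<sigma> S])
  have S\<sigma>: "S \<in> sets \<sigma>" using S(1) s\<sigma> by simp
  have pdiv: "p * (a / p) = a" for a
    using p by (metis ennreal_mult_divide_eq ennreal_times_divide infinity_ennreal_def mult.commute order_less_irrefl)
  have e\<tau>: "p * emeasure \<tau> B = emeasure \<sigma> (B \<inter> S)" if "B \<in> sets borel" for B
    unfolding \<tau>_def using S\<sigma> that s\<sigma> pdiv by (simp add: p_def Int_commute)
  have c\<tau>: "p * transport_cost \<tau> = (\<integral>\<^sup>+z\<in>S. d z \<partial>\<sigma>)"
    unfolding cost \<tau>_def nn_integral_uniform_measure'[OF md\<sigma> S\<sigma>] using pdiv by (simp add: p_def)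
  define r where "r = (\<integral>\<^sup>+z\<in>-S. d z \<partial>\<sigma>)"
  have split: "transport_cost \<sigma> = p * transport_cost \<tau> + r"
  proof -
    have "transport_cost \<sigma> = (\<integral>\<^sup>+z. d z * indicator S z + d z * indicator (- S) z \<partial>\<sigma>)"
      unfolding cost by (intro nn_integral_cong) (auto split: split_indicator)
    also have "\<dots> = (\<integral>\<^sup>+z\<in>S. d z \<partial>\<sigma>) + r"
      unfolding r_def using md\<sigma> S\<sigma> sp by (intro nn_integral_add borel_measurable_times_ennreal borel_measurable_indicator)
        (auto simp: Compl_eq_Diff_UNIV sets.compl_sets[of S \<sigma>, simplified sp])
    finally show ?thesis using c\<tau> by simp
  qed
  have rfin: "r < \<infinity>" using fin split by (simp add: ennreal_add_less_top)
  have "transport_cost \<tau> \<le> transport_cost \<tau>'" if \<tau>': "\<tau>' \<in> couplings (distr \<tau> borel fst) (distr \<tau> borel snd)" for \<tau>'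
  proof -
    have \<tau>'b: "\<tau>' \<in> borel_probs" and m1: "distr \<tau>' borel fst = distr \<tau> borel fst"
      and m2: "distr \<tau>' borel snd = distr \<tau> borel snd" using \<tau>' by (auto simp: couplings_def)
    have sp': "space \<tau> = UNIV" "space \<tau>' = UNIV"
      using sets_eq_imp_space_eq[OF borel_probsD(2)[OF \<tau>]] sets_eq_imp_space_eq[OF borel_probsD(2)[OF \<tau>'b]] by simp_all
    define N where "N = density \<sigma> (indicator (- S))"
    have cS: "- S \<in> sets \<sigma>" using sets.compl_sets[OF S\<sigma>] sp by (simp add: Compl_eq_Diff_UNIV)
    have sN: "sets N = sets borel" using s\<sigma> by (simp add: N_def)
    have eN: "emeasure N B = emeasure \<sigma> (B - S)" if "B \<in> sets borel" for B
    proof -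
      have "emeasure N B = (\<integral>\<^sup>+z\<in>B. indicator (- S) z \<partial>\<sigma>)"
        unfolding N_def using that s\<sigma> cS by (intro emeasure_density) auto
      also have "\<dots> = (\<integral>\<^sup>+z. indicator (B - S) z \<partial>\<sigma>)"
        by (intro nn_integral_cong) (auto split: split_indicator)
      finally show ?thesis using that s\<sigma> S\<sigma> by simp
    qed
    have iN: "(\<integral>\<^sup>+z. d z \<partial>N) = r"
      unfolding N_def r_def using md\<sigma> cS by (subst nn_integral_density) (auto simp: mult.commute)
    \<comment> \<open>The competitor \<open>p * \<tau>' + N\<close>: the part of
      \<open>\<sigma>\<close> inside \<open>S\<close>, which is \<open>p * \<tau>\<close>, is
      exchanged for \<open>p * \<tau>'\<close>. The marginals stay those of \<open>\<sigma>\<close>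
      because \<open>\<tau>\<close> and \<open>\<tau>'\<close> share theirs.\<close>
    obtain R where R: "sets R = sets borel"
      "\<And>B. B \<in> sets borel \<Longrightarrow> emeasure R B = p * emeasure \<tau>' B + emeasure N B"
      "\<And>f. f \<in> borel_measurable borel \<Longrightarrow> (\<integral>\<^sup>+x. f x \<partial>R) = p * (\<integral>\<^sup>+x. f x \<partial>\<tau>') + (\<integral>\<^sup>+x. f x \<partial>N)"
      using ex_measure_sum[OF borel_probsD(2)[OF \<tau>'b] sN, of p] by blast
    have spR: "space R = UNIV" using sets_eq_imp_space_eq[OF R(1)] by simp
    have union: "emeasure \<sigma> (B \<inter> S) + emeasure \<sigma> (B - S) = emeasure \<sigma> B" if "B \<in> sets borel" for B
      using that S\<sigma> s\<sigma> by (subst plus_emeasure) (auto intro!: arg_cong[where f="emeasure \<sigma>"])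
    have marg: "distr R borel h = distr \<sigma> borel h"
      if h: "h \<in> borel_measurable borel" and eq: "distr \<tau>' borel h = distr \<tau> borel h" for h :: "'a \<times> 'a \<Rightarrow> 'a"
    proof (rule measure_eqI)
      fix B assume "B \<in> sets (distr R borel h)"
      then have B: "B \<in> sets borel" by simp
      have hB: "h -` B \<in> sets borel" using measurable_sets[OF h B] by simp
      have mh: "h \<in> borel_measurable \<sigma>" "h \<in> borel_measurable \<tau>" "h \<in> borel_measurable \<tau>'" "h \<in> borel_measurable R"
        using h R(1) borel_measurable_borel_probs[OF \<sigma>] borel_measurable_borel_probs[OF \<tau>] borel_measurable_borel_probs[OF \<tau>'b]
        by (auto cong: measurable_cong_sets)
      have "emeasure \<tau>' (h -` B) = emeasure \<tau> (h -` B)"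
        using arg_cong[OF eq, of "\<lambda>M. emeasure M B"] B mh sp' by (simp add: emeasure_distr)
      then have "emeasure R (h -` B) = emeasure \<sigma> (h -` B \<inter> S) + emeasure \<sigma> (h -` B - S)"
        using R(2)[OF hB] eN[OF hB] e\<tau>[OF hB] by simp
      also have "\<dots> = emeasure \<sigma> (h -` B)" by (rule union[OF hB])
      finally show "emeasure (distr R borel h) B = emeasure (distr \<sigma> borel h) B"
        using B mh spR sp by (simp add: emeasure_distr)
    qed simp
    have "emeasure R UNIV = 1"
    proof -
      have "emeasure \<tau>' UNIV = emeasure \<tau> UNIV"
        using prob_space.emeasure_space_1[OF borel_probsD(1)[OF \<tau>]] prob_space.emeasure_space_1[OF borel_probsD(1)[OF \<tau>'b]] sp' by simp
      then have "emeasure R UNIV = emeasure \<sigma> UNIV"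
        using R(2)[of UNIV] eN[of UNIV] e\<tau>[of UNIV] union[of UNIV] by simp
      then show ?thesis using emeasure_space_1 sp by simp
    qed
    then have "prob_space R" using spR by (intro prob_spaceI) simp
    then have "R \<in> couplings (distr \<sigma> borel fst) (distr \<sigma> borel snd)"
      using R(1) marg[OF borel_measurable_fst' m1] marg[OF borel_measurable_snd' m2]
      by (simp add: couplings_def borel_probs_def)
    from min[OF this] have "p * transport_cost \<tau> + r \<le> p * transport_cost \<tau>' + r"
      unfolding split by (simp add: cost R(3)[OF md] iN)
    then have "p * transport_cost \<tau> \<le> p * transport_cost \<tau>'"
      using rfin by (auto simp: add.commute[of _ r] ennreal_add_left_cancel_le)
    then show ?thesis using p by (simp add: ennreal_mult_le_mult_iff)
  qed
  moreover have "transport_cost \<tau> < \<infinity>"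
  proof -
    have "p * transport_cost \<tau> < \<infinity>" using fin split by (simp add: ennreal_add_less_top)
    then show ?thesis using p by (auto simp: ennreal_mult_less_top)
  qed
  ultimately show ?thesis unfolding optimal_plan_def \<tau>_def[symmetric] using \<tau> by blast
qed

lemma W2_optimal_plan:
  assumes opt: "optimal_plan \<sigma>"
  shows "W2 (distr \<sigma> borel fst) (distr \<sigma> borel snd) = ennreal_sqrt (transport_cost \<sigma>)"
proof -
  have "\<sigma> \<in> couplings (distr \<sigma> borel fst) (distr \<sigma> borel snd)"
    using opt by (simp add: couplings_def optimal_plan_def)
  then have "(INF \<tau>\<in>couplings (distr \<sigma> borel fst) (distr \<sigma> borel snd). transport_cost \<tau>) = transport_cost \<sigma>"
    using opt by (intro antisym INF_lower INF_greatest) (auto simp: optimal_plan_def)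
  then show ?thesis unfolding W2_def transport_cost_def by simp
qed

text \<open>The law of \<open>(G z s, G z t)\<close> is a coupling, which gives
  \<open>W2 \<le> \<bar>s - t\<bar> * w\<close>. A strict inequality would, by the triangle
  inequality through times \<open>s\<close> and \<open>t\<close>, make the distance of the ends
  smaller than \<open>w\<close>, against the optimality of \<open>\<sigma>\<close>.\<close>

theorem optimal_plan_geodesic:
  fixes \<sigma> :: "('a::metric_space \<times> 'a) measure" and q :: "nat \<Rightarrow> 'a"
  assumes q: "dense_sequence q" and opt: "optimal_plan \<sigma>"
    and G: "geodesic_interpolation \<sigma> G"
  shows "(\<lambda>t. distr \<sigma> borel (\<lambda>z. G z t)) \<in> W2_geodesics"
    and "distr \<sigma> borel (\<lambda>z. G z 0) = distr \<sigma> borel fst"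
    and "distr \<sigma> borel (\<lambda>z. G z 1) = distr \<sigma> borel snd"
proof -
  interpret dense_sequence q by fact
  have \<sigma>: "\<sigma> \<in> borel_probs" and fin: "transport_cost \<sigma> < \<infinity>" using opt by (auto simp: optimal_plan_def)
  note pr = borel_probsD(1)[OF \<sigma>]
  define \<Gamma> where "\<Gamma> t = distr \<sigma> borel (\<lambda>z. G z t)" for t
  have mG: "(\<lambda>z. G z t) \<in> borel_measurable \<sigma>" for t
    using G borel_measurable_borel_probs[OF \<sigma>] unfolding geodesic_interpolation_def by blast
  have aeG: "AE z in \<sigma>. G z 0 = fst z \<and> G z 1 = snd z \<and>
      (\<forall>s\<in>{0..1}. \<forall>t\<in>{0..1}. dist (G z s) (G z t) = \<bar>s - t\<bar> * dist (fst z) (snd z))"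
    using G unfolding geodesic_interpolation_def by blast
  have G01: "AE z in \<sigma>. G z 0 = fst z" "AE z in \<sigma>. G z 1 = snd z" using aeG by (eventually_elim, blast)+
  have Gd: "AE z in \<sigma>. dist (G z s) (G z t) = \<bar>s - t\<bar> * dist (fst z) (snd z)"
    if "s \<in> {0..1}" "t \<in> {0..1}" for s t
    using aeG by eventually_elim (use that in blast)
  have mfst: "fst \<in> borel_measurable \<sigma>" and msnd: "snd \<in> borel_measurable \<sigma>"
    unfolding borel_measurable_borel_probs[OF \<sigma>] by (rule borel_measurable_fst' borel_measurable_snd')+
  show 0: "distr \<sigma> borel (\<lambda>z. G z 0) = distr \<sigma> borel fst"
    by (rule distr_cong_AE[OF refl refl G01(1) mG mfst])
  show 1: "distr \<sigma> borel (\<lambda>z. G z 1) = distr \<sigma> borel snd"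
    by (rule distr_cong_AE[OF refl refl G01(2) mG msnd])
  define w where "w = sqrt (enn2real (transport_cost \<sigma>))"
  have w0: "0 \<le> w" by (simp add: w_def)
  have cw: "transport_cost \<sigma> = ennreal (w\<^sup>2)" using fin by (simp add: w_def less_top)
  have W01: "W2 (\<Gamma> 0) (\<Gamma> 1) = ennreal w"
    unfolding \<Gamma>_def 0 1 W2_optimal_plan[OF opt] cw using w0 by (rule ennreal_sqrt_power2)
  have upper: "W2 (\<Gamma> s) (\<Gamma> t) \<le> ennreal (\<bar>s - t\<bar> * w)" if st: "s \<in> {0..1}" "t \<in> {0..1}" for s t
  proof (rule W2_le)
    define T where "T z = (G z s, G z t)" for z
    have mT: "T \<in> borel_measurable \<sigma>" unfolding T_def by (rule borel_measurable_Pair'[OF mG mG])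
    have "distr (distr \<sigma> borel T) borel fst = \<Gamma> s" "distr (distr \<sigma> borel T) borel snd = \<Gamma> t"
      unfolding \<Gamma>_def distr_distr[OF borel_measurable_fst' mT] distr_distr[OF borel_measurable_snd' mT]
      by (simp_all add: T_def comp_def)
    then show "distr \<sigma> borel T \<in> couplings (\<Gamma> s) (\<Gamma> t)"
      using distr_in_borel_probs[OF pr mT] by (simp add: couplings_def)
    have "transport_cost (distr \<sigma> borel T) = (\<integral>\<^sup>+z. ennreal ((dist (G z s) (G z t))\<^sup>2) \<partial>\<sigma>)"
      unfolding transport_cost_def by (subst nn_integral_distr[OF mT]) (use measurable_dist_sq in \<open>simp_all add: T_def\<close>)
    also have "\<dots> = (\<integral>\<^sup>+z. ennreal (\<bar>s - t\<bar>\<^sup>2) * ennreal ((dist (fst z) (snd z))\<^sup>2) \<partial>\<sigma>)"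
      using Gd[OF st] by (intro nn_integral_cong_AE) (auto simp: power_mult_distrib ennreal_mult elim!: eventually_mono)
    also have "\<dots> = ennreal (\<bar>s - t\<bar>\<^sup>2) * transport_cost \<sigma>"
      unfolding transport_cost_def
      using measurable_dist_sq borel_measurable_borel_probs[OF \<sigma>] by (intro nn_integral_cmult) blast
    also have "\<dots> = ennreal ((\<bar>s - t\<bar> * w)\<^sup>2)" unfolding cw by (simp add: power_mult_distrib ennreal_mult)
    finally show "transport_cost (distr \<sigma> borel T) \<le> ennreal ((\<bar>s - t\<bar> * w)\<^sup>2)" by simp
  qed (use w0 in simp)
  have eq: "W2 (\<Gamma> s) (\<Gamma> t) = ennreal ((t - s) * w)" if st: "0 \<le> s" "s \<le> t" "t \<le> 1" for s t
  proof -
    have "W2 (\<Gamma> s) (\<Gamma> t) < top" using upper[of s t] st by (auto intro: le_less_trans)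
    then obtain v where v: "W2 (\<Gamma> s) (\<Gamma> t) = ennreal v" "0 \<le> v" by (metis ennreal_cases less_irrefl)
    have a: "W2 (\<Gamma> 0) (\<Gamma> s) \<le> ennreal (s * w)" using upper[of 0 s] st by simp
    have b: "W2 (\<Gamma> t) (\<Gamma> 1) \<le> ennreal ((1 - t) * w)" using upper[of t 1] st by simp
    have c: "W2 (\<Gamma> 0) (\<Gamma> t) \<le> ennreal (s * w + v)"
      using a v st w0 by (intro W2_triangle[of _ "\<Gamma> s"]) auto
    have "W2 (\<Gamma> 0) (\<Gamma> 1) \<le> ennreal (s * w + v + (1 - t) * w)"
      using st w0 v by (intro W2_triangle[OF c b]) auto
    then have "w \<le> s * w + v + (1 - t) * w"
      unfolding W01 using st w0 v by (subst (asm) ennreal_le_iff) auto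
    then have "(t - s) * w \<le> v" by (simp add: algebra_simps)
    moreover have "v \<le> (t - s) * w"
      using upper[of s t] st w0 v by (simp add: ennreal_le_iff)
    ultimately show ?thesis using v by simp
  qed
  have dist: "W2 (\<Gamma> t) (\<Gamma> s) = ennreal (\<bar>t - s\<bar> * w)" if "t \<in> {0..1}" "s \<in> {0..1}" for s t
    using eq[of s t] eq[of t s] W2_commute[of "\<Gamma> t" "\<Gamma> s"] that by (cases "s \<le> t") auto
  have "\<Gamma> \<in> W2_geodesics"
    unfolding W2_geodesics_def
  proof (intro CollectI conjI ballI)
    show "\<Gamma> ` {0..1} \<subseteq> borel_probs" unfolding \<Gamma>_def using distr_in_borel_probs[OF pr mG] by blast
    show "W2 (\<Gamma> 0) (\<Gamma> 1) < \<infinity>" by (simp add: W01)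
    show "W2 (\<Gamma> t) (\<Gamma> s) = ennreal \<bar>t - s\<bar> * W2 (\<Gamma> 0) (\<Gamma> 1)" if "t \<in> {0..1}" "s \<in> {0..1}" for s t
      using dist[OF that] w0 by (simp add: W01 ennreal_mult)
    fix t :: real assume t: "t \<in> {0..1}"
    have "((\<lambda>s. \<bar>s - t\<bar> * w) \<longlongrightarrow> \<bar>t - t\<bar> * w) (at t within {0..1})"
      by (intro tendsto_intros)
    then have "((\<lambda>s. ennreal (\<bar>s - t\<bar> * w)) \<longlongrightarrow> ennreal 0) (at t within {0..1})"
      by (intro tendsto_ennrealI) simp
    moreover have "\<forall>\<^sub>F s in at t within {0..1}. ennreal (\<bar>s - t\<bar> * w) = W2 (\<Gamma> s) (\<Gamma> t)"
      using dist[OF _ t] by (auto simp: eventually_at_filter intro!: always_eventually)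
    ultimately show "((\<lambda>s. W2 (\<Gamma> s) (\<Gamma> t)) \<longlongrightarrow> 0) (at t within {0..1})"
      using Lim_transform_eventually by fastforce
  qed
  then show "(\<lambda>t. distr \<sigma> borel (\<lambda>z. G z t)) \<in> W2_geodesics" unfolding \<Gamma>_def .
qed

section \<open>Bounds for the entropy integral\<close>

text \<open>Among the \<open>m\<close>-null sets one of maximal \<open>\<mu>\<close>-mass,
  \<open>A0\<close>, is obtained as a countable union. By maximality \<open>\<mu>\<close> is
  absolutely continuous off \<open>A0\<close>, where the Radon-Nikodym theorem applies; its
  restriction to \<open>A0\<close> is the singular part.\<close>

lemma ex_lebesgue_density:
  fixes m \<mu> :: "'a::topological_space measure"
  assumes m: "sigma_finite_measure m" "sets m = sets borel"
    and \<mu>: "finite_measure \<mu>" "sets \<mu> = sets borel"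
  shows "\<exists>\<rho>. lebesgue_density m \<mu> \<rho>"
proof -
  interpret m: sigma_finite_measure m by fact
  interpret \<mu>: finite_measure \<mu> by fact
  define Z where "Z = {A \<in> sets borel. emeasure m A = 0}"
  have "Z \<noteq> {}" unfolding Z_def by (auto intro!: exI[of _ "{}"])
  from ennreal_SUP_countable_SUP[OF this, of "emeasure \<mu>"] obtain ys :: "nat \<Rightarrow> ennreal"
    where ys: "range ys \<subseteq> emeasure \<mu> ` Z" "Sup (emeasure \<mu> ` Z) = Sup (range ys)" by blast
  then have "\<forall>n. \<exists>A. A \<in> Z \<and> emeasure \<mu> A = ys n" by (metis imageE range_subsetD)
  then obtain A where A: "\<And>n. A n \<in> Z" "\<And>n. emeasure \<mu> (A n) = ys n" by metis
  define A0 where "A0 = (\<Union>n. A n)"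
  have A0[measurable]: "A0 \<in> sets borel" using A(1) unfolding A0_def Z_def by blast
  have mA0: "emeasure m A0 = 0"
    using A(1) m(2) unfolding A0_def Z_def by (intro emeasure_UN_eq_0) auto
  have max: "emeasure \<mu> B \<le> emeasure \<mu> A0" if "B \<in> Z" for B
  proof -
    have "emeasure \<mu> B \<le> Sup (emeasure \<mu> ` Z)" using that by (rule SUP_upper)
    also have "\<dots> \<le> emeasure \<mu> A0" unfolding ys(2)
    proof (rule SUP_least)
      fix n
      show "ys n \<le> emeasure \<mu> A0"
        unfolding A(2)[symmetric] A0_def using A0 \<mu>(2) unfolding A0_def by (intro emeasure_mono) auto
    qed
    finally show ?thesis .
  qed
  have mind: "(\<lambda>x. indicator S x :: ennreal) \<in> borel_measurable \<mu>" if "S \<in> sets borel" for S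
    using that \<mu>(2) by simp
  define \<mu>' where "\<mu>' = density \<mu> (indicator (- A0))"
  define \<nu> where "\<nu> = density \<mu> (indicator A0)"
  have e\<mu>': "emeasure \<mu>' B = emeasure \<mu> (B - A0)" if "B \<in> sets borel" for B
  proof -
    have "emeasure \<mu>' B = (\<integral>\<^sup>+x\<in>B. indicator (- A0) x \<partial>\<mu>)"
      unfolding \<mu>'_def using that \<mu>(2) A0 by (intro emeasure_density mind) auto
    also have "\<dots> = (\<integral>\<^sup>+x. indicator (B - A0) x \<partial>\<mu>)"
      by (intro nn_integral_cong) (auto split: split_indicator)
    finally show ?thesis using that \<mu>(2) A0 by simp
  qed
  have e\<nu>: "emeasure \<nu> B = emeasure \<mu> (B \<inter> A0)" if "B \<in> sets borel" for B
  proof -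
    have "emeasure \<nu> B = (\<integral>\<^sup>+x\<in>B. indicator (A0) x \<partial>\<mu>)"
      unfolding \<nu>_def using that \<mu>(2) A0 by (intro emeasure_density mind) auto
    also have "\<dots> = (\<integral>\<^sup>+x. indicator (B \<inter> A0) x \<partial>\<mu>)"
      by (intro nn_integral_cong) (auto split: split_indicator)
    finally show ?thesis using that \<mu>(2) A0 by simp
  qed
  have "absolutely_continuous m \<mu>'"
    unfolding absolutely_continuous_def
  proof
    fix B assume "B \<in> null_sets m"
    then have B: "B \<in> sets borel" "emeasure m B = 0" using m(2) by auto
    then have "emeasure m (A0 \<union> B) = 0"
      using mA0 m(2) A0 by (metis (no_types, lifting) emeasure_Un_null_set null_setsI)
    then have "A0 \<union> B \<in> Z" using B A0 unfolding Z_def by auto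
    from max[OF this] have "emeasure \<mu> (A0 \<union> (B - A0)) \<le> emeasure \<mu> A0" by simp
    moreover have "emeasure \<mu> (A0 \<union> (B - A0)) = emeasure \<mu> A0 + emeasure \<mu> (B - A0)"
      using A0 B \<mu>(2) by (intro plus_emeasure[symmetric]) auto
    ultimately have "emeasure \<mu> (B - A0) = 0"
      using \<mu>.emeasure_finite[of A0] 
        ennreal_add_left_cancel_le[of "emeasure \<mu> A0" "emeasure \<mu> (B - A0)" 0] by simp
    then show "B \<in> null_sets \<mu>'" using e\<mu>'[OF B(1)] B(1) \<mu>(2) by (auto simp: \<mu>'_def)
  qed
  moreover have "sets \<mu>' = sets m" using \<mu>(2) m(2) by (simp add: \<mu>'_def)
  ultimately obtain f where f: "f \<in> borel_measurable m" "density m f = \<mu>'"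
    using m.Radon_Nikodym by blast
  have f'[measurable]: "f \<in> borel_measurable borel" using f(1) m(2) by (simp cong: measurable_cong_sets)
  have "(\<integral>\<^sup>+x. f x \<partial>m) = emeasure \<mu>' UNIV"
    using f(1) unfolding f(2)[symmetric] by (subst emeasure_density) (auto simp: m(2))
  also have "\<dots> < \<infinity>" using e\<mu>'[of UNIV] \<mu>.emeasure_finite[of "UNIV - A0"] by (simp add: less_top[symmetric])
  finally have fin: "AE x in m. f x \<noteq> \<infinity>" using f(1) by (intro nn_integral_PInf_AE) auto
  define \<rho> where "\<rho> x = enn2real (f x)" for x
  have "emeasure \<mu> B = (\<integral>\<^sup>+x\<in>B. ennreal (\<rho> x) \<partial>m) + emeasure \<nu> B" if B: "B \<in> sets borel" for B
  proof -
    have "emeasure \<mu>' B = (\<integral>\<^sup>+x\<in>B. f x \<partial>m)"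
      unfolding f(2)[symmetric] using B m(2) f(1) by (subst emeasure_density) auto
    also have "\<dots> = (\<integral>\<^sup>+x\<in>B. ennreal (\<rho> x) \<partial>m)"
      using fin by (intro nn_integral_cong_AE) (auto simp: \<rho>_def less_top elim!: eventually_mono)
    finally have "emeasure \<mu> (B - A0) = (\<integral>\<^sup>+x\<in>B. ennreal (\<rho> x) \<partial>m)" using e\<mu>'[OF B] by simp
    moreover have "emeasure \<mu> B = emeasure \<mu> (B - A0) + emeasure \<mu> (B \<inter> A0)"
      using B A0 \<mu>(2) by (subst plus_emeasure) (auto intro!: arg_cong[where f="emeasure \<mu>"])
    ultimately show ?thesis using e\<nu>[OF B] by simp
  qed
  moreover have "mutually_singular m \<nu>"
    unfolding mutually_singular_def using A0 mA0 e\<nu>[of "UNIV - A0"] by (intro bexI[of _ A0]) (auto simp: Diff_Int_distrib2)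
  moreover have "\<rho> \<in> borel_measurable borel" unfolding \<rho>_def by measurable
  moreover have "sets \<nu> = sets borel" using \<mu>(2) by (simp add: \<nu>_def)
  ultimately have "lebesgue_density m \<mu> \<rho>"
    unfolding lebesgue_density_def by (intro conjI exI[of _ \<nu>] ballI allI) (auto simp: \<rho>_def)
  then show ?thesis by blast
qed

text \<open>Jensen's inequality for the concave power on \<open>A\<close>. A singular part can only
  lower the mass of \<open>\<rho>\<close> below \<open>1\<close>, which is in the right
  direction.\<close>

lemma lebesgue_density_integral_upper:
  fixes m \<mu> :: "'a::topological_space measure"
  assumes ld: "lebesgue_density m \<mu> \<rho>" and m: "sets m = sets borel" and \<mu>: "emeasure \<mu> UNIV = 1"
    and A: "A \<in> sets borel" "emeasure \<mu> (- A) = 0" "emeasure m A < \<infinity>" and N: "1 \<le> N"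
  shows "(\<integral>\<^sup>+x. ennreal (\<rho> x powr (1 - 1 / N)) \<partial>m) \<le> ennreal (measure m A powr (1 / N))"
proof -
  have \<rho>[measurable]: "\<rho> \<in> borel_measurable borel" and \<rho>0: "\<And>x. 0 \<le> \<rho> x"
    using ld unfolding lebesgue_density_def by auto
  have \<rho>m[measurable]: "\<rho> \<in> borel_measurable m" using \<rho> m by (simp cong: measurable_cong_sets)
  have le: "(\<integral>\<^sup>+x\<in>B. ennreal (\<rho> x) \<partial>m) \<le> emeasure \<mu> B" if "B \<in> sets borel" for B
    using ld that unfolding lebesgue_density_def by (metis le_iff_add)
  have Am[measurable]: "A \<in> sets m" "- A \<in> sets m" using A(1) m by (auto simp: Compl_eq_Diff_UNIV)
  have "- A \<in> sets borel" using A(1) by auto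
  from le[OF this] have "(\<integral>\<^sup>+x\<in>-A. ennreal (\<rho> x) \<partial>m) = 0" using A(2) by simp
  then have ae: "AE x in m. x \<notin> A \<longrightarrow> \<rho> x = 0"
    by (subst (asm) nn_integral_0_iff_AE) (use \<rho>0 in \<open>auto elim!: eventually_mono split: split_indicator_asm simp: order_antisym_conv\<close>)
  define \<theta> where "\<theta> = 1 / N"
  have \<theta>: "0 < \<theta>" "\<theta> \<le> 1" using N by (auto simp: \<theta>_def)
  define a where "a = measure m A"
  have ea: "emeasure m A = ennreal a" using A(3) by (simp add: a_def emeasure_eq_ennreal_measure less_top)
  show ?thesis
  \<comment> \<open>The tangent at \<open>1 / a\<close> requires \<open>a > 0\<close>. For
    \<open>a = 0\<close> the density vanishes almost everywhere, and
    \<open>0 powr (1 - 1 / N)\<close> is \<open>0\<close> also for \<open>N = 1\<close>.\<close>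
  proof (cases "a = 0")
    case True
    then have "A \<in> null_sets m" using Am ea by auto
    then have "AE x in m. x \<notin> A" by (rule AE_not_in)
    with ae have "AE x in m. \<rho> x = 0" by eventually_elim auto
    then have "(\<integral>\<^sup>+x. ennreal (\<rho> x powr (1 - 1 / N)) \<partial>m) = (\<integral>\<^sup>+x. 0 \<partial>m)"
      by (intro nn_integral_cong_AE) (auto elim!: eventually_mono)
    then show ?thesis by simp
  next
    case False
    then have a: "0 < a" by (simp add: a_def less_le)
    \<comment> \<open>The tangent of \<open>s powr (1 - \<theta>)\<close> at
      \<open>s = 1 / a\<close>, the density of the uniform measure of \<open>A\<close>; equality
      there is what produces the sharp value \<open>a powr \<theta>\<close> after
      integration.\<close>
    have pw: "\<rho> x powr (1 - \<theta>) \<le> (1 - \<theta>) * a powr \<theta> * \<rho> x + \<theta> * a powr (\<theta> - 1)" for x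
    proof (cases "\<rho> x = 0")
      case True then show ?thesis using \<theta> by simp
    next
      case False
      then have "0 < \<rho> x" using \<rho>0[of x] by simp
      have "\<rho> x powr (1 - \<theta>) * (1/a) powr \<theta> \<le> (1 - \<theta>) * \<rho> x + \<theta> * (1/a)"
        using \<theta> a \<open>0 < \<rho> x\<close> by (intro Youngs_inequality_0) auto
      then have "a powr \<theta> * (\<rho> x powr (1 - \<theta>) * (1/a) powr \<theta>) \<le> a powr \<theta> * ((1 - \<theta>) * \<rho> x + \<theta> * (1/a))"
        by (rule mult_left_mono) simp
      also have "\<dots> = (1 - \<theta>) * a powr \<theta> * \<rho> x + \<theta> * (a powr \<theta> / a)" by (simp add: algebra_simps)
      also have "a powr \<theta> / a = a powr (\<theta> - 1)" using a by (simp add: powr_diff)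
      also have "a powr \<theta> * (\<rho> x powr (1 - \<theta>) * (1/a) powr \<theta>) = \<rho> x powr (1 - \<theta>)"
      proof -
        have "a powr \<theta> * (1/a) powr \<theta> = 1" using a by (simp add: powr_mult[symmetric])
        then show ?thesis by (simp add: mult.left_commute)
      qed
      finally show ?thesis .
    qed
    have "(\<integral>\<^sup>+x. ennreal (\<rho> x powr (1 - 1 / N)) \<partial>m)
        \<le> (\<integral>\<^sup>+x. ennreal ((1 - \<theta>) * a powr \<theta>) * ennreal (\<rho> x) + ennreal (\<theta> * a powr (\<theta> - 1)) * indicator A x \<partial>m)"
    proof (rule nn_integral_mono_AE, use ae in eventually_elim)
      fix x assume x: "x \<notin> A \<longrightarrow> \<rho> x = 0"
      show "ennreal (\<rho> x powr (1 - 1 / N)) \<le> ennreal ((1 - \<theta>) * a powr \<theta>) * ennreal (\<rho> x)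
          + ennreal (\<theta> * a powr (\<theta> - 1)) * indicator A x"
      proof (cases "x \<in> A")
        case True
        have "ennreal (\<rho> x powr (1 - 1 / N)) \<le> ennreal ((1 - \<theta>) * a powr \<theta> * \<rho> x + \<theta> * a powr (\<theta> - 1))"
          using pw[of x] by (intro ennreal_leI) (simp add: \<theta>_def)
        then show ?thesis using True \<theta> \<rho>0 by (simp add: ennreal_plus ennreal_mult)
      qed (use x in simp)
    qed
    also have "\<dots> = ennreal ((1 - \<theta>) * a powr \<theta>) * (\<integral>\<^sup>+x. ennreal (\<rho> x) \<partial>m) + ennreal (\<theta> * a powr (\<theta> - 1)) * ennreal a"
      by (subst nn_integral_add) (auto simp: nn_integral_cmult ea)
    also have "\<dots> \<le> ennreal ((1 - \<theta>) * a powr \<theta>) * 1 + ennreal (\<theta> * a powr (\<theta> - 1)) * ennreal a"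
      using le[of UNIV] \<mu> by (intro add_right_mono mult_left_mono) auto
    also have "\<dots> = ennreal ((1 - \<theta>) * a powr \<theta> + \<theta> * a powr (\<theta> - 1) * a)"
      using \<theta> a by (simp add: ennreal_plus ennreal_mult)
    also have "(1 - \<theta>) * a powr \<theta> + \<theta> * a powr (\<theta> - 1) * a = a powr \<theta>"
      using a by (simp add: powr_diff algebra_simps)
    finally show ?thesis by (simp add: \<theta>_def a_def)
  qed
qed

text \<open>Domination by \<open>c * m\<close> excludes a singular part and forces
  \<open>\<rho> \<le> c\<close> almost everywhere for \<open>\<mu>\<close>. There
  \<open>\<rho> powr (1 - 1 / N)\<close> is at least \<open>c powr (- (1 / N)) * \<rho>\<close>, and
  \<open>\<rho>\<close> has integral \<open>1\<close>.\<close>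

lemma lebesgue_density_integral_lower:
  fixes m \<mu> :: "'a::topological_space measure"
  assumes ld: "lebesgue_density m \<mu> \<rho>" and m: "sets m = sets borel" and \<mu>: "emeasure \<mu> UNIV = 1"
    "sets \<mu> = sets borel"
    and c: "0 < c" "\<And>B. B \<in> sets borel \<Longrightarrow> emeasure \<mu> B \<le> ennreal c * emeasure m B" and N: "1 \<le> N"
  shows "ennreal (c powr (- (1 / N))) \<le> (\<integral>\<^sup>+x. ennreal (\<rho> x powr (1 - 1 / N)) \<partial>m)"
proof -
  have \<rho>[measurable]: "\<rho> \<in> borel_measurable borel" and \<rho>0: "\<And>x. 0 \<le> \<rho> x"
    using ld unfolding lebesgue_density_def by auto
  have \<rho>m[measurable]: "\<rho> \<in> borel_measurable m" using \<rho> m by (simp cong: measurable_cong_sets)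
  obtain \<nu> where \<nu>: "sets \<nu> = sets borel" "mutually_singular m \<nu>"
    "\<And>B. B \<in> sets borel \<Longrightarrow> emeasure \<mu> B = (\<integral>\<^sup>+x\<in>B. ennreal (\<rho> x) \<partial>m) + emeasure \<nu> B"
    using ld unfolding lebesgue_density_def by auto
  obtain A where A: "A \<in> sets borel" "emeasure m A = 0" "emeasure \<nu> (UNIV - A) = 0"
    using \<nu>(2) unfolding mutually_singular_def by blast
  have "emeasure \<nu> A = 0" using \<nu>(3)[OF A(1)] c(2)[OF A(1)] A(2) by simp
  then have "emeasure \<nu> UNIV = 0"
    using A plus_emeasure[of A \<nu> "UNIV - A"] \<nu>(1) by simp
  then have "emeasure \<nu> B = 0" if "B \<in> sets borel" for B
    using emeasure_mono[of B UNIV \<nu>] \<nu>(1) by simp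
  then have e: "emeasure \<mu> B = (\<integral>\<^sup>+x\<in>B. ennreal (\<rho> x) \<partial>m)" if "B \<in> sets borel" for B
    using \<nu>(3)[OF that] that by simp
  \<comment> \<open>On \<open>T j\<close> the density exceeds \<open>c\<close> by a fixed margin, so
    positive mass \<open>t\<close> would give \<open>d * b \<le> t \<le> c * b\<close> with
    \<open>d > c\<close> and \<open>b\<close> the measure of \<open>T j\<close>. These sets exhaust
    the set where \<open>\<rho> > c\<close>.\<close>
  define T where "T j = {x. c + 1 / Suc j \<le> \<rho> x}" for j
  have T: "T j \<in> sets borel" for j unfolding T_def by simp
  have "emeasure \<mu> (T j) = 0" for j
  proof (rule ccontr)
    assume n0: "emeasure \<mu> (T j) \<noteq> 0"
    define d where "d = c + 1 / Suc j"
    have d: "c < d" "0 < d" using c(1) by (auto simp: d_def add_pos_pos)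
    have "emeasure \<mu> (T j) \<le> emeasure \<mu> UNIV" using \<mu>(2) by (intro emeasure_mono) auto
    then obtain t where t: "emeasure \<mu> (T j) = ennreal t" "0 \<le> t"
      using \<mu>(1) by (metis ennreal_cases ennreal_one_neq_top top.extremum_unique)
    have "ennreal d * emeasure m (T j) = (\<integral>\<^sup>+x. ennreal d * indicator (T j) x \<partial>m)"
      using T m by (subst nn_integral_cmult_indicator) auto
    also have "\<dots> \<le> (\<integral>\<^sup>+x\<in>T j. ennreal (\<rho> x) \<partial>m)"
      by (intro nn_integral_mono) (auto simp: T_def d_def split: split_indicator intro!: ennreal_leI)
    also have "\<dots> = ennreal t" using e[OF T] t by simp
    finally have 1: "ennreal d * emeasure m (T j) \<le> ennreal t" .
    then have "emeasure m (T j) \<noteq> \<infinity>"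
      using d by (auto simp: ennreal_mult_top top_unique)
    then obtain b where b: "emeasure m (T j) = ennreal b" "0 \<le> b" by (metis ennreal_cases infinity_ennreal_def)
    have "d * b \<le> t" using 1 b d t by (simp add: ennreal_mult[symmetric])
    moreover have "t \<le> c * b" using c(2)[OF T, of j] b t c(1) by (simp add: ennreal_mult[symmetric])
    moreover have "0 < t" using n0 t by (simp add: less_le)
    ultimately have "d * b \<le> c * b" "0 < c * b" by linarith+
    then show False using d c(1) by (simp add: zero_less_mult_iff)
  qed
  then have T0: "emeasure \<mu> (\<Union>j. T j) = 0" using T \<mu>(2) by (intro emeasure_UN_eq_0) auto
  have TU: "(\<Union>j. T j) = {x. c < \<rho> x}"
  proof safe
    fix x j assume "x \<in> T j"
    then show "c < \<rho> x" unfolding T_def using c(1)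
      by (smt (verit) mem_Collect_eq of_nat_0_less_iff zero_less_Suc zero_less_divide_1_iff)
  next
    fix x assume "c < \<rho> x"
    then obtain j where "1 / Suc j < \<rho> x - c" using nat_approx_posE[of "\<rho> x - c"] by auto
    then show "x \<in> (\<Union>j. T j)" unfolding T_def by (intro UN_I[of j]) auto
  qed
  define L where "L = {x. \<rho> x \<le> c}"
  have Lm: "L \<in> sets borel" unfolding L_def by simp
  have "emeasure \<mu> UNIV \<le> emeasure \<mu> L + emeasure \<mu> (\<Union>j. T j)"
  proof -
    have "UNIV = L \<union> (\<Union>j. T j)" unfolding TU L_def by auto
    then show ?thesis using emeasure_subadditive[of L \<mu> "\<Union>j. T j"] Lm T \<mu>(2) by simp
  qed
  then have L1: "1 \<le> emeasure \<mu> L" using T0 \<mu>(1) by simp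
  have "ennreal (c powr (- (1 / N))) \<le> ennreal (c powr (- (1 / N))) * emeasure \<mu> L"
    using mult_left_mono[OF L1, of "ennreal (c powr (- (1 / N)))"] by simp
  also have "\<dots> = (\<integral>\<^sup>+x. ennreal (c powr (- (1 / N))) * (ennreal (\<rho> x) * indicator L x) \<partial>m)"
    unfolding e[OF Lm] using Lm m by (subst nn_integral_cmult) auto
  also have "\<dots> \<le> (\<integral>\<^sup>+x. ennreal (\<rho> x powr (1 - 1 / N)) \<partial>m)"
  proof (rule nn_integral_mono)
    fix x
    show "ennreal (c powr (- (1 / N))) * (ennreal (\<rho> x) * indicator L x) \<le> ennreal (\<rho> x powr (1 - 1 / N))"
    proof (cases "x \<in> L \<and> 0 < \<rho> x")
      case True
      then have "c powr (- (1 / N)) \<le> \<rho> x powr (- (1 / N))"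
        unfolding L_def using N by (intro powr_mono2') auto
      then have "c powr (- (1 / N)) * \<rho> x \<le> \<rho> x powr (- (1 / N)) * \<rho> x"
        using True by (intro mult_right_mono) auto
      also have "\<dots> = \<rho> x powr (1 - 1 / N)"
        using True by (simp add: powr_diff powr_minus divide_inverse)
      finally show ?thesis using True by (simp add: ennreal_mult[symmetric] ennreal_leI)
    next
      case False
      then have "x \<notin> L \<or> \<rho> x = 0" using \<rho>0[of x] by auto
      then show ?thesis by auto
    qed
  qed
  finally show ?thesis .
qed

section \<open>Density bounds along interpolations\<close>

text \<open>The integral bounds hold for every density of a decomposition, so whichever one
  \<open>SOME\<close> picks is covered once existence is known.\<close>

lemma renyi_entropy_ge:
  fixes m \<mu> :: "'a::topological_space measure"
  assumes m: "sigma_finite_measure m" "sets m = sets borel" and \<mu>: "\<mu> \<in> borel_probs"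
    and A: "A \<in> sets borel" "emeasure \<mu> (- A) = 0" "emeasure m A < \<infinity>" and N: "1 \<le> N"
  shows "- ereal (measure m A powr (1 / N)) \<le> renyi_entropy N m \<mu>"
proof -
  interpret prob_space \<mu> by (rule borel_probsD[OF \<mu>])
  have sp: "space \<mu> = UNIV" using sets_eq_imp_space_eq[OF borel_probsD(2)[OF \<mu>]] by simp
  have "\<exists>\<rho>. lebesgue_density m \<mu> \<rho>"
    using m borel_probsD(2)[OF \<mu>] finite_measure_axioms by (intro ex_lebesgue_density)
  then have "lebesgue_density m \<mu> (SOME \<rho>. lebesgue_density m \<mu> \<rho>)" by (rule someI_ex)
  from lebesgue_density_integral_upper[OF this m(2) _ A N]
  have "(\<integral>\<^sup>+x. ennreal ((SOME \<rho>. lebesgue_density m \<mu> \<rho>) x powr (1 - 1 / N)) \<partial>m)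
      \<le> ennreal (measure m A powr (1 / N))"
    using emeasure_space_1 sp by simp
  then have "enn2ereal (\<integral>\<^sup>+x. ennreal ((SOME \<rho>. lebesgue_density m \<mu> \<rho>) x powr (1 - 1 / N)) \<partial>m)
      \<le> ereal (measure m A powr (1 / N))"
    unfolding less_eq_ennreal.rep_eq by (simp add: enn2ereal_ennreal)
  then show ?thesis unfolding renyi_entropy_def Let_def by (simp only: ereal_minus_le_minus)
qed

lemma renyi_entropy_le:
  fixes m \<mu> :: "'a::topological_space measure"
  assumes m: "sigma_finite_measure m" "sets m = sets borel" and \<mu>: "\<mu> \<in> borel_probs"
    and c: "0 < c" "\<And>B. B \<in> sets borel \<Longrightarrow> emeasure \<mu> B \<le> ennreal c * emeasure m B" and N: "1 \<le> N"
  shows "renyi_entropy N m \<mu> \<le> - ereal (c powr (- (1 / N)))"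
proof -
  interpret prob_space \<mu> by (rule borel_probsD[OF \<mu>])
  have sp: "space \<mu> = UNIV" using sets_eq_imp_space_eq[OF borel_probsD(2)[OF \<mu>]] by simp
  have "\<exists>\<rho>. lebesgue_density m \<mu> \<rho>"
    using m borel_probsD(2)[OF \<mu>] finite_measure_axioms by (intro ex_lebesgue_density)
  then have "lebesgue_density m \<mu> (SOME \<rho>. lebesgue_density m \<mu> \<rho>)" by (rule someI_ex)
  from lebesgue_density_integral_lower[OF this m(2) _ borel_probsD(2)[OF \<mu>] c N]
  have "ennreal (c powr (- (1 / N)))
      \<le> (\<integral>\<^sup>+x. ennreal ((SOME \<rho>. lebesgue_density m \<mu> \<rho>) x powr (1 - 1 / N)) \<partial>m)"
    using emeasure_space_1 sp by simp
  then have "ereal (c powr (- (1 / N)))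
      \<le> enn2ereal (\<integral>\<^sup>+x. ennreal ((SOME \<rho>. lebesgue_density m \<mu> \<rho>) x powr (1 - 1 / N)) \<partial>m)"
    unfolding less_eq_ennreal.rep_eq by (simp add: enn2ereal_ennreal)
  then show ?thesis unfolding renyi_entropy_def Let_def by (simp only: ereal_minus_le_minus)
qed

lemma renyi_entropy_nonpos: "renyi_entropy N m \<mu> \<le> 0"
  unfolding renyi_entropy_def Let_def by simp

text \<open>For a monotone partition the distances telescope, and the partition consisting of
  \<open>a\<close> and \<open>b\<close> alone already attains the value.\<close>

lemma curve_length_geodesic:
  fixes \<gamma> :: "real \<Rightarrow> 'a::metric_space"
  assumes \<gamma>: "\<And>s t. s \<in> {0..1} \<Longrightarrow> t \<in> {0..1} \<Longrightarrow> dist (\<gamma> s) (\<gamma> t) = \<bar>s - t\<bar> * D"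
    and D: "0 \<le> D" and ab: "0 \<le> a" "a \<le> b" "b \<le> 1"
  shows "curve_length \<gamma> a b = ennreal ((b - a) * D)"
  unfolding curve_length_def
proof (rule antisym)
  show "(SUP (n, p)\<in>{(n::nat, p::nat \<Rightarrow> real). mono_on {..n} p \<and> p ` {..n} \<subseteq> {a..b}}.
      \<Sum>i<n. ennreal (dist (\<gamma> (p i)) (\<gamma> (p (Suc i))))) \<le> ennreal ((b - a) * D)"
  proof (rule SUP_least, clarify)
    fix n :: nat and p :: "nat \<Rightarrow> real" assume p: "mono_on {..n} p" "p ` {..n} \<subseteq> {a..b}"
    have mem: "p i \<in> {a..b}" if "i \<le> n" for i using p(2) that by auto
    have "dist (\<gamma> (p i)) (\<gamma> (p (Suc i))) = (p (Suc i) - p i) * D" if "i < n" for i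
    proof -
      have "p i \<in> {0..1}" "p (Suc i) \<in> {0..1}" using mem[of i] mem[of "Suc i"] that ab by auto
      moreover have "p i \<le> p (Suc i)" using mono_onD[OF p(1), of i "Suc i"] that by simp
      ultimately show ?thesis using \<gamma> by simp
    qed
    then have "(\<Sum>i<n. dist (\<gamma> (p i)) (\<gamma> (p (Suc i)))) = (\<Sum>i<n. (p (Suc i) - p i) * D)"
      by (intro sum.cong) auto
    then have "(\<Sum>i<n. ennreal (dist (\<gamma> (p i)) (\<gamma> (p (Suc i))))) = ennreal (\<Sum>i<n. (p (Suc i) - p i) * D)"
      by (subst sum_ennreal) auto
    also have "(\<Sum>i<n. (p (Suc i) - p i) * D) = (p n - p 0) * D"
      by (simp only: sum_distrib_right[symmetric] sum_lessThan_telescope)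
    also have "\<dots> \<le> (b - a) * D" using mem[of 0] mem[of n] D by (intro mult_right_mono) auto
    finally show "(\<Sum>i<n. ennreal (dist (\<gamma> (p i)) (\<gamma> (p (Suc i))))) \<le> ennreal ((b - a) * D)"
      by (simp add: ennreal_leI)
  qed
  define p where "p i = (if i = 0 then a else b)" for i :: nat
  have "mono_on {..Suc 0} p" using ab by (auto simp: p_def mono_on_def)
  moreover have "p ` {..Suc 0} \<subseteq> {a..b}" using ab by (auto simp: p_def)
  ultimately have "(Suc 0, p) \<in> {(n::nat, p::nat \<Rightarrow> real). mono_on {..n} p \<and> p ` {..n} \<subseteq> {a..b}}" by blast
  moreover have "ennreal ((b - a) * D)
      \<le> (case (Suc 0, p) of (n, p) \<Rightarrow> \<Sum>i<n. ennreal (dist (\<gamma> (p i)) (\<gamma> (p (Suc i)))))"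
    using \<gamma>[of a b] ab by (simp add: p_def)
  ultimately show "ennreal ((b - a) * D)
      \<le> (SUP (n, p)\<in>{(n::nat, p::nat \<Rightarrow> real). mono_on {..n} p \<and> p ` {..n} \<subseteq> {a..b}}.
      \<Sum>i<n. ennreal (dist (\<gamma> (p i)) (\<gamma> (p (Suc i)))))"
    by (rule SUP_upper2)
qed

lemma upper_gradient_geodesic:
  fixes \<gamma> :: "real \<Rightarrow> 'a::metric_space"
  assumes g: "upper_gradient u g"
    and \<gamma>: "\<And>s t. s \<in> {0..1} \<Longrightarrow> t \<in> {0..1} \<Longrightarrow> dist (\<gamma> s) (\<gamma> t) = \<bar>s - t\<bar> * D" and D: "0 \<le> D"
  shows "ennreal \<bar>u (\<gamma> 0) - u (\<gamma> 1)\<bar> \<le> ennreal D * (\<integral>\<^sup>+t\<in>{0..1}. g (\<gamma> t) \<partial>lborel)"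
proof -
  have len: "curve_length \<gamma> a b = ennreal ((b - a) * D)" if "0 \<le> a" "a \<le> b" "b \<le> 1" for a b
    using that by (intro curve_length_geodesic \<gamma> D)
  have "D-lipschitz_on {0..1} \<gamma>"
  proof (rule lipschitz_onI)
    show "dist (\<gamma> s) (\<gamma> t) \<le> D * dist s t" if "s \<in> {0..1}" "t \<in> {0..1}" for s t
      using \<gamma>[OF that] by (simp add: dist_real_def)
  qed (rule D)
  then have "continuous_on {0..1} \<gamma>" by (rule lipschitz_on_continuous_on)
  then have "constant_speed_curve \<gamma>"
    unfolding constant_speed_curve_def using D by (simp add: len ennreal_mult)
  moreover have "constant_speed_curve \<gamma> \<Longrightarrow> curve_length \<gamma> 0 1 < \<infinity> \<Longrightarrow>
      ennreal \<bar>u (\<gamma> 0) - u (\<gamma> 1)\<bar> \<le> curve_length \<gamma> 0 1 * (\<integral>\<^sup>+t\<in>{0..1}. g (\<gamma> t) \<partial>lborel)"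
    using g unfolding upper_gradient_def by blast
  ultimately show ?thesis using len[of 0 1] by simp
qed

lemma nn_integral_le_scaled:
  assumes "sets \<mu> = sets m" "\<And>B. B \<in> sets m \<Longrightarrow> emeasure \<mu> B \<le> c * emeasure m B"
    and "f \<in> borel_measurable m"
  shows "(\<integral>\<^sup>+x. f x \<partial>\<mu>) \<le> c * (\<integral>\<^sup>+x. f x \<partial>m)"
proof -
  have "(\<integral>\<^sup>+x. f x \<partial>\<mu>) \<le> (\<integral>\<^sup>+x. f x \<partial>scale_measure c m)"
    using assms by (intro nn_integral_mono_measure) (auto simp: le_measure)
  also have "\<dots> = c * (\<integral>\<^sup>+x. f x \<partial>m)" using assms(3) by (rule nn_integral_scale_measure)
  finally show ?thesis .
qed

text \<open>\<open>ball_finite\<close> expresses that averages over balls presuppose finite measure;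
  the positivity of balls follows from full support.\<close>

locale displacement_convex_space = dense_sequence q
  for q :: "nat \<Rightarrow> 'a::complete_space" +
  fixes m :: "'a measure" and N :: real
  assumes N: "1 \<le> N" and geodesic: "geodesic_space (UNIV :: 'a set)"
    and sets_m: "sets m = sets borel" and support_m: "measure_support m = UNIV"
    and ball_finite: "\<And>y \<delta>. emeasure m (ball y \<delta>) < \<infinity>"
    and convex: "strongly_displacement_convex (renyi_entropy N m)"
begin

lemma space_m: "space m = UNIV"
  using sets_eq_imp_space_eq[OF sets_m] by simp

lemma sigma_finite_m: "sigma_finite_measure m"
proof
  fix a :: 'a
  have "y \<in> (\<Union>n. ball a (real n))" for y
  proof -
    obtain n where "dist a y < real n" using reals_Archimedean2 by blast
    then show ?thesis by (intro UN_I[of n]) auto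
  qed
  then have "(\<Union>n. ball a (real n)) = UNIV" by blast
  moreover have nf: "emeasure m (ball a (real n)) \<noteq> \<infinity>" for n using ball_finite[of a "real n"] by simp
  ultimately show "\<exists>A. countable A \<and> A \<subseteq> sets m \<and> \<Union> A = space m \<and> (\<forall>a\<in>A. emeasure m a \<noteq> \<infinity>)"
    using sets_m nf by (intro exI[of _ "range (\<lambda>n. ball a (real n))"]) (auto simp: space_m)
qed

lemma ball_pos: "0 < r \<Longrightarrow> 0 < emeasure m (ball y r)"
  using support_m unfolding measure_support_def by (metis (mono_tags, lifting) UNIV_I centre_in_ball mem_Collect_eq open_ball)

text \<open>Conditioning the plan on passing through \<open>A\<close> at time \<open>t\<close> divides the densities of the endpoints by
  the mass \<open>p\<close> of that event, while the entropy at time \<open>t\<close> is controlled by the size of \<open>A\<close> alone.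
  The second alternative for \<open>\<kappa>\<close> allows a terminal measure without density bound.\<close>

lemma interpolation_density_bound:
  assumes opt: "optimal_plan \<sigma>"
    and geo: "geodesic_interpolation \<sigma> G"
    and t: "t \<in> {0..1}" and A: "A \<in> sets borel"
    and c0: "0 < c0" "\<And>B. B \<in> sets borel \<Longrightarrow> emeasure (distr \<sigma> borel fst) B \<le> ennreal c0 * emeasure m B"
    and \<kappa>: "(0 < c1 \<and> \<kappa> = c1 powr (- (1 / N)) \<and>
        (\<forall>B\<in>sets borel. emeasure (distr \<sigma> borel snd) B \<le> ennreal c1 * emeasure m B)) \<or> \<kappa> = 0"
    and K: "K = (1 - t) * c0 powr (- (1 / N)) + t * \<kappa>" "0 < K"
  shows "emeasure (distr \<sigma> borel (\<lambda>z. G z t)) A \<le> ennreal (K powr (- N)) * emeasure m A"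
proof -
  have \<sigma>: "\<sigma> \<in> borel_probs" using opt by (simp add: optimal_plan_def)
  interpret prob_space \<sigma> by (rule borel_probsD[OF \<sigma>])
  note s\<sigma> = borel_probsD(2)[OF \<sigma>]
  have sp: "space \<sigma> = UNIV" using sets_eq_imp_space_eq[OF s\<sigma>] by simp
  have G: "(\<lambda>z. G z t) \<in> borel_measurable borel" for t
    using geo unfolding geodesic_interpolation_def by blast
  define S where "S = (\<lambda>z. G z t) -` A"
  have S: "S \<in> sets borel" unfolding S_def using measurable_sets[OF G A] by simp
  have mG: "(\<lambda>z. G z t) \<in> borel_measurable \<sigma>" for t using G borel_measurable_borel_probs[OF \<sigma>] by blast
  have eS: "emeasure (distr \<sigma> borel (\<lambda>z. G z t)) A = emeasure \<sigma> S"
    using mG A sp by (simp add: emeasure_distr S_def)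
  define p where "p = measure \<sigma> S"
  have ep: "emeasure \<sigma> S = ennreal p" by (simp add: p_def emeasure_eq_measure)
  have N0: "0 < N" using N by simp
  show ?thesis
  proof (cases "p = 0 \<or> emeasure m A = \<infinity>")
    case True
    then show ?thesis using eS ep K(2) by (auto simp: ennreal_mult_top)
  next
    case False
    have p: "0 < p" using False measure_nonneg[of \<sigma> S] by (simp add: p_def order_less_le)
    have mA: "emeasure m A < \<infinity>" using False by (simp add: less_top[symmetric])
    define a where "a = measure m A"
    have ea: "emeasure m A = ennreal a" using False by (simp add: a_def emeasure_eq_ennreal_measure)
    define \<tau> where "\<tau> = uniform_measure \<sigma> S"
    have S0: "emeasure \<sigma> S \<noteq> 0" using ep p by simp
    have \<tau>: "optimal_plan \<tau>" unfolding \<tau>_def by (rule optimal_plan_restrict[OF opt S S0])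
    then have \<tau>b: "\<tau> \<in> borel_probs" by (simp add: optimal_plan_def)
    note s\<tau> = borel_probsD(2)[OF \<tau>b]
    have sp\<tau>: "space \<tau> = UNIV" using sets_eq_imp_space_eq[OF s\<tau>] by simp
    \<comment> \<open>The same curves serve for the conditioned plan, since null sets of
      \<open>\<sigma>\<close> are null sets of \<open>\<tau>\<close>.\<close>
    have "geodesic_interpolation \<tau> G"
      unfolding geodesic_interpolation_def \<tau>_def
    proof (intro conjI allI G)
      show "(\<lambda>(z, t). G z t) \<in> borel_measurable (borel \<Otimes>\<^sub>M borel)"
        using geo unfolding geodesic_interpolation_def by blast
      have "AE z in \<sigma>. G z 0 = fst z \<and> G z 1 = snd z \<and>
          (\<forall>s\<in>{0..1}. \<forall>t\<in>{0..1}. dist (G z s) (G z t) = \<bar>s - t\<bar> * dist (fst z) (snd z))"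
        using geo unfolding geodesic_interpolation_def by blast
      then show "AE z in uniform_measure \<sigma> S. G z 0 = fst z \<and> G z 1 = snd z \<and>
          (\<forall>s\<in>{0..1}. \<forall>t\<in>{0..1}. dist (G z s) (G z t) = \<bar>s - t\<bar> * dist (fst z) (snd z))"
        using S s\<sigma> by (intro AE_uniform_measureI) (auto elim!: eventually_mono simp del: AE_conj_iff)
    qed
    note geo\<tau> = optimal_plan_geodesic[OF dense_sequence_axioms \<tau> this]
    define \<Gamma> where "\<Gamma> t = distr \<tau> borel (\<lambda>z. G z t)" for t
    have \<Gamma>: "\<Gamma> \<in> W2_geodesics" "\<Gamma> 0 = distr \<tau> borel fst" "\<Gamma> 1 = distr \<tau> borel snd"
      unfolding \<Gamma>_def by (rule geo\<tau>)+
    have mG\<tau>: "(\<lambda>z. G z t) \<in> borel_measurable \<tau>" for t using G borel_measurable_borel_probs[OF \<tau>b] by blast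
    have \<Gamma>b: "\<Gamma> t \<in> borel_probs" for t
      unfolding \<Gamma>_def by (rule distr_in_borel_probs[OF borel_probsD(1)[OF \<tau>b] mG\<tau>])
    have marg: "emeasure (distr \<tau> borel h) B \<le> ennreal (c / p) * emeasure m B"
      if h: "h \<in> borel_measurable borel" and B: "B \<in> sets borel" and c: "0 < c"
        and le: "emeasure (distr \<sigma> borel h) B \<le> ennreal c * emeasure m B" for h :: "'a \<times> 'a \<Rightarrow> 'a" and B c
    proof -
      have hm: "h \<in> borel_measurable \<sigma>" "h \<in> borel_measurable \<tau>"
        using h borel_measurable_borel_probs[OF \<sigma>] borel_measurable_borel_probs[OF \<tau>b] by blast+
      have hB: "h -` B \<in> sets \<sigma>" using measurable_sets[OF h B] s\<sigma> by simp
      have "emeasure (distr \<tau> borel h) B = emeasure \<tau> (h -` B)" using hm B sp\<tau> by (simp add: emeasure_distr)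
      also have "\<dots> = emeasure \<sigma> (S \<inter> h -` B) / ennreal p"
        unfolding \<tau>_def using S s\<sigma> hB by (simp add: ep)
      also have "\<dots> \<le> emeasure \<sigma> (h -` B) / ennreal p"
        using hB by (intro divide_right_mono_ennreal emeasure_mono) auto
      also have "emeasure \<sigma> (h -` B) = emeasure (distr \<sigma> borel h) B" using hm B sp by (simp add: emeasure_distr)
      also have "\<dots> / ennreal p \<le> (ennreal c * emeasure m B) / ennreal p"
        using le by (rule divide_right_mono_ennreal)
      also have "\<dots> = (ennreal c / ennreal p) * emeasure m B"
        by (simp add: divide_ennreal_def ac_simps)
      also have "ennreal c / ennreal p = ennreal (c / p)" using c p by (simp add: divide_ennreal)
      finally show ?thesis .
    qed
    \<comment> \<open>The loss of \<open>1 / p\<close> in the density bounds reappears as the factor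
      \<open>p powr (1 / N)\<close> in both endpoint entropies; raising to the power
      \<open>N\<close> at the end makes the estimate linear in \<open>p\<close>.\<close>
    have pw: "(c / p) powr (- (1 / N)) = p powr (1 / N) * c powr (- (1 / N))" if "0 < c" for c
      using that p by (simp add: powr_divide powr_minus field_simps)
    have E0: "renyi_entropy N m (\<Gamma> 0) \<le> - ereal (p powr (1 / N) * c0 powr (- (1 / N)))"
      unfolding pw[OF c0(1), symmetric]
    proof (rule renyi_entropy_le[OF sigma_finite_m sets_m \<Gamma>b _ _ N])
      show "0 < c0 / p" using c0 p by simp
      show "emeasure (\<Gamma> 0) B \<le> ennreal (c0 / p) * emeasure m B" if "B \<in> sets borel" for B
        unfolding \<Gamma>(2) using c0 that by (intro marg borel_measurable_fst') auto
    qed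
    have E1: "renyi_entropy N m (\<Gamma> 1) \<le> - ereal (p powr (1 / N) * \<kappa>)"
      using \<kappa>
    proof (elim disjE conjE)
      assume c1: "0 < c1" "\<kappa> = c1 powr (- (1 / N))"
        "\<forall>B\<in>sets borel. emeasure (distr \<sigma> borel snd) B \<le> ennreal c1 * emeasure m B"
      show ?thesis unfolding c1(2) pw[OF c1(1), symmetric]
      proof (rule renyi_entropy_le[OF sigma_finite_m sets_m \<Gamma>b _ _ N])
        show "0 < c1 / p" using c1 p by simp
        show "emeasure (\<Gamma> 1) B \<le> ennreal (c1 / p) * emeasure m B" if "B \<in> sets borel" for B
          unfolding \<Gamma>(3) using c1 that by (intro marg borel_measurable_snd') auto
      qed
    next
      \<comment> \<open>Every entropy is at most \<open>0\<close>, so even a singular target, such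
        as a point mass, contributes a usable bound.\<close>
      assume "\<kappa> = 0"
      then show ?thesis using renyi_entropy_nonpos[of N m "\<Gamma> 1"] by (simp add: zero_ereal_def)
    qed
    have "emeasure (\<Gamma> t) (- A) = 0"
    proof -
      have "- A \<in> sets borel" using A by simp
      then have "emeasure (\<Gamma> t) (- A) = emeasure \<tau> (- S)"
        unfolding \<Gamma>_def using mG\<tau> sp\<tau> by (simp add: emeasure_distr S_def vimage_Compl)
      also have "\<dots> = emeasure \<sigma> (S \<inter> - S) / emeasure \<sigma> S"
        unfolding \<tau>_def using S s\<sigma> by (intro emeasure_uniform_measure) auto
      finally show ?thesis by simp
    qed
    from renyi_entropy_ge[OF sigma_finite_m sets_m \<Gamma>b A this mA N]
    have "- ereal (a powr (1 / N)) \<le> renyi_entropy N m (\<Gamma> t)" by (simp add: a_def)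
    also have "\<dots> \<le> ereal (1 - t) * renyi_entropy N m (\<Gamma> 0) + ereal t * renyi_entropy N m (\<Gamma> 1)"
      using convex \<Gamma>(1) t unfolding strongly_displacement_convex_def by blast
    also have "\<dots> \<le> ereal (1 - t) * (- ereal (p powr (1 / N) * c0 powr (- (1 / N)))) + ereal t * (- ereal (p powr (1 / N) * \<kappa>))"
      using E0 E1 t by (intro add_mono ereal_mult_left_mono) auto
    also have "\<dots> = ereal (- (p powr (1 / N) * K))" unfolding K(1) by (simp add: algebra_simps)
    finally have "p powr (1 / N) * K \<le> a powr (1 / N)" by simp
    then have "(p powr (1 / N) * K) powr N \<le> (a powr (1 / N)) powr N"
      using K(2) p N0 by (intro powr_mono2) auto
    then have "p * K powr N \<le> a"
      using p K(2) N0 by (simp add: powr_mult powr_powr a_def)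
    then have "p \<le> K powr (- N) * a"
      using K(2) by (simp add: powr_minus field_simps)
    then show ?thesis unfolding eS ep ea
      by (simp add: ennreal_mult[symmetric] a_def ennreal_leI)
  qed
qed

section \<open>Uniform measures on parts of balls, doubling, and the transport inequality\<close>

lemma ball_sets: "ball y \<delta> \<in> sets m"
  by (simp add: sets_m)

lemma uniform_ball_subset:
  assumes S: "S \<in> sets borel" "S \<subseteq> ball y \<delta>" "emeasure m S \<noteq> 0"
  shows "emeasure m S \<noteq> \<infinity>" "uniform_measure m S \<in> borel_probs" "0 < measure m S"
    and "emeasure m S = ennreal (measure m S)"
    and "\<And>B. B \<in> sets borel \<Longrightarrow> emeasure (uniform_measure m S) B \<le> ennreal (1 / measure m S) * emeasure m B"
    and "AE x in uniform_measure m S. x \<in> S"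
proof -
  have "emeasure m S \<le> emeasure m (ball y \<delta>)" using S ball_sets by (intro emeasure_mono) auto
  then show f: "emeasure m S \<noteq> \<infinity>" using ball_finite[of y \<delta>] by (auto simp: top_unique)
  show e: "emeasure m S = ennreal (measure m S)" using f by (simp add: emeasure_eq_ennreal_measure)
  show pos: "0 < measure m S" using S(3) unfolding e by (simp add: less_le)
  have "prob_space (uniform_measure m S)" using S f by (intro prob_space_uniform_measure)
  then show "uniform_measure m S \<in> borel_probs" by (simp add: borel_probs_def sets_m)
  show "emeasure (uniform_measure m S) B \<le> ennreal (1 / measure m S) * emeasure m B" if B: "B \<in> sets borel" for B
  proof -
    have "emeasure (uniform_measure m S) B = emeasure m (S \<inter> B) / ennreal (measure m S)"
      using S B by (simp add: sets_m e)
    also have "\<dots> \<le> emeasure m B / ennreal (measure m S)"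
      using B by (intro divide_right_mono_ennreal emeasure_mono) (auto simp: sets_m)
    also have "\<dots> = ennreal (1 / measure m S) * emeasure m B"
      using inverse_ennreal[OF pos] by (simp add: divide_ennreal_def inverse_eq_divide mult.commute)
    finally show ?thesis .
  qed
  show "AE x in uniform_measure m S. x \<in> S" using S by (intro AE_uniform_measureI) (auto simp: sets_m)
qed

text \<open>The uniform measure of the large ball is contracted to the centre; the only coupling with a point
  mass is the product, so no optimality has to be produced.\<close>

lemma doubling:
  assumes r: "0 < r"
  shows "measure m (ball x (2 * r)) \<le> 2 powr N * measure m (ball x r)"
proof -
  define B where "B = ball x (2 * r)"
  have B: "B \<in> sets borel" "B \<subseteq> ball x (2 * r)" "emeasure m B \<noteq> 0"
    using ball_pos[of "2 * r" x] r by (auto simp: B_def)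
  note U = uniform_ball_subset[OF B]
  define \<mu> where "\<mu> = uniform_measure m B"
  have \<mu>: "\<mu> \<in> borel_probs" unfolding \<mu>_def by (rule U)
  define T where "T y = (y, x)" for y :: 'a
  have mT: "T \<in> borel_measurable \<mu>"
    unfolding borel_measurable_borel_probs[OF \<mu>] T_def
    by (intro borel_measurable_continuous_onI continuous_intros)
  define \<sigma> where "\<sigma> = distr \<mu> borel T"
  have \<sigma>: "\<sigma> \<in> borel_probs" unfolding \<sigma>_def by (rule distr_in_borel_probs[OF borel_probsD(1)[OF \<mu>] mT])
  have fst\<sigma>: "distr \<sigma> borel fst = \<mu>"
  proof -
    have "distr \<sigma> borel fst = distr \<mu> borel (\<lambda>y. y)"
      unfolding \<sigma>_def distr_distr[OF borel_measurable_fst' mT] by (simp add: T_def comp_def)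
    also have "\<dots> = \<mu>" by (rule distr_id2) (simp add: borel_probsD(2)[OF \<mu>])
    finally show ?thesis .
  qed
  have snd\<sigma>: "distr \<sigma> borel snd = distr \<mu> borel (\<lambda>y. x)"
    unfolding \<sigma>_def distr_distr[OF borel_measurable_snd' mT] by (simp add: T_def comp_def)
  have md: "(\<lambda>y. ennreal ((dist y x)\<^sup>2)) \<in> borel_measurable borel"
    by (intro borel_measurable_continuous_onI continuous_on_ennreal continuous_intros)
  \<comment> \<open>The second marginal forces \<open>snd z = x\<close> almost everywhere, so the
    cost depends on the first marginal alone and all couplings are equally good.\<close>
  have cost: "transport_cost \<tau> = (\<integral>\<^sup>+y. ennreal ((dist y x)\<^sup>2) \<partial>\<mu>)"
    if \<tau>: "\<tau> \<in> borel_probs" "distr \<tau> borel fst = \<mu>" "distr \<tau> borel snd = distr \<mu> borel (\<lambda>y. x)" for \<tau>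
  proof -
    have m1: "fst \<in> borel_measurable \<tau>" and m2: "snd \<in> borel_measurable \<tau>"
      unfolding borel_measurable_borel_probs[OF \<tau>(1)] by (rule borel_measurable_fst' borel_measurable_snd')+
    have "AE y in distr \<mu> borel (\<lambda>y. x). y = x"
      by (subst AE_distr_iff) (auto simp: borel_measurable_const)
    then have "AE z in \<tau>. snd z = x" unfolding \<tau>(3)[symmetric]
      by (subst (asm) AE_distr_iff[OF m2]) auto
    then have "transport_cost \<tau> = (\<integral>\<^sup>+z. ennreal ((dist (fst z) x)\<^sup>2) \<partial>\<tau>)"
      unfolding transport_cost_def by (intro nn_integral_cong_AE) (auto elim!: eventually_mono)
    also have "\<dots> = (\<integral>\<^sup>+y. ennreal ((dist y x)\<^sup>2) \<partial>distr \<tau> borel fst)"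
      by (rule nn_integral_distr[OF m1, symmetric]) (use md in simp)
    finally show ?thesis unfolding \<tau>(2) .
  qed
  have "optimal_plan \<sigma>"
    unfolding optimal_plan_def
  proof (intro conjI ballI \<sigma>)
    interpret prob_space \<mu> by (rule borel_probsD[OF \<mu>])
    have "(\<integral>\<^sup>+y. ennreal ((dist y x)\<^sup>2) \<partial>\<mu>) \<le> (\<integral>\<^sup>+y. ennreal ((2 * r)\<^sup>2) \<partial>\<mu>)"
    proof (rule nn_integral_mono_AE)
      show "AE y in \<mu>. ennreal ((dist y x)\<^sup>2) \<le> ennreal ((2 * r)\<^sup>2)"
        using U(6) unfolding \<mu>_def
      proof eventually_elim
        fix y assume "y \<in> B"
        then have "dist y x \<le> 2 * r" by (simp add: B_def dist_commute)
        then show "ennreal ((dist y x)\<^sup>2) \<le> ennreal ((2 * r)\<^sup>2)" by (intro ennreal_leI power_mono) auto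
      qed
    qed
    also have "\<dots> < \<infinity>" by (simp add: emeasure_space_1)
    finally show "transport_cost \<sigma> < \<infinity>" using cost[OF \<sigma> fst\<sigma> snd\<sigma>] by simp
    show "transport_cost \<sigma> \<le> transport_cost \<sigma>'"
      if "\<sigma>' \<in> couplings (distr \<sigma> borel fst) (distr \<sigma> borel snd)" for \<sigma>'
      using that cost[OF \<sigma> fst\<sigma> snd\<sigma>] cost[of \<sigma>'] by (simp add: couplings_def fst\<sigma> snd\<sigma>)
  qed
  have fm: "finite_measure \<sigma>" using prob_space.finite_measure[OF borel_probsD(1)[OF \<sigma>]] .
  obtain G where G: "geodesic_interpolation \<sigma> G"
    by (rule geodesic_selection[OF geodesic dense_sequence_axioms borel_probsD(2)[OF \<sigma>] fm])
  then have aeG: "AE z in \<sigma>. G z 0 = fst z \<and> G z 1 = snd z \<and>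
      (\<forall>s\<in>{0..1}. \<forall>t\<in>{0..1}. dist (G z s) (G z t) = \<bar>s - t\<bar> * dist (fst z) (snd z))"
    unfolding geodesic_interpolation_def by blast
  define c where "c = 1 / measure m B"
  have c: "0 < c" using U(3) by (simp add: c_def)
  \<comment> \<open>The value of the convex combination at time \<open>1/2\<close> with nothing
    contributed by the target; it gives \<open>K powr (- N) = 2 powr N * c\<close>.\<close>
  define K where "K = (1/2) * c powr (- (1 / N))"
  have K: "K = (1 - 1/2) * c powr (- (1 / N)) + 1/2 * 0" "0 < K" using c by (simp_all add: K_def)
  have half: "(1/2::real) \<in> {0..1}" by simp
  have bs: "ball x r \<in> sets borel" by simp
  have le: "emeasure (distr \<sigma> borel fst) V \<le> ennreal c * emeasure m V" if "V \<in> sets borel" for V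
    unfolding fst\<sigma> \<mu>_def c_def by (rule U(5)[OF that])
  have bound: "emeasure (distr \<sigma> borel (\<lambda>z. G z (1/2))) (ball x r) \<le> ennreal (K powr (- N)) * emeasure m (ball x r)"
    by (rule interpolation_density_bound[OF \<open>optimal_plan \<sigma>\<close> G half bs c le disjI2[OF refl] K])
  have mG: "(\<lambda>z. G z t) \<in> borel_measurable \<sigma>" for t
    using G borel_measurable_borel_probs[OF \<sigma>] unfolding geodesic_interpolation_def by blast
  interpret \<Gamma>: prob_space "distr \<sigma> borel (\<lambda>z. G z (1/2))"
    by (rule prob_space.prob_space_distr[OF borel_probsD(1)[OF \<sigma>] mG])
  \<comment> \<open>Midpoints of curves from the large ball to \<open>x\<close> lie within
    \<open>r\<close> of \<open>x\<close>. The small ball thus carries all the mass at time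
    \<open>1/2\<close>, and its density bound gives
    \<open>1 \<le> 2 powr N * c * measure m (ball x r)\<close>.\<close>
  have "AE z in \<sigma>. G z (1/2) \<in> ball x r"
  proof -
    have "AE z in \<sigma>. fst z \<in> B \<and> snd z = x"
    proof -
      have "{z :: 'a \<times> 'a. fst z \<in> B \<and> snd z = x} \<in> sets borel"
      proof -
        have "fst -` B \<inter> snd -` {x} \<in> sets (borel :: ('a \<times> 'a) measure)"
          using measurable_sets[OF borel_measurable_fst' B(1)] measurable_sets[OF borel_measurable_snd', of "{x}"] by auto
        then show ?thesis by (simp add: vimage_def Int_def)
      qed
      moreover have "AE y in \<mu>. y \<in> B" unfolding \<mu>_def by (rule U(6))
      ultimately show ?thesis unfolding \<sigma>_def by (subst AE_distr_iff[OF mT]) (simp_all add: T_def)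
    qed
    then show ?thesis using aeG
    proof eventually_elim
      fix z assume z: "fst z \<in> B \<and> snd z = x" and geo: "G z 0 = fst z \<and> G z 1 = snd z \<and>
        (\<forall>s\<in>{0..1}. \<forall>t\<in>{0..1}. dist (G z s) (G z t) = \<bar>s - t\<bar> * dist (fst z) (snd z))"
      have "dist (G z (1/2)) (G z 1) = \<bar>1/2 - 1\<bar> * dist (fst z) (snd z)"
        using geo half by (meson atLeastAtMost_iff order_refl zero_le_one)
      moreover have "G z 1 = x" using geo z by simp
      ultimately have "dist (G z (1/2)) x = 1/2 * dist (fst z) x" using z by simp
      then show "G z (1/2) \<in> ball x r" using z by (simp add: B_def dist_commute)
    qed
  qed
  then have "AE y in distr \<sigma> borel (\<lambda>z. G z (1/2)). y \<in> ball x r"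
    by (subst AE_distr_iff[OF mG]) (simp_all del: mem_ball)
  then have "emeasure (distr \<sigma> borel (\<lambda>z. G z (1/2))) (ball x r) = 1"
    by (intro \<Gamma>.emeasure_eq_1_AE) simp_all
  then have "1 \<le> ennreal (K powr (- N)) * ennreal (measure m (ball x r))"
    using bound ball_finite[of x r] by (simp add: emeasure_eq_ennreal_measure less_top)
  then have "1 \<le> K powr (- N) * measure m (ball x r)"
    by (simp add: ennreal_mult[symmetric] flip: ennreal_1)
  moreover have "K powr (- N) = 2 powr N * c"
  proof -
    have "K powr (- N) = (1/2) powr (- N) * (c powr (- (1 / N))) powr (- N)"
      unfolding K_def by (rule powr_mult)
    also have "(1/2::real) powr (- N) = 2 powr N" by (simp add: powr_minus powr_divide)
    also have "(c powr (- (1 / N))) powr (- N) = c" using c N by (simp add: powr_powr)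
    finally show ?thesis .
  qed
  ultimately show ?thesis using U(3) unfolding c_def B_def by (simp add: field_simps)
qed

text \<open>The product coupling has finite cost because both sets lie in one ball, so an optimal
  plan exists. The upper gradient bound along its geodesics, of length at most \<open>2 * r\<close>,
  is integrated over the plan. Fubini's theorem moves time outside, and at each time the density
  bound \<open>c\<close> replaces the interpolated measure by \<open>m\<close> on the doubled
  ball.\<close>

lemma transport_inequality:
  assumes S0: "S0 \<in> sets borel" "S0 \<subseteq> ball x r" "emeasure m S0 \<noteq> 0"
    and S1: "S1 \<in> sets borel" "S1 \<subseteq> ball x r" "emeasure m S1 \<noteq> 0"
    and c: "1 / measure m S0 \<le> c" "1 / measure m S1 \<le> c"
    and u: "continuous_on UNIV u" and g: "upper_gradient u g" and r: "0 < r"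
  obtains \<rho> where "\<rho> \<in> couplings (uniform_measure m S0) (uniform_measure m S1)"
    "(\<integral>\<^sup>+z. ennreal \<bar>u (fst z) - u (snd z)\<bar> \<partial>\<rho>) \<le> ennreal (2 * r * c) * (\<integral>\<^sup>+y\<in>ball x (2 * r). g y \<partial>m)"
proof -
  note U0 = uniform_ball_subset[OF S0] and U1 = uniform_ball_subset[OF S1]
  define \<mu>0 where "\<mu>0 = uniform_measure m S0"
  define \<mu>1 where "\<mu>1 = uniform_measure m S1"
  have \<mu>0: "\<mu>0 \<in> borel_probs" and \<mu>1: "\<mu>1 \<in> borel_probs" unfolding \<mu>0_def \<mu>1_def by (rule U0(2) U1(2))+
  have ae0: "AE y in \<mu>0. y \<in> S0" and ae1: "AE y in \<mu>1. y \<in> S1" unfolding \<mu>0_def \<mu>1_def by (rule U0(6) U1(6))+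
  interpret M0: prob_space \<mu>0 by (rule borel_probsD[OF \<mu>0])
  interpret M1: prob_space \<mu>1 by (rule borel_probsD[OF \<mu>1])
  interpret M01: pair_prob_space \<mu>0 \<mu>1 ..
  have sp01: "space \<mu>0 = UNIV" "space \<mu>1 = UNIV"
    using sets_eq_imp_space_eq[OF borel_probsD(2)[OF \<mu>0]] sets_eq_imp_space_eq[OF borel_probsD(2)[OF \<mu>1]] by simp_all
  have mf: "fst \<in> borel_measurable (\<mu>0 \<Otimes>\<^sub>M \<mu>1)"
    using measurable_fst[of \<mu>0 \<mu>1] measurable_cong_sets[OF refl borel_probsD(2)[OF \<mu>0]] by blast
  have ms: "snd \<in> borel_measurable (\<mu>0 \<Otimes>\<^sub>M \<mu>1)"
    using measurable_snd[of \<mu>0 \<mu>1] measurable_cong_sets[OF refl borel_probsD(2)[OF \<mu>1]] by blast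
  \<comment> \<open>The identity passes from the product sigma algebra to the Borel sets of the
    product type, on which couplings are defined; this is where separability enters.\<close>
  have mid: "(\<lambda>z. z) \<in> borel_measurable (\<mu>0 \<Otimes>\<^sub>M \<mu>1)"
    using borel_measurable_Pair'[OF mf ms] by simp
  define \<pi> where "\<pi> = distr (\<mu>0 \<Otimes>\<^sub>M \<mu>1) borel (\<lambda>z. z)"
  have "\<pi> \<in> couplings \<mu>0 \<mu>1"
    unfolding couplings_def
  proof (intro CollectI conjI)
    show "\<pi> \<in> borel_probs" unfolding \<pi>_def by (rule distr_in_borel_probs[OF M01.prob_space_axioms mid])
    have "distr \<pi> borel fst = distr (\<mu>0 \<Otimes>\<^sub>M \<mu>1) borel fst" "distr \<pi> borel snd = distr (\<mu>0 \<Otimes>\<^sub>M \<mu>1) borel snd"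
      unfolding \<pi>_def distr_distr[OF borel_measurable_fst' mid] distr_distr[OF borel_measurable_snd' mid]
      by (simp_all add: comp_def)
    moreover have "distr (\<mu>0 \<Otimes>\<^sub>M \<mu>1) borel fst = \<mu>0"
    proof (rule measure_eqI)
      fix V assume "V \<in> sets (distr (\<mu>0 \<Otimes>\<^sub>M \<mu>1) borel fst)"
      then have V: "V \<in> sets borel" by simp
      have "fst -` V = V \<times> (UNIV :: 'a set)" by auto
      then show "emeasure (distr (\<mu>0 \<Otimes>\<^sub>M \<mu>1) borel fst) V = emeasure \<mu>0 V"
        using V mf M1.emeasure_space_1 borel_probsD(2)[OF \<mu>0] sp01
        by (simp add: emeasure_distr space_pair_measure M1.emeasure_pair_measure_Times sets.top[of \<mu>1, simplified sp01])
    qed (simp add: borel_probsD(2)[OF \<mu>0])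
    moreover have "distr (\<mu>0 \<Otimes>\<^sub>M \<mu>1) borel snd = \<mu>1"
    proof (rule measure_eqI)
      fix V assume "V \<in> sets (distr (\<mu>0 \<Otimes>\<^sub>M \<mu>1) borel snd)"
      then have V: "V \<in> sets borel" by simp
      have "snd -` V = (UNIV :: 'a set) \<times> V" by auto
      then show "emeasure (distr (\<mu>0 \<Otimes>\<^sub>M \<mu>1) borel snd) V = emeasure \<mu>1 V"
        using V ms M0.emeasure_space_1 borel_probsD(2)[OF \<mu>1] sp01
        by (simp add: emeasure_distr space_pair_measure M1.emeasure_pair_measure_Times sets.top[of \<mu>0, simplified sp01])
    qed (simp add: borel_probsD(2)[OF \<mu>1])
    ultimately show "distr \<pi> borel fst = \<mu>0" "distr \<pi> borel snd = \<mu>1" by simp_all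
  qed
  moreover have "transport_cost \<pi> < \<infinity>"
  proof -
    have md: "(\<lambda>z. ennreal ((dist (fst z) (snd z))\<^sup>2)) \<in> borel_measurable (\<mu>0 \<Otimes>\<^sub>M \<mu>1)"
      using measurable_compose[OF mid measurable_dist_sq] by simp
    have "transport_cost \<pi> = (\<integral>\<^sup>+z. ennreal ((dist (fst z) (snd z))\<^sup>2) \<partial>(\<mu>0 \<Otimes>\<^sub>M \<mu>1))"
      unfolding transport_cost_def \<pi>_def by (rule nn_integral_distr[OF mid]) (use measurable_dist_sq in simp)
    also have "\<dots> = (\<integral>\<^sup>+a. \<integral>\<^sup>+b. ennreal ((dist a b)\<^sup>2) \<partial>\<mu>1 \<partial>\<mu>0)"
      using M1.nn_integral_fst[OF md] by simp
    also have "\<dots> \<le> (\<integral>\<^sup>+a. ennreal ((2 * r)\<^sup>2) \<partial>\<mu>0)"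
    proof (rule nn_integral_mono_AE, use ae0 in eventually_elim)
      fix a assume a: "a \<in> S0"
      have "(\<integral>\<^sup>+b. ennreal ((dist a b)\<^sup>2) \<partial>\<mu>1) \<le> (\<integral>\<^sup>+b. ennreal ((2 * r)\<^sup>2) \<partial>\<mu>1)"
      proof (rule nn_integral_mono_AE, use ae1 in eventually_elim)
        fix b assume "b \<in> S1"
        then have "dist x a < r" "dist x b < r" using a S0(2) S1(2) by auto
        then have "dist a b \<le> 2 * r" using dist_triangle3[of a b x] by simp
        then show "ennreal ((dist a b)\<^sup>2) \<le> ennreal ((2 * r)\<^sup>2)" by (intro ennreal_leI power_mono) auto
      qed
      then show "(\<integral>\<^sup>+b. ennreal ((dist a b)\<^sup>2) \<partial>\<mu>1) \<le> ennreal ((2 * r)\<^sup>2)"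
        by (simp add: M1.emeasure_space_1)
    qed
    also have "\<dots> < \<infinity>" by (simp add: M0.emeasure_space_1)
    finally show ?thesis .
  qed
  ultimately obtain \<rho> where \<rho>c: "\<rho> \<in> couplings \<mu>0 \<mu>1" and opt: "optimal_plan \<rho>"
    using ex_optimal_plan[OF dense_sequence_axioms] by blast
  have \<rho>: "\<rho> \<in> borel_probs" and fst\<rho>: "distr \<rho> borel fst = \<mu>0" and snd\<rho>: "distr \<rho> borel snd = \<mu>1"
    using \<rho>c by (auto simp: couplings_def)
  interpret R: prob_space \<rho> by (rule borel_probsD[OF \<rho>])
  have mfst: "fst \<in> borel_measurable \<rho>" and msnd: "snd \<in> borel_measurable \<rho>"
    unfolding borel_measurable_borel_probs[OF \<rho>] by (rule borel_measurable_fst' borel_measurable_snd')+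
  have aef: "AE z in \<rho>. fst z \<in> S0"
    using ae0 S0(1) unfolding fst\<rho>[symmetric] by (subst (asm) AE_distr_iff[OF mfst]) auto
  have aes: "AE z in \<rho>. snd z \<in> S1"
    using ae1 S1(1) unfolding snd\<rho>[symmetric] by (subst (asm) AE_distr_iff[OF msnd]) auto
  obtain G where G: "geodesic_interpolation \<rho> G"
    by (rule geodesic_selection[OF geodesic dense_sequence_axioms borel_probsD(2)[OF \<rho>] R.finite_measure_axioms])
  then have aeG: "AE z in \<rho>. G z 0 = fst z \<and> G z 1 = snd z \<and>
      (\<forall>s\<in>{0..1}. \<forall>t\<in>{0..1}. dist (G z s) (G z t) = \<bar>s - t\<bar> * dist (fst z) (snd z))"
    unfolding geodesic_interpolation_def by blast
  have mG: "(\<lambda>z. G z t) \<in> borel_measurable \<rho>" for t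
    using G borel_measurable_borel_probs[OF \<rho>] unfolding geodesic_interpolation_def by blast
  have c0: "0 < c" using c(1) U0(3) by (meson less_le_trans zero_less_divide_1_iff)
  have le0: "emeasure (distr \<rho> borel fst) V \<le> ennreal c * emeasure m V" if "V \<in> sets borel" for V
  proof -
    have "emeasure (distr \<rho> borel fst) V \<le> ennreal (1 / measure m S0) * emeasure m V"
      unfolding fst\<rho> \<mu>0_def by (rule U0(5)[OF that])
    also have "\<dots> \<le> ennreal c * emeasure m V" using c(1) by (intro mult_right_mono ennreal_leI) auto
    finally show ?thesis .
  qed
  have le1: "emeasure (distr \<rho> borel snd) V \<le> ennreal c * emeasure m V" if "V \<in> sets borel" for V
  proof -
    have "emeasure (distr \<rho> borel snd) V \<le> ennreal (1 / measure m S1) * emeasure m V"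
      unfolding snd\<rho> \<mu>1_def by (rule U1(5)[OF that])
    also have "\<dots> \<le> ennreal c * emeasure m V" using c(2) by (intro mult_right_mono ennreal_leI) auto
    finally show ?thesis .
  qed
  define \<Gamma> where "\<Gamma> t = distr \<rho> borel (\<lambda>z. G z t)" for t
  have density: "emeasure (\<Gamma> t) V \<le> ennreal c * emeasure m V" if t: "t \<in> {0..1}" and V: "V \<in> sets borel" for t V
  proof -
    \<comment> \<open>With the same bound \<open>c\<close> at both ends the convex combination does
      not depend on \<open>t\<close>, and \<open>K powr (- N)\<close> is \<open>c\<close>
      again.\<close>
    define K where "K = c powr (- (1 / N))"
    have K: "K = (1 - t) * c powr (- (1 / N)) + t * c powr (- (1 / N))" "0 < K"
      using c0 by (simp_all add: K_def algebra_simps)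
    have "emeasure (\<Gamma> t) V \<le> ennreal (K powr (- N)) * emeasure m V"
      unfolding \<Gamma>_def
      by (rule interpolation_density_bound[OF opt G t V c0 le0 disjI1 K]) (use c0 le1 in auto)
    also have "K powr (- N) = c" using c0 N by (simp add: K_def powr_powr)
    finally show ?thesis .
  qed
  have mg: "g \<in> borel_measurable borel" using g by (simp add: upper_gradient_def)
  have mgi: "(\<lambda>y. g y * indicator (ball x (2 * r)) y) \<in> borel_measurable borel"
  proof -
    have "(indicator (ball x (2 * r)) :: 'a \<Rightarrow> ennreal) \<in> borel_measurable borel"
      by (rule borel_measurable_indicator) simp
    from borel_measurable_times_ennreal[OF mg this] show ?thesis .
  qed
  have mgm: "(\<lambda>y. g y * indicator (ball x (2 * r)) y) \<in> borel_measurable m"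
    using mgi sets_m by (simp cong: measurable_cong_sets)
  define I where "I = (\<integral>\<^sup>+y\<in>ball x (2 * r). g y \<partial>m)"
  have inner: "(\<integral>\<^sup>+z. g (G z t) \<partial>\<rho>) \<le> ennreal c * I" if t: "t \<in> {0..1}" for t
  proof -
    have "AE z in \<rho>. G z t \<in> ball x (2 * r)"
      using aef aes aeG
    proof eventually_elim
      fix z assume z: "fst z \<in> S0" "snd z \<in> S1" and geo: "G z 0 = fst z \<and> G z 1 = snd z \<and>
        (\<forall>s\<in>{0..1}. \<forall>t\<in>{0..1}. dist (G z s) (G z t) = \<bar>s - t\<bar> * dist (fst z) (snd z))"
      have d0: "dist x (fst z) < r" and d1: "dist x (snd z) < r" using z S0(2) S1(2) by auto
      have d: "dist (fst z) (snd z) < 2 * r" using d0 d1 dist_triangle3[of "fst z" "snd z" x] by simp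
      have g: "G z 0 = fst z" "G z 1 = snd z"
        "\<And>s. s \<in> {0..1} \<Longrightarrow> dist (G z s) (G z t) = \<bar>s - t\<bar> * dist (fst z) (snd z)"
        using geo t by blast+
      have a: "dist (fst z) (G z t) = t * dist (fst z) (snd z)" using g(3)[of 0] t unfolding g(1) by simp
      have b: "dist (snd z) (G z t) = (1 - t) * dist (fst z) (snd z)" using g(3)[of 1] t unfolding g(2) by simp
      \<comment> \<open>A point of the curve is within half its length, hence within
        \<open>r\<close>, of the nearer endpoint, which itself lies within \<open>r\<close> of
        \<open>x\<close>.\<close>
      show "G z t \<in> ball x (2 * r)"
      proof (cases "t \<le> 1/2")
        case True
        then have "t * dist (fst z) (snd z) \<le> 1/2 * dist (fst z) (snd z)" by (intro mult_right_mono) auto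
        then show ?thesis using a d d0 dist_triangle[of x "G z t" "fst z"] by simp
      next
        case False
        then have "(1 - t) * dist (fst z) (snd z) \<le> 1/2 * dist (fst z) (snd z)" by (intro mult_right_mono) auto
        then show ?thesis using b d d1 dist_triangle[of x "G z t" "snd z"] by simp
      qed
    qed
    then have "(\<integral>\<^sup>+z. g (G z t) \<partial>\<rho>) = (\<integral>\<^sup>+z. g (G z t) * indicator (ball x (2 * r)) (G z t) \<partial>\<rho>)"
      by (intro nn_integral_cong_AE) (auto elim!: eventually_mono)
    also have "\<dots> = (\<integral>\<^sup>+y. g y * indicator (ball x (2 * r)) y \<partial>\<Gamma> t)"
      unfolding \<Gamma>_def by (rule nn_integral_distr[OF mG, symmetric]) (use mgi in simp)
    also have "\<dots> \<le> ennreal c * I"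
      unfolding I_def using density[OF t] by (intro nn_integral_le_scaled mgm) (auto simp: \<Gamma>_def sets_m)
    finally show ?thesis .
  qed
  have mgG: "(\<lambda>(z, t). g (G z t) * indicator {0..1} t) \<in> borel_measurable (\<rho> \<Otimes>\<^sub>M lborel)"
  proof -
    have sb: "sets (\<rho> \<Otimes>\<^sub>M lborel) = sets (borel \<Otimes>\<^sub>M (borel :: real measure))"
      using borel_probsD(2)[OF \<rho>] by (intro sets_pair_measure_cong) simp_all
    have "(\<lambda>(z, t). G z t) \<in> borel_measurable (borel \<Otimes>\<^sub>M borel)"
      using G unfolding geodesic_interpolation_def by blast
    from measurable_compose[OF this mg]
    have "(\<lambda>p. g (case p of (z, t) \<Rightarrow> G z t)) \<in> borel_measurable (borel \<Otimes>\<^sub>M borel)" .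
    moreover have "(\<lambda>p. indicator {0..1::real} (snd p) :: ennreal) \<in> borel_measurable (borel \<Otimes>\<^sub>M borel)"
      by (rule measurable_compose[OF measurable_snd]) simp
    ultimately have "(\<lambda>p. g (case p of (z, t) \<Rightarrow> G z t) * indicator {0..1::real} (snd p)) \<in> borel_measurable (borel \<Otimes>\<^sub>M borel)"
      by (rule borel_measurable_times_ennreal)
    then show ?thesis unfolding measurable_cong_sets[OF sb refl] by (simp add: case_prod_beta)
  qed
  interpret P: pair_sigma_finite \<rho> lborel ..
  have "(\<integral>\<^sup>+z. ennreal \<bar>u (fst z) - u (snd z)\<bar> \<partial>\<rho>)
      \<le> (\<integral>\<^sup>+z. ennreal (2 * r) * (\<integral>\<^sup>+t. g (G z t) * indicator {0..1} t \<partial>lborel) \<partial>\<rho>)"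
  proof (rule nn_integral_mono_AE)
    show "AE z in \<rho>. ennreal \<bar>u (fst z) - u (snd z)\<bar>
        \<le> ennreal (2 * r) * (\<integral>\<^sup>+t. g (G z t) * indicator {0..1} t \<partial>lborel)"
      using aef aes aeG
    proof eventually_elim
      fix z assume z: "fst z \<in> S0" "snd z \<in> S1" and geo: "G z 0 = fst z \<and> G z 1 = snd z \<and>
        (\<forall>s\<in>{0..1}. \<forall>t\<in>{0..1}. dist (G z s) (G z t) = \<bar>s - t\<bar> * dist (fst z) (snd z))"
      have "dist x (fst z) < r" "dist x (snd z) < r" using z S0(2) S1(2) by auto
      then have d: "dist (fst z) (snd z) \<le> 2 * r" using dist_triangle3[of "fst z" "snd z" x] by simp
      have "ennreal \<bar>u (G z 0) - u (G z 1)\<bar>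
          \<le> ennreal (dist (fst z) (snd z)) * (\<integral>\<^sup>+t\<in>{0..1}. g (G z t) \<partial>lborel)"
        by (rule upper_gradient_geodesic[OF g]) (use geo in auto)
      also have "\<dots> \<le> ennreal (2 * r) * (\<integral>\<^sup>+t\<in>{0..1}. g (G z t) \<partial>lborel)"
        using d by (intro mult_right_mono ennreal_leI) auto
      finally show "ennreal \<bar>u (fst z) - u (snd z)\<bar>
          \<le> ennreal (2 * r) * (\<integral>\<^sup>+t. g (G z t) * indicator {0..1} t \<partial>lborel)"
        using geo by simp
    qed
  qed
  also have "\<dots> = ennreal (2 * r) * (\<integral>\<^sup>+z. \<integral>\<^sup>+t. g (G z t) * indicator {0..1} t \<partial>lborel \<partial>\<rho>)"
    using sigma_finite_measure.borel_measurable_nn_integral_fst[OF sigma_finite_lborel mgG]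
    by (intro nn_integral_cmult) simp
  also have "(\<integral>\<^sup>+z. \<integral>\<^sup>+t. g (G z t) * indicator {0..1} t \<partial>lborel \<partial>\<rho>)
      = (\<integral>\<^sup>+t. \<integral>\<^sup>+z. g (G z t) * indicator {0..1} t \<partial>\<rho> \<partial>lborel)"
    using P.Fubini'[OF mgG] by simp
  also have "\<dots> \<le> (\<integral>\<^sup>+t. ennreal c * I * indicator {0..1::real} t \<partial>lborel)"
  proof (rule nn_integral_mono)
    fix t :: real
    show "(\<integral>\<^sup>+z. g (G z t) * indicator {0..1} t \<partial>\<rho>) \<le> ennreal c * I * indicator {0..1} t"
      using inner[of t] by (cases "t \<in> {0..1}") auto
  qed
  also have "\<dots> = ennreal c * I" by (subst nn_integral_cmult_indicator) auto
  finally have "(\<integral>\<^sup>+z. ennreal \<bar>u (fst z) - u (snd z)\<bar> \<partial>\<rho>) \<le> ennreal (2 * r) * (ennreal c * I)"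
    by (simp add: mult_left_mono)
  also have "\<dots> = ennreal (2 * r * c) * I" using r c0 by (simp add: ennreal_mult mult.assoc)
  finally show ?thesis using that \<rho>c unfolding \<mu>0_def \<mu>1_def I_def by blast
qed

end

section \<open>The Poincare inequality\<close>

context displacement_convex_space
begin

lemma nn_integral_uniform_ball_subset:
  assumes S: "S \<in> sets borel" "S \<subseteq> ball y \<delta>" "emeasure m S \<noteq> 0" and f: "f \<in> borel_measurable borel"
  shows "(\<integral>\<^sup>+x. f x \<partial>uniform_measure m S) = (\<integral>\<^sup>+x\<in>S. f x \<partial>m) / ennreal (measure m S)"
proof -
  have "f \<in> borel_measurable m" using f sets_m by (simp cong: measurable_cong_sets)
  then show ?thesis
    using S(1) sets_m uniform_ball_subset(4)[OF S] by (subst nn_integral_uniform_measure') auto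
qed

text \<open>A continuous function may be unbounded on a ball that is not relatively compact, yet the
  mean value requires integrability. On the part where \<open>\<bar>u\<bar> > n\<close> the function
  is bounded by \<open>n\<close> plus its change under transport to the part where
  \<open>\<bar>u\<bar> \<le> n\<close>, and the transport inequality makes that change
  integrable.\<close>

lemma integrable_on_ball:
  assumes u: "continuous_on UNIV u" and g: "upper_gradient u g" and r: "0 < r"
    and I: "(\<integral>\<^sup>+y\<in>ball x (2 * r). g y \<partial>m) < \<infinity>"
  shows "(\<integral>\<^sup>+y\<in>ball x r. ennreal \<bar>u y\<bar> \<partial>m) < \<infinity>"
proof -
  define B where "B = ball x r"
  define L where "L n = B \<inter> {y. \<bar>u y\<bar> \<le> real n}" for n
  have cl: "closed {y. \<bar>u y\<bar> \<le> real n}" for n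
    by (intro closed_Collect_le continuous_on_rabs u continuous_on_const)
  have L: "L n \<in> sets borel" for n unfolding L_def B_def using cl by (intro sets.Int) auto
  have "(\<Union>n. L n) = B"
  proof -
    have "\<exists>n. \<bar>u y\<bar> \<le> real n" for y by (rule real_arch_simple)
    then show ?thesis unfolding L_def by blast
  qed
  \<comment> \<open>The sets \<open>L n\<close> exhaust a ball of positive measure; one of positive
    measure suffices as target of the transport.\<close>
  have "\<exists>n. emeasure m (L n) \<noteq> 0"
  proof (rule ccontr)
    assume "\<not> ?thesis"
    then have "emeasure m (\<Union>n. L n) = 0" using L sets_m by (intro emeasure_UN_eq_0) auto
    then show False using ball_pos[OF r, of x] \<open>(\<Union>n. L n) = B\<close> by (simp add: B_def)
  qed
  then obtain n where n: "emeasure m (L n) \<noteq> 0" by blast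
  define H where "H = B - L n"
  have H: "H \<in> sets borel" unfolding H_def B_def using L by (intro sets.Diff) auto
  have sub: "L n \<subseteq> ball x r" "H \<subseteq> ball x r" unfolding L_def H_def B_def by auto
  have mu: "(\<lambda>y. ennreal \<bar>u y\<bar>) \<in> borel_measurable borel"
    by (intro borel_measurable_continuous_onI continuous_on_ennreal continuous_on_rabs u)
  have mum: "(\<lambda>y. ennreal \<bar>u y\<bar>) \<in> borel_measurable m"
    using mu sets_m by (simp cong: measurable_cong_sets)
  have "(\<integral>\<^sup>+y\<in>H. ennreal \<bar>u y\<bar> \<partial>m) < \<infinity>"
  proof (cases "emeasure m H = 0")
    case True
    then have "H \<in> null_sets m" using H sets_m by auto
    then have "(\<integral>\<^sup>+y\<in>H. ennreal \<bar>u y\<bar> \<partial>m) = 0" by (rule nn_integral_null_set)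
    then show ?thesis by simp
  next
    case False
    note U0 = uniform_ball_subset[OF H sub(2) False] and U1 = uniform_ball_subset[OF L sub(1) n]
    define c where "c = max (1 / measure m H) (1 / measure m (L n))"
    obtain \<rho> where \<rho>: "\<rho> \<in> couplings (uniform_measure m H) (uniform_measure m (L n))"
      and le: "(\<integral>\<^sup>+z. ennreal \<bar>u (fst z) - u (snd z)\<bar> \<partial>\<rho>) \<le> ennreal (2 * r * c) * (\<integral>\<^sup>+y\<in>ball x (2 * r). g y \<partial>m)"
      by (rule transport_inequality[OF H sub(2) False L sub(1) n _ _ u g r, of c]) (auto simp: c_def)
    have \<rho>b: "\<rho> \<in> borel_probs" and f\<rho>: "distr \<rho> borel fst = uniform_measure m H"
      and s\<rho>: "distr \<rho> borel snd = uniform_measure m (L n)" using \<rho> by (auto simp: couplings_def)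
    interpret R: prob_space \<rho> by (rule borel_probsD[OF \<rho>b])
    have mfst: "fst \<in> borel_measurable \<rho>" and msnd: "snd \<in> borel_measurable \<rho>"
      unfolding borel_measurable_borel_probs[OF \<rho>b] by (rule borel_measurable_fst' borel_measurable_snd')+
    have ur: "u \<in> borel_measurable borel" by (rule borel_measurable_continuous_onI[OF u])
    have muf: "(\<lambda>z. u (fst z)) \<in> borel_measurable \<rho>" and mus: "(\<lambda>z. u (snd z)) \<in> borel_measurable \<rho>"
      by (rule measurable_compose[OF mfst ur] measurable_compose[OF msnd ur])+
    have aes: "AE z in \<rho>. snd z \<in> L n"
      using U1(6) L unfolding s\<rho>[symmetric] by (subst (asm) AE_distr_iff[OF msnd]) auto
    have "(\<integral>\<^sup>+y. ennreal \<bar>u y\<bar> \<partial>uniform_measure m H) = (\<integral>\<^sup>+z. ennreal \<bar>u (fst z)\<bar> \<partial>\<rho>)"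
      unfolding f\<rho>[symmetric] by (rule nn_integral_distr[OF mfst]) (use mu in simp)
    also have "\<dots> \<le> (\<integral>\<^sup>+z. ennreal (real n) + ennreal \<bar>u (fst z) - u (snd z)\<bar> \<partial>\<rho>)"
    proof (rule nn_integral_mono_AE, use aes in eventually_elim)
      fix z :: "'a \<times> 'a" assume "snd z \<in> L n"
      then have "\<bar>u (snd z)\<bar> \<le> real n" by (simp add: L_def)
      then have "\<bar>u (fst z)\<bar> \<le> real n + \<bar>u (fst z) - u (snd z)\<bar>" by linarith
      then show "ennreal \<bar>u (fst z)\<bar> \<le> ennreal (real n) + ennreal \<bar>u (fst z) - u (snd z)\<bar>"
        by (simp add: ennreal_plus[symmetric] ennreal_leI del: ennreal_plus)
    qed
    also have "\<dots> = ennreal (real n) + (\<integral>\<^sup>+z. ennreal \<bar>u (fst z) - u (snd z)\<bar> \<partial>\<rho>)"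
      using muf mus by (subst nn_integral_add) (auto simp: R.emeasure_space_1)
    also have "\<dots> < \<infinity>"
    proof -
      have "ennreal (2 * r * c) * (\<integral>\<^sup>+y\<in>ball x (2 * r). g y \<partial>m) < \<infinity>"
        using I by (simp add: ennreal_mult_less_top)
      then show ?thesis using le by (auto simp: ennreal_add_less_top intro: le_less_trans)
    qed
    finally have fin: "(\<integral>\<^sup>+y\<in>H. ennreal \<bar>u y\<bar> \<partial>m) / ennreal (measure m H) < \<infinity>"
      unfolding nn_integral_uniform_ball_subset[OF H sub(2) False mu] .
    show ?thesis
    proof (rule ccontr)
      assume "\<not> ?thesis"
      then have "(\<integral>\<^sup>+y\<in>H. ennreal \<bar>u y\<bar> \<partial>m) = \<infinity>" by (simp add: less_top[symmetric])
      then show False using fin by (simp add: ennreal_top_divide)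
    qed
  qed
  moreover have "(\<integral>\<^sup>+y\<in>L n. ennreal \<bar>u y\<bar> \<partial>m) < \<infinity>"
  proof -
    have "(\<integral>\<^sup>+y\<in>L n. ennreal \<bar>u y\<bar> \<partial>m) \<le> (\<integral>\<^sup>+y. ennreal (real n) * indicator (L n) y \<partial>m)"
      by (intro nn_integral_mono) (auto simp: L_def split: split_indicator intro!: ennreal_leI)
    also have "\<dots> = ennreal (real n) * emeasure m (L n)"
      using L sets_m by (subst nn_integral_cmult_indicator) auto
    also have "\<dots> < \<infinity>"
      by (subst uniform_ball_subset(4)[OF L sub(1) n]) (simp add: ennreal_mult_less_top)
    finally show ?thesis .
  qed
  moreover have "(\<integral>\<^sup>+y\<in>B. ennreal \<bar>u y\<bar> \<partial>m) = (\<integral>\<^sup>+y\<in>H. ennreal \<bar>u y\<bar> \<partial>m) + (\<integral>\<^sup>+y\<in>L n. ennreal \<bar>u y\<bar> \<partial>m)"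
  proof -
    have "(\<integral>\<^sup>+y\<in>B. ennreal \<bar>u y\<bar> \<partial>m)
        = (\<integral>\<^sup>+y. ennreal \<bar>u y\<bar> * indicator H y + ennreal \<bar>u y\<bar> * indicator (L n) y \<partial>m)"
      by (intro nn_integral_cong) (auto simp: H_def L_def split: split_indicator)
    also have "\<dots> = (\<integral>\<^sup>+y\<in>H. ennreal \<bar>u y\<bar> \<partial>m) + (\<integral>\<^sup>+y\<in>L n. ennreal \<bar>u y\<bar> \<partial>m)"
      using mum H L sets_m by (intro nn_integral_add borel_measurable_times_ennreal borel_measurable_indicator) auto
    finally show ?thesis .
  qed
  ultimately show ?thesis unfolding B_def by (simp add: ennreal_add_less_top)
qed

text \<open>Splitting the ball at the mean value \<open>a\<close> instead of a median avoids any discussion of atoms: the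
  two pieces carry the same integral \<open>J\<close> of \<open>|u - a|\<close>, and \<open>J (1 / p + 1 / q)\<close> is the
  transported amount, where \<open>p + q\<close> is the measure of the ball.\<close>

lemma oscillation_bound:
  assumes u: "continuous_on UNIV u" and g: "upper_gradient u g" and r: "0 < r"
    and I: "(\<integral>\<^sup>+y\<in>ball x (2 * r). g y \<partial>m) = ennreal i" "0 \<le> i"
  shows "(\<integral>\<^sup>+y\<in>ball x r. ennreal \<bar>u y - average m (ball x r) u\<bar> \<partial>m) \<le> ennreal (4 * r * i)"
proof -
  define B where "B = ball x r"
  define a where "a = average m B u"
  define b where "b = measure m B"
  have eB: "emeasure m B = ennreal b" using ball_finite[of x r] by (simp add: b_def B_def emeasure_eq_ennreal_measure less_top)
  have b: "0 < b" using ball_pos[OF r, of x] eB by (simp add: B_def)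
  have Bm: "B \<in> sets m" by (simp add: B_def sets_m)
  have ub: "u \<in> borel_measurable borel" by (rule borel_measurable_continuous_onI[OF u])
  have um: "u \<in> borel_measurable m" using ub sets_m by (simp cong: measurable_cong_sets)
  have iu: "integrable m (\<lambda>y. indicator B y * u y)"
  proof (rule integrableI_bounded)
    show "(\<lambda>y. indicator B y * u y) \<in> borel_measurable m" using um Bm by simp
    have "(\<integral>\<^sup>+y. ennreal (norm (indicator B y * u y)) \<partial>m) = (\<integral>\<^sup>+y\<in>B. ennreal \<bar>u y\<bar> \<partial>m)"
      by (intro nn_integral_cong) (auto split: split_indicator)
    also have "\<dots> < \<infinity>" unfolding B_def by (rule integrable_on_ball[OF u g r]) (simp add: I)
    finally show "(\<integral>\<^sup>+y. ennreal (norm (indicator B y * u y)) \<partial>m) < \<infinity>" .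
  qed
  have ii: "integrable m (indicator B :: 'a \<Rightarrow> real)" using Bm eB by simp
  define f where "f y = indicator B y * (u y - a)" for y
  have fi: "integrable m f"
    unfolding f_def using Bochner_Integration.integrable_diff[OF iu integrable_mult_right[OF ii, of a]] by (simp add: algebra_simps)
  have f0: "(\<integral>y. f y \<partial>m) = 0"
  proof -
    have "(\<integral>y. f y \<partial>m) = (\<integral>y. indicator B y * u y \<partial>m) - (\<integral>y. a * indicator B y \<partial>m)"
      unfolding f_def using Bochner_Integration.integral_diff[OF iu integrable_mult_right[OF ii, of a]]
      by (simp add: algebra_simps)
    also have "\<dots> = b * a - a * b"
    proof -
      have "(\<integral>y. indicator B y * u y \<partial>m) = b * a"
        using b unfolding a_def average_def b_def[symmetric] set_lebesgue_integral_def by simp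
      moreover have "(\<integral>y. a * indicator B y \<partial>m) = a * b" using Bm by (simp add: b_def space_m)
      ultimately show ?thesis by (simp only:)
    qed
    finally show ?thesis by simp
  qed
  define P where "P = B \<inter> {y. a < u y}"
  define Q where "Q = B \<inter> {y. u y \<le> a}"
  have "open {y. a < u y}" by (intro open_Collect_less u continuous_on_const)
  then have P: "P \<in> sets borel" unfolding P_def B_def by (intro sets.Int) auto
  have "closed {y. u y \<le> a}" by (intro closed_Collect_le u continuous_on_const)
  then have Q: "Q \<in> sets borel" unfolding Q_def B_def by (intro sets.Int) auto
  have sub: "P \<subseteq> ball x r" "Q \<subseteq> ball x r" unfolding P_def Q_def B_def by auto
  define J where "J = (\<integral>y. max 0 (f y) \<partial>m)"
  have J0: "0 \<le> J" unfolding J_def by simp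
  have mi: "integrable m (\<lambda>y. max 0 (f y))" "integrable m (\<lambda>y. max 0 (- f y))"
    using fi by (auto intro!: integrable_max)
  have J': "J = (\<integral>y. max 0 (- f y) \<partial>m)"
  proof -
    have "f = (\<lambda>y. max 0 (f y) - max 0 (- f y))" by (auto simp: max_def)
    then have "(\<integral>y. f y \<partial>m) = J - (\<integral>y. max 0 (- f y) \<partial>m)"
      using Bochner_Integration.integral_diff[OF mi] by (simp add: J_def)
    then show ?thesis using f0 by simp
  qed
  have JP: "(\<integral>\<^sup>+y\<in>P. ennreal (max 0 (u y - a)) \<partial>m) = ennreal J"
  proof -
    have "(\<integral>\<^sup>+y\<in>P. ennreal (max 0 (u y - a)) \<partial>m) = (\<integral>\<^sup>+y. ennreal (max 0 (f y)) \<partial>m)"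
      by (intro nn_integral_cong) (auto simp: P_def f_def ennreal_neg split: split_indicator)
    also have "\<dots> = ennreal J" unfolding J_def by (intro nn_integral_eq_integral mi) auto
    finally show ?thesis .
  qed
  have JQ: "(\<integral>\<^sup>+y\<in>Q. ennreal (max 0 (a - u y)) \<partial>m) = ennreal J"
  proof -
    have "(\<integral>\<^sup>+y\<in>Q. ennreal (max 0 (a - u y)) \<partial>m) = (\<integral>\<^sup>+y. ennreal (max 0 (- f y)) \<partial>m)"
      by (intro nn_integral_cong) (auto simp: Q_def f_def ennreal_neg split: split_indicator)
    also have "\<dots> = ennreal J" unfolding J' by (intro nn_integral_eq_integral mi) auto
    finally show ?thesis .
  qed
  have tot: "(\<integral>\<^sup>+y\<in>B. ennreal \<bar>u y - a\<bar> \<partial>m) = ennreal (2 * J)"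
  proof -
    have "(\<integral>\<^sup>+y\<in>B. ennreal \<bar>u y - a\<bar> \<partial>m) = (\<integral>\<^sup>+y. ennreal (max 0 (f y)) + ennreal (max 0 (- f y)) \<partial>m)"
      by (intro nn_integral_cong) (auto simp: f_def max_def split: split_indicator)
    also have "\<dots> = (\<integral>\<^sup>+y. ennreal (max 0 (f y)) \<partial>m) + (\<integral>\<^sup>+y. ennreal (max 0 (- f y)) \<partial>m)"
      using fi by (intro nn_integral_add) auto
    also have "(\<integral>\<^sup>+y. ennreal (max 0 (f y)) \<partial>m) = ennreal J"
      unfolding J_def by (intro nn_integral_eq_integral mi) auto
    also have "(\<integral>\<^sup>+y. ennreal (max 0 (- f y)) \<partial>m) = ennreal J"
      unfolding J' by (intro nn_integral_eq_integral mi) auto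
    finally show ?thesis using J0 by (simp add: ennreal_plus[symmetric] del: ennreal_plus)
  qed
  have "J \<le> 2 * r * i"
  \<comment> \<open>If one of the parts is null then \<open>J = 0\<close>, and there is nothing to
    transport.\<close>
  proof (cases "emeasure m P = 0 \<or> emeasure m Q = 0")
    case True
    then have "ennreal J = 0"
    proof
      assume "emeasure m P = 0"
      then have "P \<in> null_sets m" using P sets_m by auto
      then show ?thesis unfolding JP[symmetric] by (rule nn_integral_null_set)
    next
      assume "emeasure m Q = 0"
      then have "Q \<in> null_sets m" using Q sets_m by auto
      then show ?thesis unfolding JQ[symmetric] by (rule nn_integral_null_set)
    qed
    then show ?thesis using J0 r I(2) by simp
  next
    case False
    then have P0: "emeasure m P \<noteq> 0" and Q0: "emeasure m Q \<noteq> 0" by auto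
    note UP = uniform_ball_subset[OF P sub(1) P0] and UQ = uniform_ball_subset[OF Q sub(2) Q0]
    define p where "p = measure m P"
    define q' where "q' = measure m Q"
    have p: "0 < p" and q': "0 < q'" using UP(3) UQ(3) by (simp_all add: p_def q'_def)
    have pq: "p + q' = b"
    proof -
      have "emeasure m P + emeasure m Q = emeasure m (P \<union> Q)"
        using P Q sets_m by (intro plus_emeasure) (auto simp: P_def Q_def)
      also have "P \<union> Q = B" by (auto simp: P_def Q_def)
      finally have "ennreal (p + q') = ennreal b"
        unfolding eB UP(4) UQ(4) using p q' by (simp add: p_def q'_def ennreal_plus)
      then show ?thesis using p q' b by (simp add: ennreal_inj del: ennreal_plus)
    qed
    define c where "c = 1 / min p q'"
    have c: "1 / measure m P \<le> c" "1 / measure m Q \<le> c"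
      using p q' unfolding c_def p_def[symmetric] q'_def[symmetric] by (auto intro!: divide_left_mono)
    obtain \<rho> where \<rho>: "\<rho> \<in> couplings (uniform_measure m P) (uniform_measure m Q)"
      and le: "(\<integral>\<^sup>+z. ennreal \<bar>u (fst z) - u (snd z)\<bar> \<partial>\<rho>) \<le> ennreal (2 * r * c) * (\<integral>\<^sup>+y\<in>ball x (2 * r). g y \<partial>m)"
      by (rule transport_inequality[OF P sub(1) P0 Q sub(2) Q0 c u g r])
    have \<rho>b: "\<rho> \<in> borel_probs" and f\<rho>: "distr \<rho> borel fst = uniform_measure m P"
      and s\<rho>: "distr \<rho> borel snd = uniform_measure m Q" using \<rho> by (auto simp: couplings_def)
    have mfst: "fst \<in> borel_measurable \<rho>" and msnd: "snd \<in> borel_measurable \<rho>"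
      unfolding borel_measurable_borel_probs[OF \<rho>b] by (rule borel_measurable_fst' borel_measurable_snd')+
    have aef: "AE z in \<rho>. fst z \<in> P"
      using UP(6) P unfolding f\<rho>[symmetric] by (subst (asm) AE_distr_iff[OF mfst]) auto
    have aes: "AE z in \<rho>. snd z \<in> Q"
      using UQ(6) Q unfolding s\<rho>[symmetric] by (subst (asm) AE_distr_iff[OF msnd]) auto
    have m1: "(\<lambda>y. ennreal (max 0 (u y - a))) \<in> borel_measurable borel"
      and m2: "(\<lambda>y. ennreal (max 0 (a - u y))) \<in> borel_measurable borel" using ub by measurable
    \<comment> \<open>Under the plan the first point has value above \<open>a\<close> and the second
      at most \<open>a\<close>, so \<open>\<bar>u (fst z) - u (snd z)\<bar>\<close> splits at
      \<open>a\<close> into two terms that see one marginal each. Optimality of the plan was used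
      only for the density bound.\<close>
    have "ennreal J / ennreal p + ennreal J / ennreal q'
        = (\<integral>\<^sup>+y. ennreal (max 0 (u y - a)) \<partial>uniform_measure m P) + (\<integral>\<^sup>+y. ennreal (max 0 (a - u y)) \<partial>uniform_measure m Q)"
      unfolding nn_integral_uniform_ball_subset[OF P sub(1) P0 m1] nn_integral_uniform_ball_subset[OF Q sub(2) Q0 m2]
      by (simp only: JP JQ p_def q'_def)
    also have "\<dots> = (\<integral>\<^sup>+z. ennreal (max 0 (u (fst z) - a)) \<partial>\<rho>) + (\<integral>\<^sup>+z. ennreal (max 0 (a - u (snd z))) \<partial>\<rho>)"
      unfolding f\<rho>[symmetric] s\<rho>[symmetric]
      by (subst nn_integral_distr[OF mfst]) (use m1 m2 in \<open>simp_all add: nn_integral_distr[OF msnd]\<close>)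
    also have "\<dots> = (\<integral>\<^sup>+z. ennreal (max 0 (u (fst z) - a)) + ennreal (max 0 (a - u (snd z))) \<partial>\<rho>)"
      by (intro nn_integral_add[symmetric] measurable_compose[OF mfst m1] measurable_compose[OF msnd m2])
    also have "\<dots> = (\<integral>\<^sup>+z. ennreal \<bar>u (fst z) - u (snd z)\<bar> \<partial>\<rho>)"
    proof (rule nn_integral_cong_AE)
      show "AE z in \<rho>. ennreal (max 0 (u (fst z) - a)) + ennreal (max 0 (a - u (snd z))) = ennreal \<bar>u (fst z) - u (snd z)\<bar>"
        using aef aes
      proof eventually_elim
        fix z :: "'a \<times> 'a" assume "fst z \<in> P" "snd z \<in> Q"
        then have "a < u (fst z)" "u (snd z) \<le> a" by (auto simp: P_def Q_def)
        then show "ennreal (max 0 (u (fst z) - a)) + ennreal (max 0 (a - u (snd z))) = ennreal \<bar>u (fst z) - u (snd z)\<bar>"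
          by (simp add: ennreal_plus[symmetric] max_def del: ennreal_plus)
      qed
    qed
    also have "\<dots> \<le> ennreal (2 * r * c) * ennreal i" using le unfolding I(1) .
    finally have "ennreal (J / p + J / q') \<le> ennreal (2 * r * c * i)"
      using J0 p q' r I(2) by (simp add: divide_ennreal ennreal_plus ennreal_mult'')
    moreover have "0 \<le> 2 * r * c * i" using r I(2) p q' by (simp add: c_def)
    ultimately have "J / p + J / q' \<le> 2 * r * c * i" by (subst (asm) ennreal_le_iff) auto
    \<comment> \<open>Now \<open>J / p + J / q'\<close> equals \<open>J * b / (p * q')\<close> and
      \<open>c\<close> equals \<open>max p q' / (p * q')\<close>. Since
      \<open>max p q' \<le> b\<close>, the sizes of the two parts cancel, however uneven the
      splitting is.\<close>
    moreover have "J / p + J / q' = J * b / (p * q')" using p q' unfolding pq[symmetric] by (simp add: field_simps)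
    moreover have "c = max p q' / (p * q')" using p q' by (simp add: c_def min_def max_def)
    ultimately have "J * b / (p * q') \<le> (2 * r * i) * max p q' / (p * q')" by (simp add: mult.commute mult.left_commute)
    then have "J * b \<le> (2 * r * i) * max p q'" using p q' by (simp add: divide_le_cancel)
    also have "\<dots> \<le> (2 * r * i) * b" using pq p q' r I(2) by (intro mult_left_mono) auto
    finally show ?thesis by (rule mult_right_le_imp_le) (rule b)
  qed
  \<comment> \<open>The oscillation counts both sides of the mean, hence the factor \<open>4\<close>
    instead of \<open>2\<close>.\<close>
  then have "ennreal (2 * J) \<le> ennreal (4 * r * i)" by (intro ennreal_leI) (simp add: mult.commute mult.left_commute)
  then show ?thesis using tot unfolding a_def B_def by simp
qed

text \<open>The oscillation bound is divided by \<open>b\<close>, and doubling in the form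
  \<open>1 / b \<le> 2 powr N * (1 / d)\<close> changes the normalisation to the larger ball;
  \<open>4 * 2 powr N\<close> is \<open>2 powr (N + 2)\<close>. If \<open>g\<close> has infinite
  integral over the larger ball, the right-hand side is infinite.\<close>

theorem poincare_inequality:
  assumes u: "continuous_on UNIV u" and g: "upper_gradient u g" and r: "0 < r"
  shows "nn_average m (ball x r) (\<lambda>y. ennreal \<bar>u y - average m (ball x r) u\<bar>)
     \<le> ennreal (2 powr (N + 2)) * ennreal r * nn_average m (ball x (2 * r)) g"
proof -
  define b where "b = measure m (ball x r)"
  define d where "d = measure m (ball x (2 * r))"
  have fin: "emeasure m (ball x s) = ennreal (measure m (ball x s))" for s
    using ball_finite[of x s] by (simp add: emeasure_eq_ennreal_measure)
  have b: "0 < b" using ball_pos[OF r, of x] fin[of r] by (simp add: b_def)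
  have d: "0 < d" using ball_pos[of "2 * r" x] r fin[of "2 * r"] by (simp add: d_def)
  have db: "d \<le> 2 powr N * b" unfolding b_def d_def by (rule doubling[OF r])
  have inv: "1 / ennreal s = ennreal (1 / s)" if "0 < s" for s
    using divide_ennreal[of 1 s] that by simp
  show ?thesis
  proof (cases "(\<integral>\<^sup>+y\<in>ball x (2 * r). g y \<partial>m) = \<infinity>")
    case True
    have "nn_average m (ball x (2 * r)) g = ennreal (1 / d) * \<infinity>"
      unfolding nn_average_def True fin d_def[symmetric] inv[OF d] ..
    then have "nn_average m (ball x (2 * r)) g = \<infinity>" using d by (simp add: ennreal_mult_top)
    moreover have "ennreal (2 powr (N + 2)) * ennreal r \<noteq> 0" using r by simp
    ultimately show ?thesis by (simp add: ennreal_mult_top)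
  next
    case False
    then obtain i where i: "(\<integral>\<^sup>+y\<in>ball x (2 * r). g y \<partial>m) = ennreal i" "0 \<le> i"
      by (metis ennreal_cases infinity_ennreal_def)
    have "nn_average m (ball x r) (\<lambda>y. ennreal \<bar>u y - average m (ball x r) u\<bar>) \<le> ennreal (1 / b) * ennreal (4 * r * i)"
      unfolding nn_average_def fin b_def[symmetric] inv[OF b]
      by (intro mult_left_mono oscillation_bound[OF u g r i]) simp
    also have "\<dots> = ennreal (1 / b * (4 * r * i))"
      using b r i(2) by (intro ennreal_mult[symmetric]) simp_all
    also have "1 / b * (4 * r * i) = 4 * r * i * (1 / b)" by (rule mult.commute)
    also have "ennreal (4 * r * i * (1 / b)) \<le> ennreal (4 * r * i * (2 powr N * (1 / d)))"
    proof (intro ennreal_leI mult_left_mono)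
      show "1 / b \<le> 2 powr N * (1 / d)" using db b d by (simp add: field_simps)
    qed (use r i(2) in simp)
    also have "4 * r * i * (2 powr N * (1 / d)) = 2 powr (N + 2) * r * (1 / d * i)"
      by (simp add: powr_add)
    also have "ennreal \<dots> = ennreal (2 powr (N + 2)) * ennreal r * (ennreal (1 / d) * ennreal i)"
    proof -
      have "ennreal (2 powr (N + 2) * r * (1 / d * i)) = ennreal (2 powr (N + 2) * r) * ennreal (1 / d * i)"
        using r d i(2) by (intro ennreal_mult) simp_all
      also have "ennreal (2 powr (N + 2) * r) = ennreal (2 powr (N + 2)) * ennreal r"
        using r by (intro ennreal_mult) simp_all
      also have "ennreal (1 / d * i) = ennreal (1 / d) * ennreal i"
        using d i(2) by (intro ennreal_mult) simp_all
      finally show ?thesis .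
    qed
    also have "ennreal (1 / d) * ennreal i = nn_average m (ball x (2 * r)) g"
      unfolding nn_average_def i(1) fin d_def[symmetric] inv[OF d] ..
    finally show ?thesis .
  qed
qed

end

theorem corollary1p4:
  fixes m :: "'a::complete_space measure"
    and N :: real
    and u :: "'a \<Rightarrow> real"
    and g :: "'a \<Rightarrow> ennreal"
    and x :: 'a
    and r :: real
  assumes "N \<ge> 1"
    and "geodesic_space (UNIV :: 'a set)"
    and "sets m = sets borel"
    and "measure_support m = UNIV"
    and "\<And>y \<delta>. emeasure m (ball y \<delta>) < \<infinity>"
    and "strongly_displacement_convex (renyi_entropy N m)"
    and "continuous_on UNIV u"
    and "upper_gradient u g"
    and "r > 0"
  shows "nn_average m (ball x r) (\<lambda>y. ennreal \<bar>u y - average m (ball x r) u\<bar>)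
           \<le> ennreal (2 powr (N + 2)) * ennreal r * nn_average m (ball x (2 * r)) g"
proof -
  obtain q :: "nat \<Rightarrow> 'a" where "dense_sequence q"
    using ex_dense_sequence[OF assms(3,4,5)] by blast
  then interpret dense_sequence q .
  interpret displacement_convex_space q m N
    by unfold_locales (use assms(1-6) in blast)+
  show ?thesis by (rule poincare_inequality[OF assms(7-9)])
qed

end
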